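(* The functor $\mathcal{F}^m:\mathbf{Pcoh}_!\to\mathbf{Cstab_m}$ defined by $\mathcal{F}^mX=$ the measurable cone $\mathcal{F}^mX$ and $\mathcal{F}^mf=\hat f$ is full and faithful.
   Context: PCS $X=(|X|,\mathcal{P}(X))$: $|X|$ countable, $\mathcal{P}(X)\subseteq\mathbb{R}_{\ge0}^{|X|}$, $\mathcal{P}(X)^{\perp\perp}=\mathcal{P}(X)$ with $S^\perp=\{u:\sum_au_av_a\le1\ \forall v\in S\}$, each $a$ having $\lambda>0$ with $\lambda e_a\in\mathcal{P}(X)$ and a bound on $u_a$ over $\mathcal{P}(X)$. $\mathbf{Pcoh}_!$: objects PCSs; $\mathbf{Pcoh}_!(X,Y)$ = matrices $f\in\mathbb{R}_{\ge0}^{\mathcal{M}_{fin}(|X|)\times|Y|}$ with $\hat f(x):=f\cdot x^!\in\mathcal{P}(Y)$ for all $x\in\mathcal{P}(X)$, $(f\cdot x^!)_b=\sum_\mu f_{\mu,b}\prod_ax_a^{\mu(a)}$; composition corresponds to composition of the maps $\hat f$. Cone $\mathcal{F}X=\{\alpha x:\alpha\ge0,x\in\mathcal{P}(X)\}$, pointwise operations, norm $\inf\{1/r:r>0,rx\in\mathcal{P}(X)\}$, unit ball $\mathcal{P}(X)$. Measurable cone: a sequentially complete cone $C$ with families $\mathcal{M}_n(C)$ of functions from $\mathbb{R}^n$ to linear Scott-continuous maps $C\to\mathbb{R}_{\ge0}$, containing $0$, closed under precomposition with Borel measurable maps $\mathbb{R}^p\to\mathbb{R}^n$, and with $\vec u\mapsto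 l(\vec u)(x)$ measurable. Measurable path of arity $n$: $\gamma:\mathbb{R}^n\to C$ with bounded image, $(\vec r,\vec s)\mapsto l(\vec r)(\gamma(\vec s))$ Borel measurable for all $l\in\mathcal{M}_k(C)$; unitary if image in the unit ball. $\mathbf{Cstab_m}$: objects measurable cones; morphisms $C\to D$ are stable functions (pre-stable: $\sum_{I\subseteq\{1..n\},\,n-|I|\text{ odd}}f(x+\sum_{i\in I}u_i)\le\sum_{I,\,n-|I|\text{ even}}f(x+\sum_{i\in I}u_i)$ whenever $x+\sum u_i$ is in the unit ball; preserving lubs of nondecreasing sequences; bounded) from the unit ball of $C$ into the unit ball of $D$ that send unitary measurable paths of $C$ to measurable paths of $D$. The measurable cone $\mathcal{F}^mX$ is $\mathcal{F}X$ with tests $\mathcal{M}_n=\{0\}\cup\{\epsilon_a:a\in|X|\}$, $\epsilon_a(\vec r)(x)=x_a$. *)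

theory Defs
  imports "HOL-Analysis.Analysis" "HOL-Algebra.Module" "HOL-Library.Multiset"
begin

section \<open>Categories and functors\<close>

text \<open>The composite of \<open>f : A \<rightarrow> B\<close> and \<open>g : B \<rightarrow> C\<close> is \<open>Comp \<K> A B C g f\<close>.\<close>

record ('o, 'm) category =
  Obj :: "'o set"
  Hom :: "'o \<Rightarrow> 'o \<Rightarrow> 'm set"
  Id :: "'o \<Rightarrow> 'm"
  Comp :: "'o \<Rightarrow> 'o \<Rightarrow> 'o \<Rightarrow> 'm \<Rightarrow> 'm \<Rightarrow> 'm"

definition is_category :: "('o, 'm) category \<Rightarrow> bool" where
  "is_category \<K> \<longleftrightarrow>
     (\<forall>A\<in>Obj \<K>. Id \<K> A \<in> Hom \<K> A A) \<and>
     (\<forall>A\<in>Obj \<K>. \<forall>B\<in>Obj \<K>. \<forall>C\<in>Obj \<K>. \<forall>f\<in>Hom \<K> A B. \<forall>g\<in>Hom \<K> B C.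
        Comp \<K> A B C g f \<in> Hom \<K> A C) \<and>
     (\<forall>A\<in>Obj \<K>. \<forall>B\<in>Obj \<K>. \<forall>f\<in>Hom \<K> A B.
        Comp \<K> A A B f (Id \<K> A) = f \<and> Comp \<K> A B B (Id \<K> B) f = f) \<and>
     (\<forall>A\<in>Obj \<K>. \<forall>B\<in>Obj \<K>. \<forall>C\<in>Obj \<K>. \<forall>D\<in>Obj \<K>.
        \<forall>f\<in>Hom \<K> A B. \<forall>g\<in>Hom \<K> B C. \<forall>h\<in>Hom \<K> C D.
        Comp \<K> A C D h (Comp \<K> A B C g f) = Comp \<K> A B D (Comp \<K> B C D h g) f)"

definition is_functor ::
  "('o, 'm) category \<Rightarrow> ('p, 'n) category \<Rightarrow> ('o \<Rightarrow> 'p) \<Rightarrow> ('o \<Rightarrow> 'o \<Rightarrow> 'm \<Rightarrow> 'n) \<Rightarrow> bool" where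
  "is_functor \<K> \<L> F\<^sub>o F\<^sub>m \<longleftrightarrow>
     is_category \<K> \<and> is_category \<L> \<and>
     (\<forall>A\<in>Obj \<K>. F\<^sub>o A \<in> Obj \<L>) \<and>
     (\<forall>A\<in>Obj \<K>. \<forall>B\<in>Obj \<K>. \<forall>f\<in>Hom \<K> A B. F\<^sub>m A B f \<in> Hom \<L> (F\<^sub>o A) (F\<^sub>o B)) \<and>
     (\<forall>A\<in>Obj \<K>. F\<^sub>m A A (Id \<K> A) = Id \<L> (F\<^sub>o A)) \<and>
     (\<forall>A\<in>Obj \<K>. \<forall>B\<in>Obj \<K>. \<forall>C\<in>Obj \<K>. \<forall>f\<in>Hom \<K> A B. \<forall>g\<in>Hom \<K> B C.
        F\<^sub>m A C (Comp \<K> A B C g f) = Comp \<L> (F\<^sub>o A) (F\<^sub>o B) (F\<^sub>o C) (F\<^sub>m B C g) (F\<^sub>m A B f))"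

definition is_full ::
  "('o, 'm) category \<Rightarrow> ('p, 'n) category \<Rightarrow> ('o \<Rightarrow> 'p) \<Rightarrow> ('o \<Rightarrow> 'o \<Rightarrow> 'm \<Rightarrow> 'n) \<Rightarrow> bool" where
  "is_full \<K> \<L> F\<^sub>o F\<^sub>m \<longleftrightarrow>
     (\<forall>A\<in>Obj \<K>. \<forall>B\<in>Obj \<K>. \<forall>g\<in>Hom \<L> (F\<^sub>o A) (F\<^sub>o B). \<exists>f\<in>Hom \<K> A B. F\<^sub>m A B f = g)"

definition is_faithful ::
  "('o, 'm) category \<Rightarrow> ('o \<Rightarrow> 'o \<Rightarrow> 'm \<Rightarrow> 'n) \<Rightarrow> bool" where
  "is_faithful \<K> F\<^sub>m \<longleftrightarrow> (\<forall>A\<in>Obj \<K>. \<forall>B\<in>Obj \<K>. inj_on (F\<^sub>m A B) (Hom \<K> A B))"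


section \<open>Probabilistic coherence spaces\<close>

record 'a pcs =
  web :: "'a set"
  pts :: "('a \<Rightarrow> real) set"

text \<open>Families over a set \<open>A\<close> of nonnegative reals, represented as functions vanishing
  outside \<open>A\<close>, so that each family has exactly one representative and the pointwise operations
  need no restriction.\<close>

definition nnvec :: "'a set \<Rightarrow> ('a \<Rightarrow> real) set" where
  "nnvec A = {u. (\<forall>a\<in>A. 0 \<le> u a) \<and> (\<forall>a. a \<notin> A \<longrightarrow> u a = 0)}"

definition polar :: "'a set \<Rightarrow> ('a \<Rightarrow> real) set \<Rightarrow> ('a \<Rightarrow> real) set" where
  "polar A S = {u \<in> nnvec A. \<forall>v\<in>S. (\<Sum>\<^sub>\<infinity>a\<in>A. ennreal (u a * v a)) \<le> 1}"

definition is_pcs :: "'a pcs \<Rightarrow> bool" where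
  "is_pcs X \<longleftrightarrow>
     countable (web X) \<and>
     pts X \<subseteq> nnvec (web X) \<and>
     polar (web X) (polar (web X) (pts X)) = pts X \<and>
     (\<forall>a\<in>web X. \<exists>c>0. (\<lambda>b. if b = a then c else 0) \<in> pts X) \<and>
     (\<forall>a\<in>web X. \<exists>M. \<forall>u\<in>pts X. u a \<le> M)"

definition mfin :: "'a set \<Rightarrow> 'a multiset set" where
  "mfin A = {\<mu>. set_mset \<mu> \<subseteq> A}"

definition monomial :: "('a \<Rightarrow> real) \<Rightarrow> 'a multiset \<Rightarrow> real" where
  "monomial x \<mu> = (\<Prod>a\<in>set_mset \<mu>. x a ^ count \<mu> a)"

text \<open>The power series of a matrix is evaluated in \<open>[0, \<infinity>]\<close>; its finiteness is part of being a
  morphism, so that \<open>enn2real\<close> in \<open>hat\<close> loses nothing there.\<close>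

definition series :: "'a pcs \<Rightarrow> ('a multiset \<Rightarrow> 'b \<Rightarrow> real) \<Rightarrow> ('a \<Rightarrow> real) \<Rightarrow> 'b \<Rightarrow> ennreal" where
  "series X f x b = (\<Sum>\<^sub>\<infinity>\<mu>\<in>mfin (web X). ennreal (f \<mu> b * monomial x \<mu>))"

definition hat :: "'a pcs \<Rightarrow> ('a multiset \<Rightarrow> 'b \<Rightarrow> real) \<Rightarrow> ('a \<Rightarrow> real) \<Rightarrow> 'b \<Rightarrow> real" where
  "hat X f x = (\<lambda>b. enn2real (series X f x b))"

definition pcoh_hom :: "'a pcs \<Rightarrow> 'b pcs \<Rightarrow> ('a multiset \<Rightarrow> 'b \<Rightarrow> real) set" where
  "pcoh_hom X Y =
     {f. (\<forall>\<mu>\<in>mfin (web X). \<forall>b\<in>web Y. 0 \<le> f \<mu> b) \<and>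
         (\<forall>\<mu> b. \<mu> \<notin> mfin (web X) \<or> b \<notin> web Y \<longrightarrow> f \<mu> b = 0) \<and>
         (\<forall>x\<in>pts X. (\<forall>b\<in>web Y. series X f x b < \<infinity>) \<and> hat X f x \<in> pts Y)}"

definition pcoh_id :: "'a pcs \<Rightarrow> 'a multiset \<Rightarrow> 'a \<Rightarrow> real" where
  "pcoh_id X = (\<lambda>\<mu> a. if a \<in> web X \<and> \<mu> = {#a#} then 1 else 0)"

text \<open>Composition of matrices is the one that corresponds to composition of the associated
  maps. That such a matrix exists and is unique is part of \<open>Pcoh\<close> being a category and
  \<open>f \<mapsto> hat X f\<close> being functorial.\<close>

definition pcoh_comp ::
  "'a pcs \<Rightarrow> 'b pcs \<Rightarrow> 'c pcs \<Rightarrow> ('b multiset \<Rightarrow> 'c \<Rightarrow> real) \<Rightarrow> ('a multiset \<Rightarrow> 'b \<Rightarrow> real)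
     \<Rightarrow> ('a multiset \<Rightarrow> 'c \<Rightarrow> real)" where
  "pcoh_comp X Y Z g f =
     (THE h. h \<in> pcoh_hom X Z \<and> (\<forall>x\<in>pts X. hat X h x = hat Y g (hat X f x)))"

definition Pcoh :: "('a pcs, 'a multiset \<Rightarrow> 'a \<Rightarrow> real) category" where
  "Pcoh = \<lparr>Obj = {X. is_pcs X}, Hom = pcoh_hom, Id = pcoh_id, Comp = pcoh_comp\<rparr>"


section \<open>Cones\<close>

text \<open>Cones live on the library's module record; its fields \<open>mult\<close> and \<open>one\<close> play no role, and
  only nonnegative scalars are relevant.\<close>

record 'c cone = "(real, 'c) module" +
  cnorm :: "'c \<Rightarrow> real"

locale normed_cone = abelian_monoid C for C :: "('c, 'm) cone_scheme" (structure) +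
  assumes smult_closed: "\<lbrakk>0 \<le> \<alpha>; x \<in> carrier C\<rbrakk> \<Longrightarrow> \<alpha> \<odot> x \<in> carrier C"
    and smult_l_distr: "\<lbrakk>0 \<le> \<alpha>; 0 \<le> \<beta>; x \<in> carrier C\<rbrakk> \<Longrightarrow> (\<alpha> + \<beta>) \<odot> x = \<alpha> \<odot> x \<oplus> \<beta> \<odot> x"
    and smult_r_distr: "\<lbrakk>0 \<le> \<alpha>; x \<in> carrier C; y \<in> carrier C\<rbrakk> \<Longrightarrow> \<alpha> \<odot> (x \<oplus> y) = \<alpha> \<odot> x \<oplus> \<alpha> \<odot> y"
    and smult_assoc: "\<lbrakk>0 \<le> \<alpha>; 0 \<le> \<beta>; x \<in> carrier C\<rbrakk> \<Longrightarrow> (\<alpha> * \<beta>) \<odot> x = \<alpha> \<odot> (\<beta> \<odot> x)"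
    and smult_one: "x \<in> carrier C \<Longrightarrow> 1 \<odot> x = x"
    and add_cancel: "\<lbrakk>x \<in> carrier C; y \<in> carrier C; z \<in> carrier C; x \<oplus> y = x \<oplus> z\<rbrakk> \<Longrightarrow> y = z"
    and cnorm_nonneg: "x \<in> carrier C \<Longrightarrow> 0 \<le> cnorm C x"
    and cnorm_smult: "\<lbrakk>0 \<le> \<alpha>; x \<in> carrier C\<rbrakk> \<Longrightarrow> cnorm C (\<alpha> \<odot> x) = \<alpha> * cnorm C x"
    and cnorm_triangle: "\<lbrakk>x \<in> carrier C; y \<in> carrier C\<rbrakk> \<Longrightarrow> cnorm C (x \<oplus> y) \<le> cnorm C x + cnorm C y"
    and cnorm_eq_0: "\<lbrakk>x \<in> carrier C; cnorm C x = 0\<rbrakk> \<Longrightarrow> x = \<zero>"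
    and cnorm_mono: "\<lbrakk>x \<in> carrier C; y \<in> carrier C\<rbrakk> \<Longrightarrow> cnorm C x \<le> cnorm C (x \<oplus> y)"

definition cone_ball :: "('c, 'm) cone_scheme \<Rightarrow> 'c set" where
  "cone_ball C = {x \<in> carrier C. cnorm C x \<le> 1}"

definition cone_le :: "('c, 'm) cone_scheme \<Rightarrow> 'c \<Rightarrow> 'c \<Rightarrow> bool" where
  "cone_le C x y \<longleftrightarrow> (\<exists>z\<in>carrier C. y = x \<oplus>\<^bsub>C\<^esub> z)"

definition cone_incseq :: "('c, 'm) cone_scheme \<Rightarrow> (nat \<Rightarrow> 'c) \<Rightarrow> bool" where
  "cone_incseq C s \<longleftrightarrow> (\<forall>n. cone_le C (s n) (s (Suc n)))"

definition cone_lub :: "('c, 'm) cone_scheme \<Rightarrow> (nat \<Rightarrow> 'c) \<Rightarrow> 'c \<Rightarrow> bool" where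
  "cone_lub C s x \<longleftrightarrow> x \<in> carrier C \<and> (\<forall>n. cone_le C (s n) x) \<and>
     (\<forall>y\<in>carrier C. (\<forall>n. cone_le C (s n) y) \<longrightarrow> cone_le C x y)"

locale seq_complete_cone = normed_cone +
  assumes seq_complete: "\<lbrakk>range s \<subseteq> cone_ball C; cone_incseq C s\<rbrakk> \<Longrightarrow> \<exists>x\<in>cone_ball C. cone_lub C s x"

definition cone_dual :: "('c, 'm) cone_scheme \<Rightarrow> ('c \<Rightarrow> real) set" where
  "cone_dual C = {l \<in> carrier C \<rightarrow>\<^sub>E {0..}.
     (\<forall>x\<in>carrier C. \<forall>y\<in>carrier C. l (x \<oplus>\<^bsub>C\<^esub> y) = l x + l y) \<and>
     (\<forall>\<alpha>\<ge>0. \<forall>x\<in>carrier C. l (\<alpha> \<odot>\<^bsub>C\<^esub> x) = \<alpha> * l x) \<and>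
     (\<forall>s x. range s \<subseteq> carrier C \<longrightarrow> cone_incseq C s \<longrightarrow> cone_lub C s x \<longrightarrow> l x = (SUP n. l (s n)))}"


section \<open>Measurable cones\<close>

abbreviation RR :: "nat \<Rightarrow> (nat \<Rightarrow> real) measure" where
  "RR n \<equiv> (\<Pi>\<^sub>M i\<in>{..<n}. borel)"

record 'c mcone = "'c cone" +
  tests :: "nat \<Rightarrow> ((nat \<Rightarrow> real) \<Rightarrow> 'c \<Rightarrow> real) set"

locale measurable_cone = seq_complete_cone C for C :: "('c, 'm) mcone_scheme" (structure) +
  assumes tests_dual: "tests C n \<subseteq> space (RR n) \<rightarrow>\<^sub>E cone_dual C"
    and tests_zero: "(\<lambda>r\<in>space (RR n). \<lambda>x\<in>carrier C. 0) \<in> tests C n"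
    and tests_comp: "\<lbrakk>l \<in> tests C n; h \<in> RR p \<rightarrow>\<^sub>M RR n\<rbrakk> \<Longrightarrow> (\<lambda>r\<in>space (RR p). l (h r)) \<in> tests C p"
    and tests_measurable: "\<lbrakk>l \<in> tests C n; x \<in> carrier C\<rbrakk> \<Longrightarrow> (\<lambda>r. l r x) \<in> borel_measurable (RR n)"

definition measurable_path :: "('c, 'm) mcone_scheme \<Rightarrow> nat \<Rightarrow> ((nat \<Rightarrow> real) \<Rightarrow> 'c) \<Rightarrow> bool" where
  "measurable_path C n \<gamma> \<longleftrightarrow>
     \<gamma> \<in> space (RR n) \<rightarrow> carrier C \<and>
     (\<exists>M. \<forall>s\<in>space (RR n). cnorm C (\<gamma> s) \<le> M) \<and>
     (\<forall>k. \<forall>l\<in>tests C k. (\<lambda>(r, s). l r (\<gamma> s)) \<in> borel_measurable (RR k \<Otimes>\<^sub>M RR n))"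

definition unitary_path :: "('c, 'm) mcone_scheme \<Rightarrow> nat \<Rightarrow> ((nat \<Rightarrow> real) \<Rightarrow> 'c) \<Rightarrow> bool" where
  "unitary_path C n \<gamma> \<longleftrightarrow> measurable_path C n \<gamma> \<and> \<gamma> \<in> space (RR n) \<rightarrow> cone_ball C"


section \<open>Stable functions\<close>

definition prestable :: "('c, 'm) cone_scheme \<Rightarrow> ('d, 'n) cone_scheme \<Rightarrow> ('c \<Rightarrow> 'd) \<Rightarrow> bool" where
  "prestable C D f \<longleftrightarrow>
     (\<forall>n x u. x \<in> carrier C \<longrightarrow> u \<in> {1..n} \<rightarrow> carrier C \<longrightarrow>
        x \<oplus>\<^bsub>C\<^esub> (\<Oplus>\<^bsub>C\<^esub>i\<in>{1..n}. u i) \<in> cone_ball C \<longrightarrow>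
        cone_le D
          (\<Oplus>\<^bsub>D\<^esub>I\<in>{I. I \<subseteq> {1..n} \<and> odd (n - card I)}. f (x \<oplus>\<^bsub>C\<^esub> (\<Oplus>\<^bsub>C\<^esub>i\<in>I. u i)))
          (\<Oplus>\<^bsub>D\<^esub>I\<in>{I. I \<subseteq> {1..n} \<and> even (n - card I)}. f (x \<oplus>\<^bsub>C\<^esub> (\<Oplus>\<^bsub>C\<^esub>i\<in>I. u i))))"

definition stable :: "('c, 'm) cone_scheme \<Rightarrow> ('d, 'n) cone_scheme \<Rightarrow> ('c \<Rightarrow> 'd) \<Rightarrow> bool" where
  "stable C D f \<longleftrightarrow>
     f \<in> cone_ball C \<rightarrow> carrier D \<and>
     prestable C D f \<and>
     (\<forall>s. \<forall>x\<in>cone_ball C. range s \<subseteq> cone_ball C \<longrightarrow> cone_incseq C s \<longrightarrow> cone_lub C s x \<longrightarrow>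
        cone_lub D (\<lambda>n. f (s n)) (f x)) \<and>
     (\<exists>M. \<forall>x\<in>cone_ball C. cnorm D (f x) \<le> M)"

definition cstabm_hom :: "('c, 'm) mcone_scheme \<Rightarrow> ('d, 'n) mcone_scheme \<Rightarrow> ('c \<Rightarrow> 'd) set" where
  "cstabm_hom C D =
     {f \<in> cone_ball C \<rightarrow>\<^sub>E cone_ball D.
        stable C D f \<and>
        (\<forall>n \<gamma>. unitary_path C n \<gamma> \<longrightarrow> measurable_path D n (\<lambda>r. f (\<gamma> r)))}"

definition Cstabm :: "('c mcone, 'c \<Rightarrow> 'c) category" where
  "Cstabm = \<lparr>Obj = {C. measurable_cone C}, Hom = cstabm_hom,
     Id = (\<lambda>C. \<lambda>x\<in>cone_ball C. x), Comp = (\<lambda>C D E g f. compose (cone_ball C) g f)\<rparr>"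


section \<open>The functor\<close>

definition Fm_carrier :: "'a pcs \<Rightarrow> ('a \<Rightarrow> real) set" where
  "Fm_carrier X = {(\<lambda>a. \<alpha> * x a) | \<alpha> x. 0 \<le> \<alpha> \<and> x \<in> pts X}"

definition Fm_obj :: "'a pcs \<Rightarrow> ('a \<Rightarrow> real) mcone" where
  "Fm_obj X =
     \<lparr>carrier = Fm_carrier X,
      mult = (\<lambda>_ _. undefined), one = undefined,
      zero = (\<lambda>_. 0), add = (\<lambda>x y a. x a + y a),
      smult = (\<lambda>\<alpha> x a. \<alpha> * x a),
      cnorm = (\<lambda>x. Inf {1 / r | r. 0 < r \<and> (\<lambda>a. r * x a) \<in> pts X}),
      tests = (\<lambda>n. {\<lambda>r\<in>space (RR n). \<lambda>x\<in>Fm_carrier X. 0} \<union>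
                   {(\<lambda>r\<in>space (RR n). \<lambda>x\<in>Fm_carrier X. x a) | a. a \<in> web X})\<rparr>"

definition Fm_mor :: "'a pcs \<Rightarrow> 'b pcs \<Rightarrow> ('a multiset \<Rightarrow> 'b \<Rightarrow> real) \<Rightarrow> ('a \<Rightarrow> real) \<Rightarrow> 'b \<Rightarrow> real" where
  "Fm_mor X Y f = (\<lambda>x\<in>pts X. hat X f x)"

end

theory Submission
  imports Defs
begin

text \<open>
  A function \<open>f\<close> between cones is pre-stable iff each of its cubes \<open>I \<mapsto> f (x + \<Sum>i\<in>I. u i)\<close> is of the
  form \<open>I \<mapsto> \<Sum>J\<subseteq>I. d J\<close> with all \<open>d J\<close> in the cone; the \<open>d J\<close> are the iterated differences. In this
  form closure under composition only requires grouping the increments of the outer function by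
  the union of their index sets, and power series with nonnegative coefficients are seen to be
  pre-stable.

  For fullness, fix a coordinate \<open>\<phi>\<close> of a stable map and expand it at the dyadic points of mesh
  \<open>2\<^sup>-\<^sup>n\<close> by Newton's formula. The coefficients are divided differences of \<open>\<phi>\<close> at the origin; they are
  nonnegative and decrease as the mesh is halved, hence converge. At a dyadic point shrunk by a
  factor \<open>r < 1\<close> the terms of degree \<open>p\<close> are bounded by a multiple of \<open>r\<^sup>p\<close> uniformly in \<open>n\<close>, so by
  dominated convergence \<open>\<phi>\<close> is there the power series of the limit coefficients. Scott continuity
  extends this to all points. Faithfulness is the uniqueness of power series coefficients, by
  induction on the number of variables. Existence of composites of matrices follows from fullness.
\<close>

section \<open>Cubes and their iterated differences\<close>

definition cube_differences :: "('c, 'm) ring_scheme \<Rightarrow> 'i set \<Rightarrow> ('i set \<Rightarrow> 'c) \<Rightarrow> ('i set \<Rightarrow> 'c) \<Rightarrow> bool" where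
  "cube_differences G N F d \<longleftrightarrow> d \<in> Pow N \<rightarrow> carrier G \<and> (\<forall>I\<subseteq>N. F I = (\<Oplus>\<^bsub>G\<^esub>J\<in>Pow I. d J))"

definition monotone_cube :: "('c, 'm) ring_scheme \<Rightarrow> 'i set \<Rightarrow> ('i set \<Rightarrow> 'c) \<Rightarrow> bool" where
  "monotone_cube G N F \<longleftrightarrow> (\<exists>d. cube_differences G N F d)"

definition parity_class :: "bool \<Rightarrow> 'i set \<Rightarrow> 'i set set" where
  "parity_class p N = {I. I \<subseteq> N \<and> even (card N - card I) = p}"

lemma parity_class_subset: "I \<in> parity_class p N \<Longrightarrow> I \<subseteq> N"
  by (simp add: parity_class_def)

lemma finite_parity_class: "finite N \<Longrightarrow> finite (parity_class p N)"
  by (simp add: parity_class_def)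

lemma parity_class_empty: "parity_class True {} = {{}}" "parity_class False {} = {}"
  by (auto simp: parity_class_def)

lemma top_in_parity_class: "N \<in> parity_class p N \<longleftrightarrow> p"
  by (simp add: parity_class_def)

lemma parity_class_insert:
  assumes "finite N" "i \<notin> N"
  shows "parity_class p (insert i N) = parity_class (\<not> p) N \<union> insert i ` parity_class p N"
proof -
  have card: "card (insert i N) - card I = Suc (card N - card I)"
    "card (insert i N) - card (insert i I) = card N - card I" if "I \<subseteq> N" for I
  proof -
    have "finite I" "i \<notin> I" "card I \<le> card N" using that assms finite_subset card_mono by auto
    then show "card (insert i N) - card I = Suc (card N - card I)"
      "card (insert i N) - card (insert i I) = card N - card I"
      using assms by (simp_all add: Suc_diff_le)
  qed
  have "parity_class p (insert i N) = {I \<in> Pow (insert i N). even (card (insert i N) - card I) = p}"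
    by (simp add: parity_class_def)
  also have "\<dots> = {I \<in> Pow N. even (card (insert i N) - card I) = p} \<union>
      insert i ` {I \<in> Pow N. even (card (insert i N) - card (insert i I)) = p}"
    unfolding Pow_insert by blast
  also have "{I \<in> Pow N. even (card (insert i N) - card I) = p} = parity_class (\<not> p) N"
    by (cases p) (simp_all add: parity_class_def card(1) cong: conj_cong del: even_diff_nat)
  also have "{I \<in> Pow N. even (card (insert i N) - card (insert i I)) = p} = parity_class p N"
    by (simp add: parity_class_def card(2) cong: conj_cong del: even_diff_nat)
  finally show ?thesis .
qed

lemma parity_class_image:
  assumes "inj_on h N"
  shows "parity_class p (h ` N) = (`) h ` parity_class p N"
proof -
  have "card (h ` I) = card I" if "I \<subseteq> N" for I
    using that assms card_image inj_on_subset by blast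
  then show ?thesis by (auto simp: parity_class_def subset_image_iff simp del: even_diff_nat)
qed

lemma cube_differences_closed: "cube_differences G N F d \<Longrightarrow> J \<subseteq> N \<Longrightarrow> d J \<in> carrier G"
  by (auto simp: cube_differences_def)

lemma cube_differences_subset:
  "cube_differences G N F d \<Longrightarrow> M \<subseteq> N \<Longrightarrow> cube_differences G M F d"
  unfolding cube_differences_def by (auto dest: subset_trans)

lemma monotone_cube_cong:
  "(\<And>I. I \<subseteq> N \<Longrightarrow> F I = H I) \<Longrightarrow> monotone_cube G N F \<longleftrightarrow> monotone_cube G N H"
  by (simp add: monotone_cube_def cube_differences_def)

context abelian_monoid
begin

lemma cube_closed: "cube_differences G N F d \<Longrightarrow> I \<subseteq> N \<Longrightarrow> F I \<in> carrier G"
  unfolding cube_differences_def by (auto intro!: finsum_closed dest: subset_trans)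

lemma finsum_Pow_insert:
  assumes "finite I" "i \<notin> I" "d \<in> Pow (insert i I) \<rightarrow> carrier G"
  shows "(\<Oplus>J\<in>Pow (insert i I). d J) = (\<Oplus>J\<in>Pow I. d J) \<oplus> (\<Oplus>J\<in>Pow I. d (insert i J))"
proof -
  have "(\<Oplus>J\<in>Pow (insert i I). d J) = (\<Oplus>J\<in>Pow I. d J) \<oplus> (\<Oplus>J\<in>insert i ` Pow I. d J)"
    unfolding Pow_insert by (rule finsum_Un_disjoint) (use assms in auto)
  also have "(\<Oplus>J\<in>insert i ` Pow I. d J) = (\<Oplus>J\<in>Pow I. d (insert i J))"
    by (rule finsum_reindex) (use assms in \<open>auto simp: inj_on_def\<close>)
  finally show ?thesis .
qed

lemma cube_differences_insertD:
  assumes "finite N" "i \<notin> N" and d: "cube_differences G (insert i N) F d"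
  shows "cube_differences G N F d"
    and "cube_differences G N (\<lambda>I. \<Oplus>J\<in>Pow I. d (insert i J)) (\<lambda>J. d (insert i J))"
    and "\<And>I. I \<subseteq> N \<Longrightarrow> F (insert i I) = F I \<oplus> (\<Oplus>J\<in>Pow I. d (insert i J))"
proof -
  have closed: "d \<in> Pow (insert i N) \<rightarrow> carrier G" using d by (simp add: cube_differences_def)
  show "cube_differences G N F d" by (rule cube_differences_subset[OF d]) auto
  show "cube_differences G N (\<lambda>I. \<Oplus>J\<in>Pow I. d (insert i J)) (\<lambda>J. d (insert i J))"
    using closed by (auto simp: cube_differences_def)
  fix I assume I: "I \<subseteq> N"
  have "F (insert i I) = (\<Oplus>J\<in>Pow (insert i I). d J)" "F I = (\<Oplus>J\<in>Pow I. d J)"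
    using d insert_mono[OF I, of i] subset_insertI2[OF I, of i] by (simp_all add: cube_differences_def)
  then show "F (insert i I) = F I \<oplus> (\<Oplus>J\<in>Pow I. d (insert i J))"
    using finsum_Pow_insert[of I i d] assms I closed Pow_mono[OF insert_mono[OF I, of i]]
    by (auto simp: finite_subset Pi_iff subset_iff)
qed

lemma monotone_cube_insertE:
  assumes "finite N" "i \<notin> N" "monotone_cube G (insert i N) F"
  obtains H where "monotone_cube G N F" "monotone_cube G N H" "\<And>I. I \<subseteq> N \<Longrightarrow> F (insert i I) = F I \<oplus> H I"
  using assms(3) cube_differences_insertD[OF assms(1,2)] unfolding monotone_cube_def by blast

lemma monotone_cube_insertI:
  assumes "finite N" "i \<notin> N" "monotone_cube G N F" "monotone_cube G N H"
    and step: "\<And>I. I \<subseteq> N \<Longrightarrow> F (insert i I) = F I \<oplus> H I"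
  shows "monotone_cube G (insert i N) F"
proof -
  obtain d e where d: "cube_differences G N F d" and e: "cube_differences G N H e"
    using assms by (auto simp: monotone_cube_def)
  define w where "w J = (if i \<in> J then e (J - {i}) else d J)" for J
  have closed: "w \<in> Pow (insert i N) \<rightarrow> carrier G"
    using d e by (auto simp: w_def cube_differences_def Pi_iff subset_insert_iff)
  have "F I = (\<Oplus>J\<in>Pow I. w J)" if "I \<subseteq> insert i N" for I
  proof -
    define K where "K = I - {i}"
    have K: "K \<subseteq> N" "finite K" "i \<notin> K" using that assms(1) finite_subset by (auto simp: K_def)
    have "(\<Oplus>J\<in>Pow K. w J) = (\<Oplus>J\<in>Pow K. d J)"
      by (rule finsum_cong') (use d K in \<open>auto simp: w_def cube_differences_closed subset_trans\<close>)
    then have old: "(\<Oplus>J\<in>Pow K. w J) = F K" using d K by (simp add: cube_differences_def)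
    have "(\<Oplus>J\<in>Pow K. w (insert i J)) = (\<Oplus>J\<in>Pow K. e J)"
    proof (rule finsum_cong')
      fix J assume "J \<in> Pow K"
      then have "insert i J - {i} = J" using K by auto
      then show "w (insert i J) = e J" by (simp add: w_def)
    qed (use e K in \<open>auto intro: cube_differences_closed\<close>)
    then have new: "(\<Oplus>J\<in>Pow K. w (insert i J)) = H K" using e K by (simp add: cube_differences_def)
    show ?thesis
    proof (cases "i \<in> I")
      case True
      then have "I = insert i K" by (auto simp: K_def)
      moreover have "w \<in> Pow (insert i K) \<rightarrow> carrier G"
        using closed Pow_mono[OF insert_mono[OF K(1), of i]] by blast
      ultimately show ?thesis using finsum_Pow_insert[OF K(2,3), of w] step[OF K(1)] old new by simp
    next
      case False
      then show ?thesis using old by (simp add: K_def)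
    qed
  qed
  with closed show ?thesis by (auto simp: monotone_cube_def cube_differences_def)
qed

lemma monotone_cube_add:
  assumes "monotone_cube G N F" "monotone_cube G N H"
  shows "monotone_cube G N (\<lambda>I. F I \<oplus> H I)"
proof -
  obtain d e where d: "cube_differences G N F d" and e: "cube_differences G N H e"
    using assms by (auto simp: monotone_cube_def)
  have "F I \<oplus> H I = (\<Oplus>J\<in>Pow I. d J \<oplus> e J)" if I: "I \<subseteq> N" for I
  proof -
    have "(\<Oplus>J\<in>Pow I. d J \<oplus> e J) = (\<Oplus>J\<in>Pow I. d J) \<oplus> (\<Oplus>J\<in>Pow I. e J)"
      by (rule finsum_addf)
         (auto intro!: cube_differences_closed[OF d] cube_differences_closed[OF e] subset_trans[OF _ I])
    then show ?thesis using d e I by (simp add: cube_differences_def)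
  qed
  then show ?thesis
    using d e unfolding monotone_cube_def cube_differences_def
    by (intro exI[of _ "\<lambda>J. d J \<oplus> e J"]) auto
qed

lemma monotone_cube_const:
  assumes "finite N" "c \<in> carrier G"
  shows "monotone_cube G N (\<lambda>_. c)"
proof -
  have "c = (\<Oplus>J\<in>Pow I. if J = {} then c else \<zero>)" if "I \<subseteq> N" for I
    using finite_subset[OF that assms(1)] assms(2) add.finprod_singleton[of "{}" "Pow I" "\<lambda>_. c"]
    by (simp add: eq_commute[of "{}"])
  then show ?thesis
    using assms unfolding monotone_cube_def cube_differences_def
    by (intro exI[of _ "\<lambda>J. if J = {} then c else \<zero>"]) auto
qed

lemma monotone_cube_vertex:
  assumes "finite N" "x \<in> carrier G" "u \<in> N \<rightarrow> carrier G"
  shows "monotone_cube G N (\<lambda>I. x \<oplus> (\<Oplus>i\<in>I. u i))"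
  using assms(1,3)
proof (induction N rule: finite_induct)
  case empty
  then show ?case
    using monotone_cube_const[of "{}" x] assms(2) by (simp add: monotone_cube_def cube_differences_def)
next
  case (insert i N)
  show ?case
  proof (rule monotone_cube_insertI[OF insert.hyps])
    show "monotone_cube G N (\<lambda>I. x \<oplus> (\<Oplus>i\<in>I. u i))" using insert by auto
    show "monotone_cube G N (\<lambda>_. u i)" using insert by (intro monotone_cube_const) auto
    fix I assume "I \<subseteq> N"
    then have "finite I" "i \<notin> I" "u \<in> I \<rightarrow> carrier G" "u i \<in> carrier G"
      using insert finite_subset by auto
    then show "x \<oplus> (\<Oplus>i\<in>insert i I. u i) = x \<oplus> (\<Oplus>i\<in>I. u i) \<oplus> u i"
      using assms(2) by (simp add: a_ac)
  qed
qed

lemma cube_differences_galois: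
  assumes "finite N" "finite M" and d: "cube_differences G M F d"
    and A: "\<And>I. I \<subseteq> N \<Longrightarrow> A I \<subseteq> M"
    and galois: "\<And>T I. T \<subseteq> M \<Longrightarrow> I \<subseteq> N \<Longrightarrow> T \<subseteq> A I \<longleftrightarrow> c T \<subseteq> I"
  shows "cube_differences G N (\<lambda>I. F (A I)) (\<lambda>J. \<Oplus>T\<in>{T. T \<subseteq> M \<and> c T = J}. d T)"
  unfolding cube_differences_def
proof (intro conjI allI impI)
  have closed: "T \<subseteq> M \<Longrightarrow> d T \<in> carrier G" for T using d by (auto simp: cube_differences_def)
  then show "(\<lambda>J. \<Oplus>T\<in>{T. T \<subseteq> M \<and> c T = J}. d T) \<in> Pow N \<rightarrow> carrier G" by auto
  fix I assume I: "I \<subseteq> N"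
  have "F (A I) = (\<Oplus>T\<in>Pow (A I). d T)" using d A[OF I] by (simp add: cube_differences_def)
  also have "T \<subseteq> A I \<longleftrightarrow> T \<subseteq> M \<and> c T \<subseteq> I" for T
    using A[OF I] galois[OF _ I] subset_trans by metis
  then have "Pow (A I) = (\<Union>J\<in>Pow I. {T. T \<subseteq> M \<and> c T = J})" by auto
  also have "(\<Oplus>T\<in>\<dots>. d T) = (\<Oplus>J\<in>Pow I. \<Oplus>T\<in>{T. T \<subseteq> M \<and> c T = J}. d T)"
    by (rule add.finprod_UN_disjoint)
       (use I assms(1,2) closed in \<open>auto intro: finite_subset simp: pairwise_def disjnt_def\<close>)
  finally show "F (A I) = (\<Oplus>J\<in>Pow I. \<Oplus>T\<in>{T. T \<subseteq> M \<and> c T = J}. d T)" .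
qed

lemma monotone_cube_image:
  assumes "finite N" "inj_on h N" "monotone_cube G N (\<lambda>I. F (h ` I))"
  shows "monotone_cube G (h ` N) F"
proof -
  define A where "A I = {i \<in> N. h i \<in> I}" for I
  obtain d where d: "cube_differences G N (\<lambda>I. F (h ` I)) d" using assms by (auto simp: monotone_cube_def)
  have "cube_differences G (h ` N) (\<lambda>I. F (h ` A I)) (\<lambda>J. \<Oplus>T\<in>{T. T \<subseteq> N \<and> h ` T = J}. d T)"
    by (rule cube_differences_galois[OF _ _ d]) (use assms in \<open>auto simp: A_def\<close>)
  moreover have "h ` A I = I" if "I \<subseteq> h ` N" for I using that by (auto simp: A_def)
  ultimately have "cube_differences G (h ` N) F (\<lambda>J. \<Oplus>T\<in>{T. T \<subseteq> N \<and> h ` T = J}. d T)"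
    by (simp add: cube_differences_def)
  then show ?thesis by (auto simp: monotone_cube_def)
qed

lemma finsum_parity_class_closed:
  "(\<And>I. I \<subseteq> N \<Longrightarrow> F I \<in> carrier G) \<Longrightarrow> (\<Oplus>I\<in>parity_class p N. F I) \<in> carrier G"
  by (intro finsum_closed) (auto dest: parity_class_subset)

lemma finsum_parity_class_insert:
  assumes "finite N" "i \<notin> N" and F: "\<And>I. I \<subseteq> insert i N \<Longrightarrow> F I \<in> carrier G"
  shows "(\<Oplus>I\<in>parity_class p (insert i N). F I) =
    (\<Oplus>I\<in>parity_class (\<not> p) N. F I) \<oplus> (\<Oplus>I\<in>parity_class p N. F (insert i I))"
proof -
  have outside: "I \<in> parity_class q N \<Longrightarrow> i \<notin> I" for q I
    using assms(2) by (auto dest: parity_class_subset)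
  have "(\<Oplus>I\<in>parity_class p (insert i N). F I) =
      (\<Oplus>I\<in>parity_class (\<not> p) N. F I) \<oplus> (\<Oplus>I\<in>insert i ` parity_class p N. F I)"
    unfolding parity_class_insert[OF assms(1,2)]
    by (rule finsum_Un_disjoint)
       (auto simp: assms(1) finite_parity_class intro!: F dest: outside parity_class_subset)
  also have "(\<Oplus>I\<in>insert i ` parity_class p N. F I) = (\<Oplus>I\<in>parity_class p N. F (insert i I))"
    by (rule finsum_reindex)
       (auto simp: inj_on_def intro!: F dest: outside parity_class_subset)
  finally show ?thesis .
qed

lemma finsum_parity_class_image:
  assumes "inj_on h N" "\<And>I. I \<subseteq> N \<Longrightarrow> F (h ` I) \<in> carrier G"
  shows "(\<Oplus>I\<in>parity_class p (h ` N). F I) = (\<Oplus>I\<in>parity_class p N. F (h ` I))"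
  unfolding parity_class_image[OF assms(1)]
proof (rule finsum_reindex)
  show "F \<in> (`) h ` parity_class p N \<rightarrow> carrier G" using assms(2) by (auto dest: parity_class_subset)
  show "inj_on ((`) h) (parity_class p N)"
    using inj_on_image_eq_iff[OF assms(1)] by (intro inj_onI) (auto dest!: parity_class_subset)
qed

lemma cube_differences_parity:
  assumes "finite N" "cube_differences G N F d"
  shows "(\<Oplus>I\<in>parity_class True N. F I) = (\<Oplus>I\<in>parity_class False N. F I) \<oplus> d N"
  using assms
proof (induction N arbitrary: F d rule: finite_induct)
  case empty
  then show ?case by (auto simp: parity_class_empty cube_differences_def)
next
  case (insert i N)
  note split = cube_differences_insertD[OF insert.hyps insert.prems]
  let ?H = "\<lambda>I. F (insert i I)"
  let ?F = "\<lambda>p. \<Oplus>I\<in>parity_class p N. F I" and ?G = "\<lambda>p. \<Oplus>I\<in>parity_class p N. ?H I"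
  have closed: "J \<subseteq> N \<Longrightarrow> d J \<in> carrier G" "J \<subseteq> N \<Longrightarrow> d (insert i J) \<in> carrier G" for J
    using cube_differences_closed[OF split(1)] cube_differences_closed[OF split(2)] by auto
  have cube: "cube_differences G N ?H (\<lambda>J. d J \<oplus> d (insert i J))"
    unfolding cube_differences_def
  proof (intro conjI allI impI)
    show "(\<lambda>J. d J \<oplus> d (insert i J)) \<in> Pow N \<rightarrow> carrier G" using closed by auto
    fix I assume I: "I \<subseteq> N"
    then have "(\<Oplus>J\<in>Pow I. d J \<oplus> d (insert i J)) = (\<Oplus>J\<in>Pow I. d J) \<oplus> (\<Oplus>J\<in>Pow I. d (insert i J))"
      using closed by (intro finsum_addf) (auto dest: subset_trans)
    then show "?H I = (\<Oplus>J\<in>Pow I. d J \<oplus> d (insert i J))"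
      using split(1,3) I by (simp add: cube_differences_def)
  qed
  have F: "?F p \<in> carrier G" and H: "?G p \<in> carrier G" for p
    using cube_closed[OF split(1)] cube_closed[OF cube] by (auto intro: finsum_parity_class_closed)
  have faces: "(\<Oplus>I\<in>parity_class p (insert i N). F I) = ?F (\<not> p) \<oplus> ?G p" for p
    using cube_closed[OF insert.prems] by (intro finsum_parity_class_insert insert.hyps) auto
  have "(\<Oplus>I\<in>parity_class True (insert i N). F I) = ?F False \<oplus> (?G False \<oplus> (d N \<oplus> d (insert i N)))"
    using faces[of True] insert.IH[OF cube] by simp
  also have "\<dots> = (?F False \<oplus> d N) \<oplus> ?G False \<oplus> d (insert i N)"
    using F H closed[of N] by (simp add: a_ac)
  also have "\<dots> = (\<Oplus>I\<in>parity_class False (insert i N). F I) \<oplus> d (insert i N)"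
    using faces[of False] insert.IH[OF split(1)] by simp
  finally show ?case .
qed

lemma finsum_parity_class_top:
  assumes "finite N" "\<And>I. I \<subseteq> N \<Longrightarrow> F I \<in> carrier G"
  shows "(\<Oplus>I\<in>parity_class True N. F I) = F N \<oplus> (\<Oplus>I\<in>parity_class True N - {N}. F I)"
proof -
  have "parity_class True N = insert N (parity_class True N - {N})" using top_in_parity_class by auto
  moreover have "(\<Oplus>I\<in>insert N (parity_class True N - {N}). F I) = F N \<oplus> (\<Oplus>I\<in>parity_class True N - {N}. F I)"
    by (rule finsum_insert) (use assms in \<open>auto simp: finite_parity_class dest: parity_class_subset\<close>)
  ultimately show ?thesis by simp
qed

end

lemma (in normed_cone) cube_differencesI_parity:
  assumes "finite N" and F: "\<And>I. I \<subseteq> N \<Longrightarrow> F I \<in> carrier C" and d: "d \<in> Pow N \<rightarrow> carrier C"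
    and parity: "\<And>J. J \<subseteq> N \<Longrightarrow>
      (\<Oplus>I\<in>parity_class True J. F I) = (\<Oplus>I\<in>parity_class False J. F I) \<oplus> d J"
  shows "cube_differences C N F d"
proof -
  let ?H = "\<lambda>I. \<Oplus>J\<in>Pow I. d J"
  have cube: "cube_differences C N ?H d" using d by (simp add: cube_differences_def)
  have "F I = ?H I" if "I \<subseteq> N" for I
    using that
  proof (induction "card I" arbitrary: I rule: less_induct)
    case less
    have fin: "finite I" using less.prems assms(1) finite_subset by auto
    have closed: "K \<subseteq> I \<Longrightarrow> F K \<in> carrier C" "K \<subseteq> I \<Longrightarrow> ?H K \<in> carrier C" for K
      using F cube_closed[OF cube] less.prems by (auto dest: subset_trans)
    have below: "finsum C F S = finsum C ?H S" if "S \<subseteq> Pow I - {I}" for S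
    proof (rule finsum_cong')
      fix K assume "K \<in> S"
      then have "K \<subset> I" using that by auto
      then show "F K = ?H K" using less psubset_card_mono[OF fin] by auto
    qed (use that closed in auto)
    have "F I \<oplus> finsum C F (parity_class True I - {I}) = finsum C F (parity_class False I) \<oplus> d I"
      using parity[OF less.prems] finsum_parity_class_top[OF fin, of F] closed by simp
    also have "\<dots> = finsum C ?H (parity_class False I) \<oplus> d I"
      by (subst below) (auto simp: top_in_parity_class dest: parity_class_subset)
    also have "\<dots> = ?H I \<oplus> finsum C ?H (parity_class True I - {I})"
      using cube_differences_parity[OF fin cube_differences_subset[OF cube less.prems]]
        finsum_parity_class_top[OF fin, of ?H] closed by simp
    also have "finsum C ?H (parity_class True I - {I}) = finsum C F (parity_class True I - {I})"
      by (rule below[symmetric]) (auto dest: parity_class_subset)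
    finally have "F I \<oplus> finsum C F (parity_class True I - {I}) =
        ?H I \<oplus> finsum C F (parity_class True I - {I})" .
    moreover have "finsum C F (parity_class True I - {I}) \<in> carrier C"
      by (intro finsum_closed) (auto intro: closed dest: parity_class_subset)
    ultimately show "F I = ?H I"
      using add_cancel[of "finsum C F (parity_class True I - {I})" "F I" "?H I"] closed by (simp add: a_comm)
  qed
  then show ?thesis using d by (simp add: cube_differences_def)
qed

section \<open>Stable functions compose\<close>

abbreviation vertex :: "('c, 'm) ring_scheme \<Rightarrow> 'c \<Rightarrow> ('i \<Rightarrow> 'c) \<Rightarrow> 'i set \<Rightarrow> 'c" where
  "vertex C x u I \<equiv> x \<oplus>\<^bsub>C\<^esub> (\<Oplus>\<^bsub>C\<^esub>i\<in>I. u i)"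

definition ball_cube :: "('c, 'm) cone_scheme \<Rightarrow> 'i set \<Rightarrow> 'c \<Rightarrow> ('i \<Rightarrow> 'c) \<Rightarrow> bool" where
  "ball_cube C N x u \<longleftrightarrow>
     finite N \<and> x \<in> carrier C \<and> u \<in> N \<rightarrow> carrier C \<and> vertex C x u N \<in> cone_ball C"

lemma (in normed_cone) ball_cube_subset:
  assumes "ball_cube C N x u" "I \<subseteq> N"
  shows "ball_cube C I x u"
proof -
  have I: "finite I" "u \<in> I \<rightarrow> carrier C" "finite (N - I)" "u \<in> (N - I) \<rightarrow> carrier C" and x: "x \<in> carrier C"
    using assms finite_subset by (auto simp: ball_cube_def)
  have "(\<Oplus>i\<in>I \<union> (N - I). u i) = (\<Oplus>i\<in>I. u i) \<oplus> (\<Oplus>i\<in>N-I. u i)"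
    by (rule finsum_Un_disjoint) (use I in auto)
  moreover have "I \<union> (N - I) = N" using assms(2) by auto
  ultimately have "vertex C x u N = vertex C x u I \<oplus> (\<Oplus>i\<in>N-I. u i)"
    using I x by (simp add: a_assoc)
  then have "cnorm C (vertex C x u I) \<le> cnorm C (vertex C x u N)"
    using I x by (simp add: cnorm_mono)
  then show ?thesis
    using assms I x by (auto simp: ball_cube_def cone_ball_def)
qed

lemma prestable_iff_cone_le:
  "prestable C D f \<longleftrightarrow>
     (\<forall>(n :: nat) x u. ball_cube C {1..n} x u \<longrightarrow>
        cone_le D (\<Oplus>\<^bsub>D\<^esub>I\<in>parity_class False {1..n}. f (vertex C x u I))
                  (\<Oplus>\<^bsub>D\<^esub>I\<in>parity_class True {1..n}. f (vertex C x u I)))"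
  by (auto simp: prestable_def ball_cube_def parity_class_def simp del: even_diff_nat One_nat_def)

lemma prestableI_monotone_cube:
  assumes D: "abelian_monoid D"
    and cubes: "\<And>(n :: nat) x u. ball_cube C {1..n} x u \<Longrightarrow> monotone_cube D {1..n} (\<lambda>I. f (vertex C x u I))"
  shows "prestable C D f"
  unfolding prestable_iff_cone_le cone_le_def
proof (intro allI impI)
  interpret D: abelian_monoid D by fact
  fix n :: nat and x u assume "ball_cube C {1..n} x u"
  from cubes[OF this] obtain d where d: "cube_differences D {1..n} (\<lambda>I. f (vertex C x u I)) d"
    by (auto simp: monotone_cube_def)
  from D.cube_differences_parity[OF _ d]
  show "\<exists>z\<in>carrier D. (\<Oplus>\<^bsub>D\<^esub>I\<in>parity_class True {1..n}. f (vertex C x u I)) =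
      (\<Oplus>\<^bsub>D\<^esub>I\<in>parity_class False {1..n}. f (vertex C x u I)) \<oplus>\<^bsub>D\<^esub> z"
    using cube_differences_closed[OF d] by auto
qed

locale cone_map = C: normed_cone C + D: normed_cone D
  for C :: "('c, 'm) cone_scheme" and D :: "('d, 'n) cone_scheme" +
  fixes f
  assumes range: "f \<in> cone_ball C \<rightarrow> carrier D"
begin

lemma vertex_closed: "ball_cube C N x u \<Longrightarrow> I \<subseteq> N \<Longrightarrow> f (vertex C x u I) \<in> carrier D"
  using C.ball_cube_subset[of N x u I] range by (auto simp: ball_cube_def)

lemma prestable_cone_le:
  assumes "prestable C D f" and u: "ball_cube C N x u"
  shows "cone_le D (\<Oplus>\<^bsub>D\<^esub>I\<in>parity_class False N. f (vertex C x u I))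
                   (\<Oplus>\<^bsub>D\<^esub>I\<in>parity_class True N. f (vertex C x u I))"
proof -
  have "finite N" using u by (simp add: ball_cube_def)
  then obtain h where "bij_betw h {1..card N} N" using ex_bij_betw_nat_finite_1 by blast
  then have h: "inj_on h {1..card N}" "h ` {1..card N} = N" by (auto simp: bij_betw_def)
  have vertex: "vertex C x (\<lambda>i. u (h i)) I = vertex C x u (h ` I)" if I: "I \<subseteq> {1..card N}" for I
  proof -
    have "h ` I \<subseteq> N" using I h by auto
    then have "u \<in> h ` I \<rightarrow> carrier C" using u by (auto simp: ball_cube_def)
    then show ?thesis using C.finsum_reindex[of u h I] inj_on_subset[OF h(1) I] by simp
  qed
  have "ball_cube C {1..card N} x (\<lambda>i. u (h i))"
    using u vertex[of "{1..card N}"] h by (auto simp: ball_cube_def)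
  moreover have "(\<Oplus>\<^bsub>D\<^esub>I\<in>parity_class p {1..card N}. f (vertex C x (\<lambda>i. u (h i)) I)) =
      (\<Oplus>\<^bsub>D\<^esub>I\<in>parity_class p N. f (vertex C x u I))" for p
  proof -
    have closed: "f (vertex C x u (h ` I)) \<in> carrier D" if "I \<subseteq> {1..card N}" for I
      by (rule vertex_closed[OF u]) (use that h in auto)
    have "(\<Oplus>\<^bsub>D\<^esub>I\<in>parity_class p {1..card N}. f (vertex C x (\<lambda>i. u (h i)) I)) =
        (\<Oplus>\<^bsub>D\<^esub>I\<in>parity_class p {1..card N}. f (vertex C x u (h ` I)))"
      by (rule D.finsum_cong') (auto simp: vertex closed dest: parity_class_subset)
    also have "\<dots> = (\<Oplus>\<^bsub>D\<^esub>I\<in>parity_class p N. f (vertex C x u I))"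
      using D.finsum_parity_class_image[OF h(1), of "\<lambda>I. f (vertex C x u I)" p] closed unfolding h(2) by simp
    finally show ?thesis .
  qed
  ultimately show ?thesis using assms(1) unfolding prestable_iff_cone_le by metis
qed

lemma prestable_monotone_cube:
  assumes "prestable C D f" and u: "ball_cube C N x u"
  shows "monotone_cube D N (\<lambda>I. f (vertex C x u I))"
proof -
  have "\<exists>z. z \<in> carrier D \<and> (\<Oplus>\<^bsub>D\<^esub>I\<in>parity_class True J. f (vertex C x u I)) =
      (\<Oplus>\<^bsub>D\<^esub>I\<in>parity_class False J. f (vertex C x u I)) \<oplus>\<^bsub>D\<^esub> z" if "J \<subseteq> N" for J
    using prestable_cone_le[OF assms(1) C.ball_cube_subset[OF u that]] by (auto simp: cone_le_def)
  then obtain d where d: "\<And>J. J \<subseteq> N \<Longrightarrow> d J \<in> carrier D"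
    "\<And>J. J \<subseteq> N \<Longrightarrow> (\<Oplus>\<^bsub>D\<^esub>I\<in>parity_class True J. f (vertex C x u I)) =
      (\<Oplus>\<^bsub>D\<^esub>I\<in>parity_class False J. f (vertex C x u I)) \<oplus>\<^bsub>D\<^esub> d J" by metis
  have "cube_differences D N (\<lambda>I. f (vertex C x u I)) d"
    by (rule D.cube_differencesI_parity)
       (use u in \<open>auto simp: ball_cube_def d(1) intro: vertex_closed[OF u] d(2)\<close>)
  then show ?thesis by (auto simp: monotone_cube_def)
qed

lemma prestable_mono:
  assumes "prestable C D f" and "x \<in> carrier C" "y \<in> cone_ball C" "cone_le C x y"
  shows "x \<in> cone_ball C" "cone_le D (f x) (f y)"
proof -
  obtain z where z: "z \<in> carrier C" "y = x \<oplus>\<^bsub>C\<^esub> z" using assms by (auto simp: cone_le_def)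
  then have u: "ball_cube C {()} x (\<lambda>_. z)" using assms by (simp add: ball_cube_def)
  then show x: "x \<in> cone_ball C"
    using C.ball_cube_subset[OF u, of "{}"] assms(2) by (simp add: ball_cube_def)
  have parity: "parity_class True {()} = {{()}}" "parity_class False {()} = {{}}"
    using parity_class_insert[of "{}" "()"] by (auto simp: parity_class_empty)
  show "cone_le D (f x) (f y)"
    using prestable_cone_le[OF assms(1) u] z assms(2,3) range x by (simp add: parity Pi_iff)
qed

end

lemma prestable_compose:
  assumes f: "cone_map C D f" "f \<in> cone_ball C \<rightarrow> cone_ball D" "prestable C D f"
    and g: "cone_map D E g" "prestable D E g"
  shows "prestable C E (\<lambda>x. g (f x))"
proof -
  interpret f: cone_map C D f by fact
  interpret g: cone_map D E g by fact
  show ?thesis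
  proof (rule prestableI_monotone_cube[OF g.D.abelian_monoid_axioms])
    fix n :: nat and x u
    assume u: "ball_cube C {1..n} x u"
    let ?K = "Pow {1..n} - {{}}"
    obtain d where d: "cube_differences D {1..n} (\<lambda>I. f (vertex C x u I)) d"
      using f.prestable_monotone_cube[OF f(3) u] by (auto simp: monotone_cube_def)
    have inner: "f (vertex C x u I) = vertex D (d {}) d (Pow I - {{}})" if "I \<subseteq> {1..n}" for I
    proof -
      have "f (vertex C x u I) = (\<Oplus>\<^bsub>D\<^esub>J\<in>insert {} (Pow I - {{}}). d J)"
        using d that by (simp add: cube_differences_def insert_absorb)
      also have "\<dots> = vertex D (d {}) d (Pow I - {{}})"
        by (rule f.D.finsum_insert)
           (use finite_subset[OF that] in \<open>auto intro!: cube_differences_closed[OF d]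
             subset_trans[OF _ that]\<close>)
      finally show ?thesis .
    qed
    have "vertex D (d {}) d ?K \<in> cone_ball D"
      using funcset_mem[OF f(2)] u by (metis ball_cube_def inner order_refl)
    then have "ball_cube D ?K (d {}) d"
      using cube_differences_closed[OF d] by (auto simp: ball_cube_def)
    from g.prestable_monotone_cube[OF g(2) this]
    obtain e where e: "cube_differences E ?K (\<lambda>S. g (vertex D (d {}) d S)) e"
      by (auto simp: monotone_cube_def)
    have "monotone_cube E {1..n} (\<lambda>I. g (vertex D (d {}) d (Pow I - {{}})))"
      unfolding monotone_cube_def
      by (rule exI, rule g.D.cube_differences_galois[where c = Union, OF _ _ e]) auto
    then show "monotone_cube E {1..n} (\<lambda>I. g (f (vertex C x u I)))"
      by (rule monotone_cube_cong[THEN iffD1, rotated]) (simp add: inner)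
  qed
qed

lemma prestable_cong:
  assumes "cone_map C D f" "prestable C D f" and eq: "\<And>x. x \<in> cone_ball C \<Longrightarrow> f x = g x"
  shows "prestable C D g"
proof -
  interpret cone_map C D f by fact
  show ?thesis
  proof (rule prestableI_monotone_cube[OF D.abelian_monoid_axioms])
    fix n :: nat and x u assume u: "ball_cube C {1..n} x u"
    show "monotone_cube D {1..n} (\<lambda>I. g (vertex C x u I))"
    proof (rule monotone_cube_cong[THEN iffD1, OF _ prestable_monotone_cube[OF assms(2) u]])
      fix I :: "nat set" assume "I \<subseteq> {1..n}"
      from C.ball_cube_subset[OF u this] show "f (vertex C x u I) = g (vertex C x u I)"
        by (intro eq) (simp add: ball_cube_def)
    qed
  qed
qed

lemma stable_cone_map:
  "normed_cone C \<Longrightarrow> normed_cone D \<Longrightarrow> stable C D f \<Longrightarrow> cone_map C D f"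
  by (simp add: cone_map_def cone_map_axioms_def stable_def)

lemma stable_compose:
  assumes C: "normed_cone C" and D: "normed_cone D" and E: "normed_cone E"
    and f: "f \<in> cone_ball C \<rightarrow> cone_ball D" "stable C D f" and g: "stable D E g"
  shows "stable C E (\<lambda>x. g (f x))"
proof -
  interpret f: cone_map C D f using C D f(2) by (rule stable_cone_map)
  interpret g: cone_map D E g using D E g by (rule stable_cone_map)
  show ?thesis
    unfolding stable_def
  proof (intro conjI allI ballI impI)
    show "prestable C E (\<lambda>x. g (f x))"
      by (rule prestable_compose[OF f.cone_map_axioms f(1) _ g.cone_map_axioms])
         (use f(2) g in \<open>simp_all add: stable_def\<close>)
    show "(\<lambda>x. g (f x)) \<in> cone_ball C \<rightarrow> carrier E" using f(1) g.range by (auto simp: Pi_iff)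
    obtain M where "\<forall>x\<in>cone_ball D. cnorm E (g x) \<le> M" using g by (auto simp: stable_def)
    then show "\<exists>M. \<forall>x\<in>cone_ball C. cnorm E (g (f x)) \<le> M" using f(1) by (intro exI[of _ M]) auto
    fix s x assume s: "x \<in> cone_ball C" "range s \<subseteq> cone_ball C" "cone_incseq C s" "cone_lub C s x"
    then have "cone_lub D (\<lambda>n. f (s n)) (f x)" using f(2) by (auto simp: stable_def)
    moreover have "cone_incseq D (\<lambda>n. f (s n))"
      using s f(2) f.prestable_mono by (auto simp: cone_incseq_def stable_def cone_ball_def image_subset_iff)
    moreover have "range (\<lambda>n. f (s n)) \<subseteq> cone_ball D" "f x \<in> cone_ball D" using f(1) s by auto
    ultimately show "cone_lub E (\<lambda>n. g (f (s n))) (g (f x))" using g by (simp add: stable_def)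
  qed
qed

lemma stable_cong:
  assumes "normed_cone C" "normed_cone D" "stable C D f" and eq: "\<And>x. x \<in> cone_ball C \<Longrightarrow> f x = g x"
  shows "stable C D g"
proof -
  interpret cone_map C D f using assms(1-3) by (rule stable_cone_map)
  have "(\<lambda>n. g (s n)) = (\<lambda>n. f (s n))" if "range s \<subseteq> cone_ball C" for s :: "nat \<Rightarrow> 'a"
    using eq that by (auto simp: fun_eq_iff image_subset_iff)
  moreover have "g \<in> cone_ball C \<rightarrow> carrier D" using range eq by (simp add: Pi_iff)
  ultimately show ?thesis
    using assms(3) eq prestable_cong[OF cone_map_axioms _ eq] by (simp add: stable_def)
qed

lemma stable_id:
  assumes "normed_cone C"
  shows "stable C C (\<lambda>x. x)"
proof -
  interpret C: normed_cone C by fact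
  have "prestable C C (\<lambda>x. x)"
    by (rule prestableI_monotone_cube[OF C.abelian_monoid_axioms])
       (auto simp: ball_cube_def intro: C.monotone_cube_vertex)
  then show ?thesis by (auto simp: stable_def cone_ball_def)
qed

lemma measurable_path_cong:
  assumes eq: "\<And>r. r \<in> space (RR n) \<Longrightarrow> \<gamma> r = \<gamma>' r" and \<gamma>: "measurable_path C n \<gamma>"
  shows "measurable_path C n \<gamma>'"
  unfolding measurable_path_def
proof (intro conjI allI ballI)
  show "\<gamma>' \<in> space (RR n) \<rightarrow> carrier C" "\<exists>M. \<forall>s\<in>space (RR n). cnorm C (\<gamma>' s) \<le> M"
    using \<gamma> eq by (auto simp: measurable_path_def Pi_iff)
  fix k l assume "l \<in> tests C k"
  then have "(\<lambda>(r, s). l r (\<gamma> s)) \<in> borel_measurable (RR k \<Otimes>\<^sub>M RR n)"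
    using \<gamma> unfolding measurable_path_def by blast
  then show "(\<lambda>(r, s). l r (\<gamma>' s)) \<in> borel_measurable (RR k \<Otimes>\<^sub>M RR n)"
    by (rule measurable_cong[THEN iffD1, rotated]) (auto simp: space_pair_measure eq)
qed

lemma measurable_cone_imp_normed_cone: "measurable_cone C \<Longrightarrow> normed_cone C"
  by (simp add: measurable_cone_def seq_complete_cone_def)

lemma cstabm_hom_restrict:
  assumes C: "measurable_cone C" and D: "measurable_cone D"
    and f: "f \<in> cone_ball C \<rightarrow> cone_ball D" "stable C D f"
    and paths: "\<And>n \<gamma>. unitary_path C n \<gamma> \<Longrightarrow> measurable_path D n (\<lambda>r. f (\<gamma> r))"
  shows "restrict f (cone_ball C) \<in> cstabm_hom C D"
  unfolding cstabm_hom_def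
proof (intro CollectI conjI allI impI)
  show "restrict f (cone_ball C) \<in> cone_ball C \<rightarrow>\<^sub>E cone_ball D" using f(1) by auto
  show "stable C D (restrict f (cone_ball C))"
    by (rule stable_cong[OF _ _ f(2)]) (use C D in \<open>simp_all add: measurable_cone_imp_normed_cone\<close>)
  fix n \<gamma> assume \<gamma>: "unitary_path C n \<gamma>"
  show "measurable_path D n (\<lambda>r. restrict f (cone_ball C) (\<gamma> r))"
    by (rule measurable_path_cong[OF _ paths[OF \<gamma>]]) (use \<gamma> in \<open>auto simp: unitary_path_def\<close>)
qed

lemma cstabm_hom_id: "measurable_cone C \<Longrightarrow> (\<lambda>x\<in>cone_ball C. x) \<in> cstabm_hom C C"
  by (intro cstabm_hom_restrict stable_id measurable_cone_imp_normed_cone) (auto simp: unitary_path_def)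

lemma cstabm_hom_compose:
  assumes C: "measurable_cone C" and D: "measurable_cone D" and E: "measurable_cone E"
    and f: "f \<in> cstabm_hom C D" and g: "g \<in> cstabm_hom D E"
  shows "compose (cone_ball C) g f \<in> cstabm_hom C E"
  unfolding compose_def
proof (rule cstabm_hom_restrict[OF C E])
  have f': "f \<in> cone_ball C \<rightarrow> cone_ball D" "stable C D f"
    and g': "g \<in> cone_ball D \<rightarrow> cone_ball E" "stable D E g"
    using f g by (auto simp: cstabm_hom_def)
  show "(\<lambda>x. g (f x)) \<in> cone_ball C \<rightarrow> cone_ball E" using f' g' by auto
  show "stable C E (\<lambda>x. g (f x))"
    by (rule stable_compose[OF _ _ _ f' g'(2)]) (use C D E in \<open>simp_all add: measurable_cone_imp_normed_cone\<close>)
  fix n \<gamma> assume "unitary_path C n \<gamma>"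
  then have "unitary_path D n (\<lambda>r. f (\<gamma> r))" using f f'(1) by (auto simp: cstabm_hom_def unitary_path_def)
  then show "measurable_path E n (\<lambda>r. g (f (\<gamma> r)))" using g by (auto simp: cstabm_hom_def)
qed

lemma is_category_Cstabm: "is_category (Cstabm :: ('c mcone, 'c \<Rightarrow> 'c) category)"
proof -
  have unit: "compose (cone_ball C) f (\<lambda>x\<in>cone_ball C. x) = f"
    "compose (cone_ball C) (\<lambda>x\<in>cone_ball D. x) f = f"
    if "f \<in> cstabm_hom C D" for C D :: "'c mcone" and f
    using that by (auto simp: cstabm_hom_def compose_def PiE_iff fun_eq_iff extensional_def)
  have assoc: "compose (cone_ball C) h (compose (cone_ball C) g f) =
      compose (cone_ball C) (compose (cone_ball D) h g) f"
    if "f \<in> cstabm_hom C D" for C D :: "'c mcone" and f g h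
    using that by (auto simp: cstabm_hom_def compose_def fun_eq_iff)
  show ?thesis
    unfolding is_category_def Cstabm_def category.simps mem_Collect_eq
    by (intro conjI ballI cstabm_hom_id cstabm_hom_compose[rotated 3] unit assoc)
      (assumption | erule CollectD)+
qed

section \<open>Cubes of nonnegative scalars\<close>

definition nonneg_semiring :: "'c::{ordered_comm_monoid_add, times, one} ring" where
  "nonneg_semiring = \<lparr>carrier = {0..}, mult = (*), one = 1, zero = 0, add = (+)\<rparr>"

lemma nonneg_semiring_simps:
  "carrier nonneg_semiring = {0..}" "\<zero>\<^bsub>nonneg_semiring\<^esub> = 0" "x \<oplus>\<^bsub>nonneg_semiring\<^esub> y = x + y"
  by (simp_all add: nonneg_semiring_def)

interpretation nonneg: abelian_monoid nonneg_semiring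
  by (rule abelian_monoidI) (auto simp: nonneg_semiring_simps ac_simps)

lemma finsum_nonneg_semiring:
  assumes "\<And>i. i \<in> A \<Longrightarrow> 0 \<le> f i"
  shows "(\<Oplus>\<^bsub>nonneg_semiring\<^esub>i\<in>A. f i) = (\<Sum>i\<in>A. f i)"
  using assms
  by (induction A rule: infinite_finite_induct)
     (simp_all add: nonneg.finsum_infinite nonneg_semiring_simps Pi_iff)

lemma cube_differences_nonneg_semiring:
  "cube_differences nonneg_semiring N F d \<longleftrightarrow> (\<forall>J\<subseteq>N. 0 \<le> d J) \<and> (\<forall>I\<subseteq>N. F I = (\<Sum>J\<in>Pow I. d J))"
proof -
  have "(\<Oplus>\<^bsub>nonneg_semiring\<^esub>J\<in>Pow I. d J) = (\<Sum>J\<in>Pow I. d J)" if "\<forall>J\<subseteq>N. 0 \<le> d J" "I \<subseteq> N" for I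
    using that by (intro finsum_nonneg_semiring) auto
  then show ?thesis by (auto simp: cube_differences_def nonneg_semiring_simps Pi_iff)
qed

lemma monotone_cube_mult:
  fixes F H :: "'i set \<Rightarrow> 'c::linordered_semidom"
  assumes "finite N" "monotone_cube nonneg_semiring N F" "monotone_cube nonneg_semiring N H"
  shows "monotone_cube nonneg_semiring N (\<lambda>I. F I * H I)"
  using assms
proof (induction N arbitrary: F H rule: finite_induct)
  case empty
  then show ?case
    by (auto simp: monotone_cube_def cube_differences_nonneg_semiring intro!: exI[of _ "\<lambda>_. F {} * H {}"])
next
  case (insert i N)
  obtain F' where F: "monotone_cube nonneg_semiring N F" "monotone_cube nonneg_semiring N F'"
    "\<And>I. I \<subseteq> N \<Longrightarrow> F (insert i I) = F I \<oplus>\<^bsub>nonneg_semiring\<^esub> F' I"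
    using nonneg.monotone_cube_insertE[OF insert.hyps insert.prems(1)] by metis
  obtain H' where H: "monotone_cube nonneg_semiring N H" "monotone_cube nonneg_semiring N H'"
    "\<And>I. I \<subseteq> N \<Longrightarrow> H (insert i I) = H I \<oplus>\<^bsub>nonneg_semiring\<^esub> H' I"
    using nonneg.monotone_cube_insertE[OF insert.hyps insert.prems(2)] by metis
  show ?case
  proof (rule nonneg.monotone_cube_insertI[OF insert.hyps insert.IH[OF F(1) H(1)]])
    show "monotone_cube nonneg_semiring N (\<lambda>I. F I * H' I \<oplus>\<^bsub>nonneg_semiring\<^esub>
        (F' I * H I \<oplus>\<^bsub>nonneg_semiring\<^esub> F' I * H' I))"
      by (intro nonneg.monotone_cube_add insert.IH F(1,2) H(1,2))
    show "F (insert i I) * H (insert i I) = F I * H I \<oplus>\<^bsub>nonneg_semiring\<^esub>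
        (F I * H' I \<oplus>\<^bsub>nonneg_semiring\<^esub> (F' I * H I \<oplus>\<^bsub>nonneg_semiring\<^esub> F' I * H' I))"
      if "I \<subseteq> N" for I
      using that by (simp add: F(3) H(3) nonneg_semiring_simps algebra_simps)
  qed
qed

lemma monotone_cube_ennreal_iff:
  assumes "finite N" "\<And>I. I \<subseteq> N \<Longrightarrow> 0 \<le> F I"
  shows "monotone_cube nonneg_semiring N (\<lambda>I. ennreal (F I)) \<longleftrightarrow> monotone_cube nonneg_semiring N F"
proof
  assume "monotone_cube nonneg_semiring N F"
  then obtain d where d: "\<forall>J\<subseteq>N. 0 \<le> d J" "\<forall>I\<subseteq>N. F I = (\<Sum>J\<in>Pow I. d J)"
    by (auto simp: monotone_cube_def cube_differences_nonneg_semiring)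
  have "ennreal (F I) = (\<Sum>J\<in>Pow I. ennreal (d J))" if "I \<subseteq> N" for I
    using that d by (subst sum_ennreal) (auto intro: subset_trans)
  then show "monotone_cube nonneg_semiring N (\<lambda>I. ennreal (F I))"
    by (auto simp: monotone_cube_def cube_differences_nonneg_semiring intro!: exI[of _ "\<lambda>J. ennreal (d J)"])
next
  assume "monotone_cube nonneg_semiring N (\<lambda>I. ennreal (F I))"
  then obtain d where d: "\<And>I. I \<subseteq> N \<Longrightarrow> ennreal (F I) = (\<Sum>J\<in>Pow I. d J)"
    by (auto simp: monotone_cube_def cube_differences_nonneg_semiring)
  have finite: "d J < \<infinity>" if "J \<subseteq> N" for J
  proof -
    have "d J \<le> ennreal (F N)"
      unfolding d[OF subset_refl] using that assms(1) by (intro member_le_sum) auto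
    then show ?thesis by (rule le_less_trans) simp
  qed
  have "F I = (\<Sum>J\<in>Pow I. enn2real (d J))" if I: "I \<subseteq> N" for I
  proof -
    have "(\<Sum>J\<in>Pow I. enn2real (d J)) = enn2real (\<Sum>J\<in>Pow I. d J)"
      using enn2real_sum[of "Pow I" d] finite subset_trans[OF _ I] by (simp add: comp_def)
    also have "\<dots> = F I" using assms(2)[OF I] by (simp flip: d[OF I])
    finally show ?thesis ..
  qed
  then show "monotone_cube nonneg_semiring N F"
    by (auto simp: monotone_cube_def cube_differences_nonneg_semiring intro!: exI[of _ "\<lambda>J. enn2real (d J)"])
qed

section \<open>The measurable cone of a probabilistic coherence space\<close>

lemma infsum_ennreal_le_1_iff:
  fixes f :: "'a \<Rightarrow> real"
  assumes "\<And>a. a \<in> A \<Longrightarrow> 0 \<le> f a"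
  shows "(\<Sum>\<^sub>\<infinity>a\<in>A. ennreal (f a)) \<le> 1 \<longleftrightarrow> (\<forall>F. finite F \<longrightarrow> F \<subseteq> A \<longrightarrow> sum f F \<le> 1)"
proof -
  have "(\<Sum>a\<in>F. ennreal (f a)) \<le> 1 \<longleftrightarrow> sum f F \<le> 1" if "F \<subseteq> A" for F
    using assms that by (subst sum_ennreal) auto
  then show ?thesis
    by (subst nonneg_infsum_complete) (auto simp: SUP_le_iff)
qed

lemma nnvec_nonneg: "u \<in> nnvec A \<Longrightarrow> 0 \<le> u a"
  by (cases "a \<in> A") (auto simp: nnvec_def)

lemma polar_subset_nnvec: "polar A S \<subseteq> nnvec A"
  by (auto simp: polar_def)

lemma polar_iff_finite_sums:
  assumes "S \<subseteq> nnvec A"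
  shows "u \<in> polar A S \<longleftrightarrow> u \<in> nnvec A \<and> (\<forall>v\<in>S. \<forall>F. finite F \<longrightarrow> F \<subseteq> A \<longrightarrow> (\<Sum>a\<in>F. u a * v a) \<le> 1)"
proof -
  have "(\<Sum>\<^sub>\<infinity>a\<in>A. ennreal (u a * v a)) \<le> 1 \<longleftrightarrow> (\<forall>F. finite F \<longrightarrow> F \<subseteq> A \<longrightarrow> (\<Sum>a\<in>F. u a * v a) \<le> 1)"
    if "u \<in> nnvec A" "v \<in> S" for v
    using that assms by (intro infsum_ennreal_le_1_iff mult_nonneg_nonneg) (auto intro: nnvec_nonneg)
  then show ?thesis by (auto simp: polar_def)
qed

locale pcspace =
  fixes X :: "'a pcs"
  assumes is_pcs: "is_pcs X"
begin

abbreviation "dual_pts \<equiv> polar (web X) (pts X)"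

lemma countable_web: "countable (web X)"
  and pts_nnvec: "pts X \<subseteq> nnvec (web X)"
  and web_unit: "a \<in> web X \<Longrightarrow> \<exists>c>0. (\<lambda>b. if b = a then c else 0) \<in> pts X"
  and web_bounded: "a \<in> web X \<Longrightarrow> \<exists>M. \<forall>u\<in>pts X. u a \<le> M"
  using is_pcs by (auto simp: is_pcs_def)

lemma pts_nonneg: "x \<in> pts X \<Longrightarrow> 0 \<le> x a"
  by (rule nnvec_nonneg[OF subsetD[OF pts_nnvec]])

lemma pts_outside: "x \<in> pts X \<Longrightarrow> a \<notin> web X \<Longrightarrow> x a = 0"
  using pts_nnvec by (auto simp: nnvec_def)

lemma dual_nonneg: "v \<in> dual_pts \<Longrightarrow> 0 \<le> v a"
  by (rule nnvec_nonneg[OF subsetD[OF polar_subset_nnvec]])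

lemma pts_iff_finite_sums:
  "u \<in> pts X \<longleftrightarrow> u \<in> nnvec (web X) \<and>
    (\<forall>v\<in>dual_pts. \<forall>F. finite F \<longrightarrow> F \<subseteq> web X \<longrightarrow> (\<Sum>a\<in>F. u a * v a) \<le> 1)"
proof -
  have "polar (web X) dual_pts = pts X" using is_pcs by (simp add: is_pcs_def)
  then show ?thesis using polar_iff_finite_sums[of dual_pts "web X" u, OF polar_subset_nnvec] by simp
qed

lemma pts_sum_le: "u \<in> pts X \<Longrightarrow> v \<in> dual_pts \<Longrightarrow> finite F \<Longrightarrow> F \<subseteq> web X \<Longrightarrow> (\<Sum>a\<in>F. u a * v a) \<le> 1"
  using pts_iff_finite_sums by blast

lemma zero_pts: "(\<lambda>_. 0) \<in> pts X"
  by (auto simp: pts_iff_finite_sums nnvec_def)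

lemma pts_downward_closed:
  assumes "u \<in> pts X" "\<And>a. 0 \<le> v a" "\<And>a. v a \<le> u a"
  shows "v \<in> pts X"
  unfolding pts_iff_finite_sums
proof (intro conjI ballI allI impI)
  show "v \<in> nnvec (web X)"
    using assms pts_outside[OF assms(1)] by (auto simp: nnvec_def) (metis antisym)
  fix w F assume w: "w \<in> dual_pts" "finite F" "F \<subseteq> web X"
  have "(\<Sum>a\<in>F. v a * w a) \<le> (\<Sum>a\<in>F. u a * w a)"
    using assms dual_nonneg[OF w(1)] by (intro sum_mono mult_right_mono) auto
  then show "(\<Sum>a\<in>F. v a * w a) \<le> 1" using pts_sum_le[OF assms(1) w] by simp
qed

lemma pts_convex:
  assumes "u \<in> pts X" "v \<in> pts X" "0 \<le> s" "0 \<le> t" "s + t \<le> 1"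
  shows "(\<lambda>a. s * u a + t * v a) \<in> pts X"
  unfolding pts_iff_finite_sums
proof (intro conjI ballI allI impI)
  show "(\<lambda>a. s * u a + t * v a) \<in> nnvec (web X)"
    using assms by (auto simp: nnvec_def pts_outside pts_nonneg)
  fix w F assume w: "w \<in> dual_pts" "finite F" "F \<subseteq> web X"
  have "(\<Sum>a\<in>F. (s * u a + t * v a) * w a) = s * (\<Sum>a\<in>F. u a * w a) + t * (\<Sum>a\<in>F. v a * w a)"
    by (simp add: sum_distrib_left sum.distrib algebra_simps)
  also have "\<dots> \<le> s * 1 + t * 1"
    using pts_sum_le[OF _ w] assms by (intro add_mono mult_left_mono) auto
  finally show "(\<Sum>a\<in>F. (s * u a + t * v a) * w a) \<le> 1" using assms by simp
qed

lemma pts_limit: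
  assumes "\<And>n. s n \<in> pts X" "\<And>a. (\<lambda>n. s n a) \<longlonglongrightarrow> u a"
  shows "u \<in> pts X"
  unfolding pts_iff_finite_sums
proof (intro conjI ballI allI impI)
  have "0 \<le> u a" for a
    by (rule LIMSEQ_le_const[OF assms(2)]) (use pts_nonneg[OF assms(1)] in auto)
  moreover have "u a = 0" if "a \<notin> web X" for a
    using assms(2)[of a] by (simp add: pts_outside[OF assms(1) that] LIMSEQ_const_iff)
  ultimately show "u \<in> nnvec (web X)" by (auto simp: nnvec_def)
  fix w F assume w: "w \<in> dual_pts" "finite F" "F \<subseteq> web X"
  have "(\<lambda>n. \<Sum>a\<in>F. s n a * w a) \<longlonglongrightarrow> (\<Sum>a\<in>F. u a * w a)"
    by (intro tendsto_intros assms)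
  then show "(\<Sum>a\<in>F. u a * w a) \<le> 1"
    by (rule LIMSEQ_le_const2) (use pts_sum_le[OF assms(1) w] in auto)
qed

lemma pts_coordinate_bdd_above:
  assumes "\<And>n. s n \<in> pts X"
  shows "bdd_above (range (\<lambda>n. s n a))"
proof (cases "a \<in> web X")
  case True
  then obtain M where "\<forall>u\<in>pts X. u a \<le> M" using web_bounded by blast
  then show ?thesis using assms by (intro bdd_aboveI[of _ M]) auto
next
  case False
  then show ?thesis using assms by (intro bdd_aboveI[of _ 0]) (auto simp: pts_outside)
qed

lemma carrier_iff: "x \<in> Fm_carrier X \<longleftrightarrow> (\<exists>r>0. (\<lambda>a. r * x a) \<in> pts X)"
proof
  assume "x \<in> Fm_carrier X"
  then obtain \<alpha> y where x: "x = (\<lambda>a. \<alpha> * y a)" "0 \<le> \<alpha>" "y \<in> pts X" by (auto simp: Fm_carrier_def)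
  show "\<exists>r>0. (\<lambda>a. r * x a) \<in> pts X"
  proof (cases "\<alpha> = 0")
    case True
    then show ?thesis using x zero_pts by (intro exI[of _ 1]) auto
  next
    case False
    then show ?thesis using x by (intro exI[of _ "1 / \<alpha>"]) auto
  qed
next
  assume "\<exists>r>0. (\<lambda>a. r * x a) \<in> pts X"
  then obtain r where r: "r > 0" "(\<lambda>a. r * x a) \<in> pts X" by blast
  then show "x \<in> Fm_carrier X"
    unfolding Fm_carrier_def by (intro CollectI exI[of _ "1/r"] exI[of _ "\<lambda>a. r * x a"]) auto
qed

lemma pts_carrier: "x \<in> pts X \<Longrightarrow> x \<in> Fm_carrier X"
  unfolding carrier_iff by (intro exI[of _ 1]) auto

lemma carrier_nonneg: "x \<in> Fm_carrier X \<Longrightarrow> 0 \<le> x a"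
  by (auto simp: Fm_carrier_def pts_nonneg)

lemma carrier_outside: "x \<in> Fm_carrier X \<Longrightarrow> a \<notin> web X \<Longrightarrow> x a = 0"
  by (auto simp: Fm_carrier_def pts_outside)

lemma carrier_downward_closed:
  assumes "u \<in> Fm_carrier X" "\<And>a. 0 \<le> v a" "\<And>a. v a \<le> u a"
  shows "v \<in> Fm_carrier X"
proof -
  obtain r where r: "r > 0" "(\<lambda>a. r * u a) \<in> pts X" using assms carrier_iff by blast
  then have "(\<lambda>a. r * v a) \<in> pts X"
    using assms by (intro pts_downward_closed[OF r(2)]) auto
  then show ?thesis using r carrier_iff by blast
qed

lemma carrier_scale:
  assumes "u \<in> Fm_carrier X" "0 \<le> t"
  shows "(\<lambda>a. t * u a) \<in> Fm_carrier X"
proof -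
  obtain \<alpha> y where u: "u = (\<lambda>a. \<alpha> * y a)" "0 \<le> \<alpha>" "y \<in> pts X" using assms by (auto simp: Fm_carrier_def)
  then show ?thesis
    unfolding Fm_carrier_def using assms
      by (intro CollectI exI[of _ "t * \<alpha>"] exI[of _ y]) (auto simp: mult.assoc)
qed

lemma carrier_add:
  assumes "x \<in> Fm_carrier X" "y \<in> Fm_carrier X"
  shows "(\<lambda>a. x a + y a) \<in> Fm_carrier X"
proof -
  obtain r s where r: "r > 0" "(\<lambda>a. r * x a) \<in> pts X" and s: "s > 0" "(\<lambda>a. s * y a) \<in> pts X"
    using assms carrier_iff by blast
  have "(\<lambda>a. s / (r + s) * (r * x a) + r / (r + s) * (s * y a)) \<in> pts X"
    by (rule pts_convex) (use r s in \<open>auto simp: add_divide_distrib[symmetric] add.commute\<close>)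
  also have "(\<lambda>a. s / (r + s) * (r * x a) + r / (r + s) * (s * y a)) = (\<lambda>a. (r * s / (r + s)) * (x a + y a))"
    by (simp add: fun_eq_iff add_divide_distrib distrib_left mult.assoc mult.left_commute)
  finally show ?thesis unfolding carrier_iff using r s by (intro exI[of _ "r * s / (r + s)"]) auto
qed

lemma finite_support_carrier:
  assumes "finite A" "A \<subseteq> web X" "\<And>a. 0 \<le> x a" "\<And>a. a \<notin> A \<Longrightarrow> x a = 0"
  shows "x \<in> Fm_carrier X"
  using assms
proof (induction A arbitrary: x rule: finite_induct)
  case empty
  then have "x = (\<lambda>_. 0)" by (simp add: fun_eq_iff)
  then show ?case using pts_carrier[OF zero_pts] by simp
next
  case (insert b A)
  obtain c where c: "c > 0" "(\<lambda>a. if a = b then c else 0) \<in> pts X" using web_unit insert.prems(1) by auto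
  have "x(b := 0) \<in> Fm_carrier X" using insert.prems by (intro insert.IH) auto
  moreover have "(\<lambda>a. x b / c * (if a = b then c else 0)) \<in> Fm_carrier X"
    using c insert.prems(2) by (intro carrier_scale pts_carrier) auto
  ultimately have "(\<lambda>a. (x(b := 0)) a + x b / c * (if a = b then c else 0)) \<in> Fm_carrier X"
    by (rule carrier_add)
  also have "(\<lambda>a. (x(b := 0)) a + x b / c * (if a = b then c else 0)) = x"
    using c by (auto simp: fun_eq_iff)
  finally show ?case .
qed

lemma Fm_obj_simps:
  "carrier (Fm_obj X) = Fm_carrier X" "\<zero>\<^bsub>Fm_obj X\<^esub> = (\<lambda>_. 0)"
  "x \<oplus>\<^bsub>Fm_obj X\<^esub> y = (\<lambda>a. x a + y a)" "t \<odot>\<^bsub>Fm_obj X\<^esub> x = (\<lambda>a. t * x a)"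
  by (auto simp: Fm_obj_def)

abbreviation pnorm :: "('a \<Rightarrow> real) \<Rightarrow> real" where
  "pnorm \<equiv> cnorm (Fm_obj X)"

lemma pnorm_eq_Inf: "pnorm x = Inf {1 / r | r. 0 < r \<and> (\<lambda>a. r * x a) \<in> pts X}"
  by (simp add: Fm_obj_def)

lemma pnorm_nonneg: "x \<in> Fm_carrier X \<Longrightarrow> 0 \<le> pnorm x"
  unfolding pnorm_eq_Inf carrier_iff by (rule cInf_greatest) auto

lemma pnorm_le_iff:
  assumes "x \<in> Fm_carrier X" "0 < t"
  shows "pnorm x \<le> t \<longleftrightarrow> (\<lambda>a. x a / t) \<in> pts X"
proof
  let ?R = "{1 / r | r. 0 < r \<and> (\<lambda>a. r * x a) \<in> pts X}"
  have bdd: "bdd_below ?R" and nonempty: "?R \<noteq> {}"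
    using assms(1) by (auto simp: carrier_iff intro: bdd_belowI[of _ 0])
  show "pnorm x \<le> t" if "(\<lambda>a. x a / t) \<in> pts X"
    unfolding pnorm_eq_Inf
    by (rule cInf_lower[OF _ bdd]) (use that assms(2) in \<open>auto intro!: exI[of _ "1/t"]\<close>)
  have strict: "(\<lambda>a. x a / s) \<in> pts X" if less: "pnorm x < s" for s
  proof -
    obtain r where r: "0 < r" "(\<lambda>a. r * x a) \<in> pts X" "1 / r < s"
      using less unfolding pnorm_eq_Inf cInf_less_iff[OF nonempty bdd] by auto
    have "0 < s" using pnorm_nonneg[OF assms(1)] less by simp
    then have "1 / s \<le> r" using r by (simp add: field_simps)
    then have "x a / s \<le> r * x a" for a
      using mult_right_mono[OF _ carrier_nonneg[OF assms(1)], of "1/s" r] by simp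
    then show ?thesis
      using carrier_nonneg[OF assms(1)] \<open>0 < s\<close> by (intro pts_downward_closed[OF r(2)]) auto
  qed
  assume le: "pnorm x \<le> t"
  show "(\<lambda>a. x a / t) \<in> pts X"
  proof (rule pts_limit)
    show "(\<lambda>a. x a / (t + 1 / Suc n)) \<in> pts X" for n
      by (rule strict) (use le in \<open>simp add: add_pos_pos less_add_same_cancel1 le_less_trans\<close>)
    have "(\<lambda>n. 1 / real (Suc n)) \<longlonglongrightarrow> 0" using LIMSEQ_inverse_real_of_nat by (simp add: inverse_eq_divide)
    then have "(\<lambda>n. x a / (t + 1 / Suc n)) \<longlonglongrightarrow> x a / (t + 0)" for a
      using assms(2) by (intro tendsto_intros) auto
    then show "(\<lambda>n. x a / (t + 1 / Suc n)) \<longlonglongrightarrow> x a / t" for a by simp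
  qed
qed

lemma pnorm_le_1_iff: "x \<in> Fm_carrier X \<and> pnorm x \<le> 1 \<longleftrightarrow> x \<in> pts X"
  using pnorm_le_iff[of x 1] pts_carrier by auto

lemma pnorm_mono:
  assumes x: "x \<in> Fm_carrier X" and y: "y \<in> Fm_carrier X" and le: "\<And>a. x a \<le> y a"
  shows "pnorm x \<le> pnorm y"
proof (rule dense_ge)
  fix t assume "pnorm y < t"
  moreover from this have t: "t > 0" using pnorm_nonneg[OF y] by simp
  ultimately have "(\<lambda>a. y a / t) \<in> pts X" using pnorm_le_iff[OF y t] by simp
  then have "(\<lambda>a. x a / t) \<in> pts X"
    by (rule pts_downward_closed) (use le t carrier_nonneg[OF x] in \<open>auto intro: divide_right_mono\<close>)
  then show "pnorm x \<le> t" by (simp add: pnorm_le_iff[OF x t])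
qed

lemma pnorm_triangle:
  assumes x: "x \<in> Fm_carrier X" and y: "y \<in> Fm_carrier X"
  shows "pnorm (\<lambda>a. x a + y a) \<le> pnorm x + pnorm y"
proof (rule field_le_epsilon)
  fix e :: real assume "e > 0"
  define s t where "s = pnorm x + e / 2" and "t = pnorm y + e / 2"
  have pos: "s > 0" "t > 0" using \<open>e > 0\<close> pnorm_nonneg x y by (simp_all add: s_def t_def add_nonneg_pos)
  have "(\<lambda>a. x a / s) \<in> pts X" "(\<lambda>a. y a / t) \<in> pts X"
    using \<open>e > 0\<close> pnorm_le_iff[OF x pos(1)] pnorm_le_iff[OF y pos(2)] by (simp_all add: s_def t_def)
  then have "(\<lambda>a. s / (s + t) * (x a / s) + t / (s + t) * (y a / t)) \<in> pts X"
    by (rule pts_convex) (use pos in \<open>auto simp: add_divide_distrib[symmetric]\<close>)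
  also have "(\<lambda>a. s / (s + t) * (x a / s) + t / (s + t) * (y a / t)) = (\<lambda>a. (x a + y a) / (s + t))"
    using pos by (auto simp: add_divide_distrib)
  finally have "pnorm (\<lambda>a. x a + y a) \<le> s + t"
    using pos by (simp add: pnorm_le_iff carrier_add[OF x y])
  then show "pnorm (\<lambda>a. x a + y a) \<le> pnorm x + pnorm y + e" by (simp add: s_def t_def)
qed

lemma pnorm_zero: "pnorm (\<lambda>_. 0) = 0"
proof (rule antisym)
  show "pnorm (\<lambda>_. 0) \<le> 0"
    by (rule dense_ge) (simp add: pnorm_le_iff pts_carrier zero_pts)
qed (simp add: pnorm_nonneg pts_carrier zero_pts)

lemma pnorm_scale:
  assumes x: "x \<in> Fm_carrier X" and "0 \<le> \<alpha>"
  shows "pnorm (\<lambda>a. \<alpha> * x a) = \<alpha> * pnorm x"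
proof (cases "\<alpha> = 0")
  case False
  then have \<alpha>: "\<alpha> > 0" using assms by simp
  have le_iff: "pnorm (\<lambda>a. \<alpha> * x a) \<le> t \<longleftrightarrow> \<alpha> * pnorm x \<le> t" if t: "t > 0" for t
  proof -
    have "pnorm (\<lambda>a. \<alpha> * x a) \<le> t \<longleftrightarrow> (\<lambda>a. x a / (t / \<alpha>)) \<in> pts X"
      using pnorm_le_iff[OF carrier_scale[OF x assms(2)] t] by (simp add: mult.commute)
    also have "\<dots> \<longleftrightarrow> pnorm x \<le> t / \<alpha>" using pnorm_le_iff[OF x, of "t / \<alpha>"] t \<alpha> by simp
    also have "\<dots> \<longleftrightarrow> \<alpha> * pnorm x \<le> t" using \<alpha> by (simp add: field_simps)
    finally show ?thesis .
  qed
  have nonneg: "0 \<le> pnorm (\<lambda>a. \<alpha> * x a)" "0 \<le> \<alpha> * pnorm x"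
    using pnorm_nonneg[OF carrier_scale[OF assms]] pnorm_nonneg[OF x] assms(2) by simp_all
  show ?thesis
  proof (rule antisym; rule dense_ge)
    show "pnorm (\<lambda>a. \<alpha> * x a) \<le> t" if "\<alpha> * pnorm x < t" for t
      using le_iff[of t] nonneg that by simp
    show "\<alpha> * pnorm x \<le> t" if "pnorm (\<lambda>a. \<alpha> * x a) < t" for t
      using le_iff[of t] nonneg that by simp
  qed
qed (simp add: pnorm_zero)

lemma pnorm_eq_0:
  assumes x: "x \<in> Fm_carrier X" and "pnorm x = 0"
  shows "x = (\<lambda>_. 0)"
proof
  fix a
  show "x a = 0"
  proof (cases "a \<in> web X")
    case True
    then obtain M where M: "\<forall>u\<in>pts X. u a \<le> M" using web_bounded by blast
    have "x a \<le> M * t" if t: "t > 0" for t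
    proof -
      have "(\<lambda>b. x b / t) \<in> pts X" using pnorm_le_iff[OF x t] assms(2) t by simp
      then have "x a / t \<le> M" using M by (rule bspec[rotated])
      then show ?thesis using t by (simp add: field_simps)
    qed
    then have "\<forall>\<^sub>F t in at_right 0. x a \<le> M * t"
      by (intro eventually_at_right_less[THEN eventually_mono]) auto
    then have "x a \<le> M * 0" by (intro tendsto_lowerbound[of "\<lambda>t. M * t" _ "at_right 0"] tendsto_intros) auto
    then show ?thesis using carrier_nonneg[OF x, of a] by simp
  qed (simp add: carrier_outside[OF x])
qed

lemma cone_ball_Fm_obj: "cone_ball (Fm_obj X) = pts X"
  using pnorm_le_1_iff by (auto simp: cone_ball_def Fm_obj_simps)

lemma cone_le_Fm_obj:
  assumes "x \<in> Fm_carrier X" "y \<in> Fm_carrier X"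
  shows "cone_le (Fm_obj X) x y \<longleftrightarrow> (\<forall>a. x a \<le> y a)"
proof
  assume "cone_le (Fm_obj X) x y"
  then show "\<forall>a. x a \<le> y a" using carrier_nonneg by (auto simp: cone_le_def Fm_obj_simps)
next
  assume le: "\<forall>a. x a \<le> y a"
  have "(\<lambda>a. y a - x a) \<in> Fm_carrier X"
    using le carrier_nonneg[OF assms(1)] by (intro carrier_downward_closed[OF assms(2)]) auto
  then show "cone_le (Fm_obj X) x y"
    unfolding cone_le_def by (intro bexI[of _ "\<lambda>a. y a - x a"]) (auto simp: Fm_obj_simps)
qed

lemma normed_cone_Fm_obj: "normed_cone (Fm_obj X)"
proof (rule normed_cone.intro)
  show "abelian_monoid (Fm_obj X)"
    by (rule abelian_monoidI) (auto simp: Fm_obj_simps carrier_add pts_carrier zero_pts add.assoc add.commute)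
  show "normed_cone_axioms (Fm_obj X)"
  proof (unfold_locales, unfold Fm_obj_simps)
    fix x y z :: "'a \<Rightarrow> real" assume "(\<lambda>a. x a + y a) = (\<lambda>a. x a + z a)"
    then show "y = z" by (simp add: fun_eq_iff)
  next
    fix x y assume "x \<in> Fm_carrier X" "y \<in> Fm_carrier X"
    then show "pnorm x \<le> pnorm (\<lambda>a. x a + y a)"
      by (intro pnorm_mono carrier_add) (auto simp: carrier_nonneg)
  qed (simp_all add: carrier_scale distrib_left distrib_right mult.assoc
    pnorm_nonneg pnorm_scale pnorm_triangle pnorm_eq_0)
qed

lemma cone_incseq_Fm_obj:
  assumes "\<And>n. s n \<in> Fm_carrier X"
  shows "cone_incseq (Fm_obj X) s \<longleftrightarrow> (\<forall>a. incseq (\<lambda>n. s n a))"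
  using cone_le_Fm_obj[OF assms assms] by (auto simp: cone_incseq_def incseq_Suc_iff)

lemma cone_lub_Fm_objI:
  assumes s: "\<And>n. s n \<in> Fm_carrier X" and x: "x \<in> Fm_carrier X"
    and inc: "\<And>a. incseq (\<lambda>n. s n a)" and lim: "\<And>a. (\<lambda>n. s n a) \<longlonglongrightarrow> x a"
  shows "cone_lub (Fm_obj X) s x"
  unfolding cone_lub_def Fm_obj_simps
proof (intro conjI allI ballI impI)
  show "x \<in> Fm_carrier X" by fact
  show "cone_le (Fm_obj X) (s n) x" for n
    unfolding cone_le_Fm_obj[OF s x] using incseq_le[OF inc lim] by blast
  fix y assume y: "y \<in> Fm_carrier X" and "\<forall>n. cone_le (Fm_obj X) (s n) y"
  then have "s n a \<le> y a" for n a using cone_le_Fm_obj[OF s y] by blast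
  then show "cone_le (Fm_obj X) x y"
    unfolding cone_le_Fm_obj[OF x y] using LIMSEQ_le_const2[OF lim] by blast
qed

lemma cone_lub_Fm_objD:
  assumes s: "\<And>n. s n \<in> Fm_carrier X" and inc: "cone_incseq (Fm_obj X) s"
    and lub: "cone_lub (Fm_obj X) s x"
  shows "(\<lambda>n. s n a) \<longlonglongrightarrow> x a"
proof -
  have incseq: "incseq (\<lambda>n. s n b)" for b using inc cone_incseq_Fm_obj[of s, OF s] by blast
  have x: "x \<in> Fm_carrier X" using lub by (simp add: cone_lub_def Fm_obj_simps)
  have le: "s n b \<le> x b" for n b using lub cone_le_Fm_obj[OF s x] by (simp add: cone_lub_def)
  have bdd: "bdd_above (range (\<lambda>n. s n b))" for b using le by (intro bdd_aboveI[of _ "x b"]) auto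
  let ?y = "\<lambda>b. SUP n. s n b"
  have y_le: "?y b \<le> x b" for b using le by (intro cSUP_least) auto
  have y: "?y \<in> Fm_carrier X"
    using order_trans[OF carrier_nonneg[OF s] cSUP_upper[OF _ bdd]] y_le
      by (intro carrier_downward_closed[OF x]) auto
  have "cone_le (Fm_obj X) x ?y"
    using lub y cSUP_upper[OF _ bdd] by (auto simp: cone_lub_def Fm_obj_simps cone_le_Fm_obj[OF s y])
  then have "x a = ?y a" using cone_le_Fm_obj[OF x y] y_le by (auto intro: antisym)
  then show ?thesis using LIMSEQ_incseq_SUP[OF bdd incseq] by simp
qed

lemma seq_complete_cone_Fm_obj: "seq_complete_cone (Fm_obj X)"
proof -
  interpret normed_cone "Fm_obj X" by (rule normed_cone_Fm_obj)
  show ?thesis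
  proof
    fix s assume "range s \<subseteq> cone_ball (Fm_obj X)" and inc: "cone_incseq (Fm_obj X) s"
    then have s: "s n \<in> pts X" for n by (auto simp: cone_ball_Fm_obj)
    have incseq: "incseq (\<lambda>n. s n a)" for a using inc cone_incseq_Fm_obj[of s, OF pts_carrier[OF s]] by blast
    have lim: "(\<lambda>n. s n a) \<longlonglongrightarrow> (SUP n. s n a)" for a
      by (rule LIMSEQ_incseq_SUP[OF pts_coordinate_bdd_above[OF s] incseq])
    have sup: "(\<lambda>a. SUP n. s n a) \<in> pts X" by (rule pts_limit[OF s lim])
    then show "\<exists>x\<in>cone_ball (Fm_obj X). cone_lub (Fm_obj X) s x"
      using s incseq lim
        by (intro bexI[of _ "\<lambda>a. SUP n. s n a"] cone_lub_Fm_objI pts_carrier)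
          (auto simp: cone_ball_Fm_obj)
  qed
qed

definition functionals :: "(('a \<Rightarrow> real) \<Rightarrow> real) set" where
  "functionals = insert (\<lambda>_. 0) ((\<lambda>a x. x a) ` web X)"

lemma tests_Fm_obj:
  "tests (Fm_obj X) n = (\<lambda>c. \<lambda>r\<in>space (RR n). restrict c (Fm_carrier X)) ` functionals"
  by (auto simp: Fm_obj_def functionals_def)

lemma functional_dual:
  assumes "c \<in> functionals"
  shows "restrict c (Fm_carrier X) \<in> cone_dual (Fm_obj X)"
  unfolding cone_dual_def Fm_obj_simps
proof (intro CollectI conjI allI ballI impI)
  fix s x
  assume "range s \<subseteq> Fm_carrier X" and inc: "cone_incseq (Fm_obj X) s" and lub: "cone_lub (Fm_obj X) s x"
  then have s: "s n \<in> Fm_carrier X" for n by auto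
  have x: "x \<in> Fm_carrier X" using lub by (simp add: cone_lub_def Fm_obj_simps)
  have incseq: "incseq (\<lambda>n. c (s n))" and lim: "(\<lambda>n. c (s n)) \<longlonglongrightarrow> c x"
    using assms inc cone_incseq_Fm_obj[of s, OF s] cone_lub_Fm_objD[OF s inc lub]
      by (auto simp: functionals_def)
  have "bdd_above (range (\<lambda>n. c (s n)))" using incseq_le[OF incseq lim]
    by (auto intro: bdd_aboveI[of _ "c x"])
  then have "c x = (SUP n. c (s n))" using LIMSEQ_incseq_SUP[OF _ incseq] LIMSEQ_unique lim by blast
  then show "restrict c (Fm_carrier X) x = (SUP n. restrict c (Fm_carrier X) (s n))" using x s by simp
qed (use assms in \<open>auto simp: functionals_def carrier_nonneg carrier_add carrier_scale\<close>)

lemma measurable_cone_Fm_obj: "measurable_cone (Fm_obj X)"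
proof -
  interpret seq_complete_cone "Fm_obj X" by (rule seq_complete_cone_Fm_obj)
  show ?thesis
  proof
    show "tests (Fm_obj X) n \<subseteq> space (RR n) \<rightarrow>\<^sub>E cone_dual (Fm_obj X)" for n
      using functional_dual by (auto simp: tests_Fm_obj)
    show "(\<lambda>r\<in>space (RR n). \<lambda>x\<in>carrier (Fm_obj X). 0) \<in> tests (Fm_obj X) n" for n
      by (auto simp: tests_Fm_obj Fm_obj_simps functionals_def)
  next
    fix l n h p assume "l \<in> tests (Fm_obj X) n" and h: "h \<in> RR p \<rightarrow>\<^sub>M RR n"
    then obtain c where c: "c \<in> functionals" "l = (\<lambda>r\<in>space (RR n). restrict c (Fm_carrier X))"
      by (auto simp: tests_Fm_obj)
    have "(\<lambda>r\<in>space (RR p). l (h r)) = (\<lambda>r\<in>space (RR p). restrict c (Fm_carrier X))"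
      using measurable_space[OF h] by (simp add: c(2) cong: restrict_cong)
    then show "(\<lambda>r\<in>space (RR p). l (h r)) \<in> tests (Fm_obj X) p"
      using c(1) by (simp add: tests_Fm_obj)
  next
    fix l n x assume "l \<in> tests (Fm_obj X) n" and "x \<in> carrier (Fm_obj X)"
    then obtain c where "\<And>r. r \<in> space (RR n) \<Longrightarrow> l r x = c x" by (auto simp: tests_Fm_obj Fm_obj_simps)
    then show "(\<lambda>r. l r x) \<in> borel_measurable (RR n)" by (simp cong: measurable_cong)
  qed
qed

lemma test_path_measurable_iff:
  assumes \<gamma>: "\<gamma> \<in> space (RR n) \<rightarrow> Fm_carrier X"
  shows "(\<lambda>(r, s). (\<lambda>r\<in>space (RR k). restrict c (Fm_carrier X)) r (\<gamma> s)) \<in> borel_measurable (RR k \<Otimes>\<^sub>M RR n) \<longleftrightarrow>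
    (\<lambda>s. c (\<gamma> s)) \<in> borel_measurable (RR n)"
proof -
  have r: "(\<lambda>i\<in>{..<k}. 0) \<in> space (RR k)" by (simp add: space_PiM)
  have "(\<lambda>(r, s). (\<lambda>r\<in>space (RR k). restrict c (Fm_carrier X)) r (\<gamma> s)) \<in> borel_measurable (RR k \<Otimes>\<^sub>M RR n) \<longleftrightarrow>
      (\<lambda>w. c (\<gamma> (snd w))) \<in> borel_measurable (RR k \<Otimes>\<^sub>M RR n)"
    using \<gamma> by (intro measurable_cong) (auto simp: space_pair_measure)
  also have "\<dots> \<longleftrightarrow> (\<lambda>s. c (\<gamma> s)) \<in> borel_measurable (RR n)"
  proof
    assume "(\<lambda>w. c (\<gamma> (snd w))) \<in> borel_measurable (RR k \<Otimes>\<^sub>M RR n)"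
    from measurable_compose[OF measurable_Pair1'[OF r] this]
    show "(\<lambda>s. c (\<gamma> s)) \<in> borel_measurable (RR n)" by simp
  qed (rule measurable_compose[OF measurable_snd])
  finally show ?thesis .
qed

lemma measurable_path_Fm_obj:
  "measurable_path (Fm_obj X) n \<gamma> \<longleftrightarrow> \<gamma> \<in> space (RR n) \<rightarrow> Fm_carrier X \<and>
     (\<exists>M. \<forall>s\<in>space (RR n). pnorm (\<gamma> s) \<le> M) \<and> (\<forall>a\<in>web X. (\<lambda>s. \<gamma> s a) \<in> borel_measurable (RR n))"
proof -
  have "(\<forall>k. \<forall>l\<in>tests (Fm_obj X) k. (\<lambda>(r, s). l r (\<gamma> s)) \<in> borel_measurable (RR k \<Otimes>\<^sub>M RR n)) \<longleftrightarrow>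
      (\<forall>c\<in>functionals. (\<lambda>s. c (\<gamma> s)) \<in> borel_measurable (RR n))"
    if "\<gamma> \<in> space (RR n) \<rightarrow> Fm_carrier X"
    unfolding tests_Fm_obj ball_simps(9) test_path_measurable_iff[OF that] by simp
  then show ?thesis
    by (auto simp: measurable_path_def Fm_obj_simps functionals_def)
qed

end

sublocale pcspace \<subseteq> cone: measurable_cone "Fm_obj X"
  by (rule measurable_cone_Fm_obj)

context pcspace
begin

lemma finsum_Fm_obj:
  assumes "finite I" "\<And>i. i \<in> I \<Longrightarrow> u i \<in> Fm_carrier X"
  shows "(\<Oplus>\<^bsub>Fm_obj X\<^esub>i\<in>I. u i) = (\<lambda>a. \<Sum>i\<in>I. u i a)"
  using assms by (induction I rule: finite_induct) (auto simp: Fm_obj_simps)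

lemma monotone_cube_coordinate:
  assumes "finite N" and cube: "monotone_cube (Fm_obj X) N F"
  shows "monotone_cube nonneg_semiring N (\<lambda>I. F I a)"
proof -
  obtain d where d: "cube_differences (Fm_obj X) N F d" using cube by (auto simp: monotone_cube_def)
  have closed: "d J \<in> Fm_carrier X" if "J \<subseteq> N" for J
    using cube_differences_closed[OF d that] by (simp add: Fm_obj_simps)
  have "F I a = (\<Sum>J\<in>Pow I. d J a)" if "I \<subseteq> N" for I
  proof -
    have "finite (Pow I)" using that assms(1) finite_subset by auto
    then have "(\<Oplus>\<^bsub>Fm_obj X\<^esub>J\<in>Pow I. d J) = (\<lambda>a. \<Sum>J\<in>Pow I. d J a)"
      by (rule finsum_Fm_obj) (use closed that in auto)
    then show ?thesis using d that by (simp add: cube_differences_def)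
  qed
  then show ?thesis
    using carrier_nonneg[OF closed]
    by (auto simp: monotone_cube_def cube_differences_nonneg_semiring intro!: exI[of _ "\<lambda>J. d J a"])
qed

lemma monotone_cube_Fm_objI:
  assumes "finite N" and top: "F N \<in> Fm_carrier X"
    and cubes: "\<And>a. monotone_cube nonneg_semiring N (\<lambda>I. F I a)"
  shows "monotone_cube (Fm_obj X) N F"
proof -
  obtain d where "\<And>a. cube_differences nonneg_semiring N (\<lambda>I. F I a) (d a)"
    using cubes unfolding monotone_cube_def by metis
  then have d: "\<And>a J. J \<subseteq> N \<Longrightarrow> 0 \<le> d a J" "\<And>a I. I \<subseteq> N \<Longrightarrow> F I a = (\<Sum>J\<in>Pow I. d a J)"
    by (simp_all add: cube_differences_nonneg_semiring)
  have closed: "(\<lambda>a. d a J) \<in> Fm_carrier X" if J: "J \<subseteq> N" for J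
  proof (rule carrier_downward_closed[OF top])
    show "\<And>a. 0 \<le> d a J" using d(1) J by simp
    show "d a J \<le> F N a" for a
      unfolding d(2)[OF subset_refl] by (rule member_le_sum) (use J d(1) assms(1) in auto)
  qed
  have "F I = (\<Oplus>\<^bsub>Fm_obj X\<^esub>J\<in>Pow I. (\<lambda>a. d a J))" if I: "I \<subseteq> N" for I
  proof -
    have "finite (Pow I)" using I assms(1) finite_subset by auto
    then have "(\<Oplus>\<^bsub>Fm_obj X\<^esub>J\<in>Pow I. (\<lambda>a. d a J)) = (\<lambda>a. \<Sum>J\<in>Pow I. d a J)"
      by (rule finsum_Fm_obj) (use closed I in auto)
    then show ?thesis using d(2)[OF I] by (simp add: fun_eq_iff)
  qed
  then show ?thesis
    using closed unfolding monotone_cube_def cube_differences_def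
    by (intro exI[of _ "\<lambda>J a. d a J"]) (auto simp: Fm_obj_simps)
qed

end

section \<open>Infinite sums of nonnegative extended reals\<close>

lemma countable_finite_exhaustion:
  assumes "countable A"
  obtains F :: "nat \<Rightarrow> 'a set" where "incseq F" "\<And>n. finite (F n)" "(\<Union>n. F n) = A"
proof
  let ?F = "\<lambda>n. to_nat_on A -` {..<n} \<inter> A"
  show "incseq ?F" by (auto simp: incseq_def)
  show "finite (?F n)" for n
    by (intro finite_vimage_IntI inj_on_to_nat_on assms) simp
  show "(\<Union>n. ?F n) = A" by auto
qed

lemma infsum_ennreal_eq_SUP:
  fixes f :: "'a \<Rightarrow> ennreal"
  assumes "incseq F" "\<And>n. finite (F n)" "(\<Union>n. F n) = A"
  shows "infsum f A = (SUP n. sum f (F n))"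
proof -
  have "(SUP G\<in>{G. finite G \<and> G \<subseteq> A}. sum f G) = (SUP n. sum f (F n))"
  proof (rule antisym)
    show "(SUP G\<in>{G. finite G \<and> G \<subseteq> A}. sum f G) \<le> (SUP n. sum f (F n))"
    proof (rule SUP_mono)
      fix G assume "G \<in> {G. finite G \<and> G \<subseteq> A}"
      then have G: "finite G" "G \<subseteq> A" by auto
      have "\<forall>\<^sub>F n in sequentially. a \<in> F n" if a: "a \<in> G" for a
      proof -
        obtain m where "a \<in> F m" using a G(2) assms(3) by auto
        then show ?thesis
          using incseqD[OF assms(1)] by (intro eventually_mono[OF eventually_ge_at_top[of m]]) auto
      qed
      then have "\<forall>\<^sub>F n in sequentially. \<forall>a\<in>G. a \<in> F n" by (intro eventually_ball_finite G(1) ballI)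
      then obtain n where "G \<subseteq> F n" by (auto simp: eventually_sequentially)
      then show "\<exists>n\<in>UNIV. sum f G \<le> sum f (F n)" using assms(2) by (intro bexI sum_mono2) auto
    qed
    show "(SUP n. sum f (F n)) \<le> (SUP G\<in>{G. finite G \<and> G \<subseteq> A}. sum f G)"
      by (rule SUP_mono) (use assms in auto)
  qed
  then show ?thesis by (subst nonneg_infsum_complete) auto
qed

lemma nn_integral_count_space_eq_infsum:
  fixes f :: "'a \<Rightarrow> ennreal"
  assumes "countable A"
  shows "(\<integral>\<^sup>+x. f x \<partial>count_space A) = infsum f A"
proof -
  obtain F :: "nat \<Rightarrow> 'a set" where F: "incseq F" "\<And>n. finite (F n)" "(\<Union>n. F n) = A"
    using countable_finite_exhaustion[OF assms] by metis
  have "f x = (SUP n. f x * indicator (F n) x)" if x: "x \<in> A" for x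
  proof (rule antisym)
    obtain n where "x \<in> F n" using x F(3) by auto
    then show "f x \<le> (SUP n. f x * indicator (F n) x)" by (intro SUP_upper2[of n]) auto
  qed (auto intro!: SUP_least simp: indicator_def)
  then have "(\<integral>\<^sup>+x. f x \<partial>count_space A) = (\<integral>\<^sup>+x. (SUP n. f x * indicator (F n) x) \<partial>count_space A)"
    by (intro nn_integral_cong) simp
  also have "\<dots> = (SUP n. \<integral>\<^sup>+x. f x * indicator (F n) x \<partial>count_space A)"
    using F(1)
      by (intro nn_integral_monotone_convergence_SUP)
        (auto simp: incseq_def le_fun_def indicator_def split: if_splits)
  also have "\<dots> = (SUP n. sum f (F n))"
  proof (rule SUP_cong)
    fix n
    have "(\<integral>\<^sup>+x. f x * indicator (F n) x \<partial>count_space A) = (\<Sum>x\<in>F n. f x * indicator (F n) x)"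
      by (rule nn_integral_count_space') (use F in auto)
    then show "(\<integral>\<^sup>+x. f x * indicator (F n) x \<partial>count_space A) = sum f (F n)" by simp
  qed simp
  also have "\<dots> = infsum f A" by (rule infsum_ennreal_eq_SUP[OF F, symmetric])
  finally show ?thesis .
qed

lemma borel_measurable_infsum_ennreal:
  fixes f :: "'a \<Rightarrow> 'b \<Rightarrow> ennreal"
  assumes "countable A" "\<And>a. a \<in> A \<Longrightarrow> f a \<in> borel_measurable M"
  shows "(\<lambda>x. \<Sum>\<^sub>\<infinity>a\<in>A. f a x) \<in> borel_measurable M"
proof -
  obtain F :: "nat \<Rightarrow> 'a set" where F: "incseq F" "\<And>n. finite (F n)" "(\<Union>n. F n) = A"
    using countable_finite_exhaustion[OF assms(1)] by metis
  show ?thesis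
    unfolding infsum_ennreal_eq_SUP[OF F] using F(3)
    by (intro borel_measurable_SUP borel_measurable_sum assms(2)) auto
qed

lemma infsum_ennreal_SUP:
  fixes G :: "nat \<Rightarrow> 'a \<Rightarrow> ennreal"
  assumes "countable A" "\<And>a. incseq (\<lambda>n. G n a)"
  shows "(\<Sum>\<^sub>\<infinity>a\<in>A. SUP n. G n a) = (SUP n. \<Sum>\<^sub>\<infinity>a\<in>A. G n a)"
  unfolding nn_integral_count_space_eq_infsum[OF assms(1), symmetric]
  by (rule nn_integral_monotone_convergence_SUP) (use assms(2) in \<open>auto simp: incseq_def le_fun_def\<close>)

lemma infsum_ennreal_dominated_convergence:
  fixes G :: "nat \<Rightarrow> 'a \<Rightarrow> ennreal"
  assumes "countable A" "\<And>n a. a \<in> A \<Longrightarrow> G n a \<le> w a" "infsum w A < \<infinity>"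
    and "\<And>a. a \<in> A \<Longrightarrow> (\<lambda>n. G n a) \<longlonglongrightarrow> g a"
  shows "(\<lambda>n. infsum (G n) A) \<longlonglongrightarrow> infsum g A"
  unfolding nn_integral_count_space_eq_infsum[OF assms(1), symmetric]
  by (rule nn_integral_dominated_convergence[where w = w])
     (use assms in \<open>auto simp: AE_count_space nn_integral_count_space_eq_infsum\<close>)

lemma infsum_ennreal_sum:
  fixes d :: "'m \<Rightarrow> 'j \<Rightarrow> ennreal"
  shows "(\<Sum>\<^sub>\<infinity>\<mu>\<in>M. \<Sum>J\<in>A. d \<mu> J) = (\<Sum>J\<in>A. \<Sum>\<^sub>\<infinity>\<mu>\<in>M. d \<mu> J)"
  by (induction A rule: infinite_finite_induct) (simp_all add: infsum_add nonneg_summable_on_complete)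

lemma infsum_ennreal:
  fixes h :: "'a \<Rightarrow> real"
  assumes "h summable_on A" "\<And>a. a \<in> A \<Longrightarrow> 0 \<le> h a"
  shows "(\<Sum>\<^sub>\<infinity>a\<in>A. ennreal (h a)) = ennreal (infsum h A)"
proof -
  have "(\<Sum>\<^sub>\<infinity>a\<in>A. ennreal (h a)) = (SUP F\<in>{F. finite F \<and> F \<subseteq> A}. \<Sum>a\<in>F. ennreal (h a))"
    by (rule nonneg_infsum_complete) simp
  also have "\<dots> = (SUP F\<in>{F. finite F \<and> F \<subseteq> A}. ennreal (sum h F))"
    using assms(2) by (intro SUP_cong sum_ennreal) auto
  also have "\<dots> = ennreal (infsum h A)"
    by (rule infsum_nonneg_is_SUPREMUM_ennreal[OF assms, symmetric])
  finally show ?thesis .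
qed

lemma has_sum_of_infsum_ennreal:
  fixes h :: "'a \<Rightarrow> real"
  assumes nonneg: "\<And>a. a \<in> A \<Longrightarrow> 0 \<le> h a" and "0 \<le> S" and sum: "(\<Sum>\<^sub>\<infinity>a\<in>A. ennreal (h a)) = ennreal S"
  shows "(h has_sum S) A"
proof -
  have "sum h F \<le> S" if "finite F" "F \<subseteq> A" for F
  proof -
    have "ennreal (sum h F) = (\<Sum>a\<in>F. ennreal (h a))" using nonneg that by (intro sum_ennreal[symmetric]) auto
    also have "\<dots> \<le> ennreal S"
      unfolding sum[symmetric] using that by (subst nonneg_infsum_complete) (auto intro: SUP_upper)
    finally show ?thesis using \<open>0 \<le> S\<close> by simp
  qed
  then have summable: "h summable_on A"
    using nonneg by (intro nonneg_bdd_above_summable_on bdd_aboveI[of _ S]) auto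
  have "infsum h A = S"
    using sum infsum_ennreal[OF summable nonneg] infsum_nonneg[of A h] nonneg \<open>0 \<le> S\<close> by simp
  then show ?thesis using has_sum_infsum[OF summable] by simp
qed

lemma monotone_cube_infsum:
  fixes F :: "'m \<Rightarrow> 'i set \<Rightarrow> ennreal"
  assumes "\<And>\<mu>. \<mu> \<in> M \<Longrightarrow> monotone_cube nonneg_semiring N (F \<mu>)"
  shows "monotone_cube nonneg_semiring N (\<lambda>I. \<Sum>\<^sub>\<infinity>\<mu>\<in>M. F \<mu> I)"
proof -
  obtain d where d: "\<And>\<mu>. \<mu> \<in> M \<Longrightarrow> cube_differences nonneg_semiring N (F \<mu>) (d \<mu>)"
    using assms unfolding monotone_cube_def by metis
  have "(\<Sum>\<^sub>\<infinity>\<mu>\<in>M. F \<mu> I) = (\<Sum>J\<in>Pow I. \<Sum>\<^sub>\<infinity>\<mu>\<in>M. d \<mu> J)" if "I \<subseteq> N" for I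
    unfolding infsum_ennreal_sum[symmetric]
    by (intro infsum_cong) (use d that in \<open>auto simp: cube_differences_nonneg_semiring\<close>)
  then show ?thesis
    by (auto simp: monotone_cube_def cube_differences_nonneg_semiring intro!: exI[of _ "\<lambda>J. \<Sum>\<^sub>\<infinity>\<mu>\<in>M. d \<mu> J"])
qed

section \<open>Monomials\<close>

lemma monomial_prod_mset: "monomial x \<mu> = (\<Prod>a\<in>#\<mu>. x a)"
  by (simp add: monomial_def image_prod_mset_multiplicity)

lemma monomial_empty [simp]: "monomial x {#} = 1"
  and monomial_add_mset [simp]: "monomial x (add_mset a \<mu>) = x a * monomial x \<mu>"
  and monomial_plus: "monomial x (\<mu> + \<nu>) = monomial x \<mu> * monomial x \<nu>"
  and monomial_replicate_mset: "monomial x (replicate_mset k a) = x a ^ k"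
  by (simp_all add: monomial_prod_mset)

lemma monomial_nonneg: "(\<And>a. 0 \<le> x a) \<Longrightarrow> 0 \<le> monomial x \<mu>"
  by (auto simp: monomial_def intro!: prod_nonneg)

lemma monomial_mono: "(\<And>a. 0 \<le> x a) \<Longrightarrow> (\<And>a. x a \<le> y a) \<Longrightarrow> monomial x \<mu> \<le> monomial y \<mu>"
  by (auto simp: monomial_def intro!: prod_mono power_mono)

lemma monomial_cong: "(\<And>a. a \<in># \<mu> \<Longrightarrow> x a = y a) \<Longrightarrow> monomial x \<mu> = monomial y \<mu>"
  by (simp add: monomial_def)

lemma monomial_eq_0: "a \<in># \<mu> \<Longrightarrow> x a = 0 \<Longrightarrow> monomial x \<mu> = 0"
  by (auto simp: monomial_prod_mset)

lemma tendsto_monomial: "(\<And>a. (\<lambda>n. s n a) \<longlonglongrightarrow> x a) \<Longrightarrow> (\<lambda>n. monomial (s n) \<mu>) \<longlonglongrightarrow> monomial x \<mu>"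
  unfolding monomial_def by (intro tendsto_intros)

lemma monotone_cube_monomial:
  assumes "finite N" "\<And>a. 0 \<le> x a" "\<And>i a. i \<in> N \<Longrightarrow> 0 \<le> u i a"
  shows "monotone_cube nonneg_semiring N (\<lambda>I. monomial (\<lambda>a. x a + (\<Sum>i\<in>I. u i a)) \<mu>)"
proof (induction \<mu>)
  case empty
  then show ?case using nonneg.monotone_cube_const[of N "1::real"] assms(1)
    by (simp add: nonneg_semiring_simps)
next
  case (add b \<mu>)
  have vertex: "vertex nonneg_semiring (x b) (\<lambda>i. u i b) I = x b + (\<Sum>i\<in>I. u i b)" if "I \<subseteq> N" for I
    unfolding nonneg_semiring_simps using assms(3) that by (subst finsum_nonneg_semiring) auto
  have "monotone_cube nonneg_semiring N (vertex nonneg_semiring (x b) (\<lambda>i. u i b))"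
    using assms by (intro nonneg.monotone_cube_vertex) (auto simp: nonneg_semiring_simps)
  then have "monotone_cube nonneg_semiring N (\<lambda>I. x b + (\<Sum>i\<in>I. u i b))"
    by (rule monotone_cube_cong[THEN iffD1, rotated]) (rule vertex)
  then show ?case using monotone_cube_mult[OF assms(1) _ add] by simp
qed

lemma countable_mfin:
  assumes "countable A"
  shows "countable (mfin A)"
proof -
  have "mfin A \<subseteq> mset ` lists A"
  proof
    fix \<mu> assume "\<mu> \<in> mfin A"
    moreover obtain xs where "mset xs = \<mu>" using ex_mset by blast
    ultimately show "\<mu> \<in> mset ` lists A" by (auto simp: mfin_def in_lists_conv_set subset_iff)
  qed
  then show ?thesis by (rule countable_subset) (intro countable_image countable_lists assms)
qed

lemma bij_betw_mfin_insert:
  assumes "a \<notin> A"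
  shows "bij_betw (\<lambda>(k, \<nu>). \<nu> + replicate_mset k a) ((UNIV :: nat set) \<times> mfin A) (mfin (insert a A))"
proof (rule bij_betw_byWitness[where f' = "\<lambda>\<mu>. (count \<mu> a, filter_mset (\<lambda>b. b \<noteq> a) \<mu>)"])
  have "count \<nu> a = 0" if "\<nu> \<in> mfin A" for \<nu> using that assms by (auto simp: mfin_def count_eq_zero_iff)
  then show "\<forall>p\<in>(UNIV :: nat set) \<times> mfin A. (\<lambda>\<mu>. (count \<mu> a, filter_mset (\<lambda>b. b \<noteq> a) \<mu>))
      ((\<lambda>(k, \<nu>). \<nu> + replicate_mset k a) p) = p"
    by (auto simp: multiset_eq_iff)
  show "\<forall>\<mu>\<in>mfin (insert a A). (\<lambda>(k, \<nu>). \<nu> + replicate_mset k a) (count \<mu> a, filter_mset (\<lambda>b. b \<noteq> a) \<mu>) = \<mu>"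
    by (auto simp: multiset_eq_iff)
qed (auto simp: mfin_def split: if_splits)

section \<open>Power series are stable\<close>

context pcspace
begin

lemma series_mono:
  assumes "\<And>\<mu>. 0 \<le> f \<mu> b" "\<And>a. 0 \<le> x a" "\<And>a. x a \<le> y a"
  shows "series X f x b \<le> series X f y b"
  unfolding series_def
  by (intro infsum_mono nonneg_summable_on_complete)
    (auto intro!: ennreal_leI mult_left_mono monomial_mono assms)

lemma tendsto_series:
  assumes f: "\<And>\<mu>. 0 \<le> f \<mu> b" and s: "\<And>n a. 0 \<le> s n a"
    and inc: "\<And>a. incseq (\<lambda>n. s n a)" and lim: "\<And>a. (\<lambda>n. s n a) \<longlonglongrightarrow> x a"
  shows "(\<lambda>n. series X f (s n) b) \<longlonglongrightarrow> series X f x b"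
proof -
  let ?term = "\<lambda>n \<mu>. ennreal (f \<mu> b * monomial (s n) \<mu>)"
  have inc_term: "incseq (\<lambda>n. ?term n \<mu>)" for \<mu>
    using inc by (auto simp: incseq_def intro!: ennreal_leI mult_left_mono monomial_mono f s)
  have "(SUP n. ?term n \<mu>) = ennreal (f \<mu> b * monomial x \<mu>)" for \<mu>
  proof (rule LIMSEQ_unique[OF LIMSEQ_SUP[OF inc_term]])
    show "(\<lambda>n. ?term n \<mu>) \<longlonglongrightarrow> ennreal (f \<mu> b * monomial x \<mu>)"
      by (intro tendsto_ennrealI tendsto_intros tendsto_monomial lim)
  qed
  then have "(SUP n. series X f (s n) b) = series X f x b"
    using infsum_ennreal_SUP[OF countable_mfin[OF countable_web] inc_term] by (simp add: series_def)
  moreover have "incseq (\<lambda>n. series X f (s n) b)"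
    using inc by (auto simp: incseq_def intro!: series_mono f s)
  ultimately show ?thesis using LIMSEQ_SUP by metis
qed

lemma series_finite_support:
  assumes "A \<subseteq> web X" "\<And>a. a \<notin> A \<Longrightarrow> x a = 0"
  shows "series X f x b = (\<Sum>\<^sub>\<infinity>\<mu>\<in>mfin A. ennreal (f \<mu> b * monomial x \<mu>))"
  unfolding series_def
proof (rule infsum_cong_neutral)
  fix \<mu> assume "\<mu> \<in> mfin (web X) - mfin A"
  then obtain a where "a \<in># \<mu>" "a \<notin> A" by (auto simp: mfin_def)
  then have "monomial x \<mu> = 0" using assms(2) by (intro monomial_eq_0[of a])
  then show "ennreal (f \<mu> b * monomial x \<mu>) = 0" by simp
qed (use assms(1) in \<open>auto simp: mfin_def\<close>)

lemma vertex_Fm_obj: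
  assumes "finite N" "u \<in> N \<rightarrow> Fm_carrier X" "I \<subseteq> N"
  shows "vertex (Fm_obj X) x u I = (\<lambda>a. x a + (\<Sum>i\<in>I. u i a))"
proof -
  have "finite I" "\<And>i. i \<in> I \<Longrightarrow> u i \<in> Fm_carrier X" using assms finite_subset by auto
  then show ?thesis by (simp add: finsum_Fm_obj Fm_obj_simps)
qed

end

locale pcs_hom = X: pcspace X + Y: pcspace Y
  for X :: "'a pcs" and Y :: "'b pcs" and f :: "'a multiset \<Rightarrow> 'b \<Rightarrow> real" +
  assumes hom: "f \<in> pcoh_hom X Y"
begin

lemma coeff_nonneg: "0 \<le> f \<mu> b"
  using hom by (cases "\<mu> \<in> mfin (web X) \<and> b \<in> web Y") (auto simp: pcoh_hom_def)

lemma hat_pts: "x \<in> pts X \<Longrightarrow> hat X f x \<in> pts Y"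
  using hom by (auto simp: pcoh_hom_def)

lemma ennreal_hat: "x \<in> pts X \<Longrightarrow> ennreal (hat X f x b) = series X f x b"
proof -
  assume x: "x \<in> pts X"
  have "series X f x b < \<infinity>"
  proof (cases "b \<in> web Y")
    case False
    then have "f \<mu> b = 0" for \<mu> using hom by (auto simp: pcoh_hom_def)
    then show ?thesis by (simp add: series_def)
  qed (use hom x in \<open>auto simp: pcoh_hom_def\<close>)
  then show ?thesis by (simp add: hat_def)
qed

lemma hat_mono:
  assumes "x \<in> pts X" "y \<in> pts X" "\<And>a. x a \<le> y a"
  shows "hat X f x b \<le> hat X f y b"
proof -
  have "ennreal (hat X f x b) \<le> ennreal (hat X f y b)"
    unfolding ennreal_hat[OF assms(1)] ennreal_hat[OF assms(2)]
    by (intro X.series_mono coeff_nonneg X.pts_nonneg assms)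
  then show ?thesis by (simp add: Y.pts_nonneg[OF hat_pts[OF assms(2)]])
qed

lemma tendsto_hat:
  assumes s: "\<And>n. s n \<in> pts X" and x: "x \<in> pts X"
    and "\<And>a. incseq (\<lambda>n. s n a)" "\<And>a. (\<lambda>n. s n a) \<longlonglongrightarrow> x a"
  shows "(\<lambda>n. hat X f (s n) b) \<longlonglongrightarrow> hat X f x b"
proof -
  have "(\<lambda>n. series X f (s n) b) \<longlonglongrightarrow> ennreal (hat X f x b)"
    unfolding ennreal_hat[OF x] by (intro X.tendsto_series coeff_nonneg X.pts_nonneg assms)
  from tendsto_enn2real[OF this] show ?thesis
    by (simp add: hat_def)
qed

lemma cone_map_hat: "cone_map (Fm_obj X) (Fm_obj Y) (hat X f)"
  using hat_pts Y.pts_carrier by unfold_locales (auto simp: X.cone_ball_Fm_obj Y.Fm_obj_simps)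

lemma prestable_hat: "prestable (Fm_obj X) (Fm_obj Y) (hat X f)"
proof (rule prestableI_monotone_cube[OF Y.cone.abelian_monoid_axioms])
  interpret hat: cone_map "Fm_obj X" "Fm_obj Y" "hat X f" by (rule cone_map_hat)
  fix n :: nat and x u
  assume u: "ball_cube (Fm_obj X) {1..n} x u"
  then have nonneg: "\<And>a. 0 \<le> x a" "\<And>i a. i \<in> {1..n} \<Longrightarrow> 0 \<le> u i a"
    and vertex: "\<And>I. I \<subseteq> {1..n} \<Longrightarrow> vertex (Fm_obj X) x u I = (\<lambda>a. x a + (\<Sum>i\<in>I. u i a))"
    using X.vertex_Fm_obj[of "{1..n}" u _ x] X.carrier_nonneg
    unfolding ball_cube_def X.Fm_obj_simps(1) by (blast, blast, blast)
  have pts: "vertex (Fm_obj X) x u I \<in> pts X" if "I \<subseteq> {1..n}" for I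
    using X.cone.ball_cube_subset[OF u that] by (simp add: ball_cube_def X.cone_ball_Fm_obj)
  have "monotone_cube nonneg_semiring {1..n} (\<lambda>I. hat X f (vertex (Fm_obj X) x u I) b)" for b
  proof -
    have "monotone_cube nonneg_semiring {1..n} (\<lambda>I. f \<mu> b * monomial (\<lambda>a. x a + (\<Sum>i\<in>I. u i a)) \<mu>)" for \<mu>
      using nonneg coeff_nonneg[of \<mu> b]
      by (intro monotone_cube_mult nonneg.monotone_cube_const monotone_cube_monomial)
        (auto simp: nonneg_semiring_simps)
    then have real: "monotone_cube nonneg_semiring {1..n} (\<lambda>I. f \<mu> b * monomial (vertex (Fm_obj X) x u I) \<mu>)"
      for \<mu>
      by (rule monotone_cube_cong[THEN iffD1, rotated]) (simp add: vertex)
    have "monotone_cube nonneg_semiring {1..n} (\<lambda>I. ennreal (f \<mu> b * monomial (vertex (Fm_obj X) x u I) \<mu>))"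
      for \<mu>
      using real monotone_cube_ennreal_iff[of "{1..n}" "\<lambda>I. f \<mu> b * monomial (vertex (Fm_obj X) x u I) \<mu>"]
      by (simp add: coeff_nonneg monomial_nonneg X.pts_nonneg[OF pts])
    then have "monotone_cube nonneg_semiring {1..n} (\<lambda>I. series X f (vertex (Fm_obj X) x u I) b)"
      unfolding series_def by (rule monotone_cube_infsum)
    then have "monotone_cube nonneg_semiring {1..n} (\<lambda>I. ennreal (hat X f (vertex (Fm_obj X) x u I) b))"
      by (rule monotone_cube_cong[THEN iffD1, rotated]) (simp add: ennreal_hat pts)
    then show ?thesis
      by (rule monotone_cube_ennreal_iff[THEN iffD1, rotated 2]) (simp_all add: Y.pts_nonneg[OF hat_pts] pts)
  qed
  then show "monotone_cube (Fm_obj Y) {1..n} (\<lambda>I. hat X f (vertex (Fm_obj X) x u I))"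
    by (intro Y.monotone_cube_Fm_objI Y.pts_carrier hat_pts pts) simp_all
qed

lemma stable_hat: "stable (Fm_obj X) (Fm_obj Y) (hat X f)"
  unfolding stable_def X.cone_ball_Fm_obj
proof (intro conjI allI ballI impI prestable_hat)
  show "hat X f \<in> pts X \<rightarrow> carrier (Fm_obj Y)"
    using hat_pts Y.pts_carrier by (auto simp: Y.Fm_obj_simps)
  show "\<exists>M. \<forall>x\<in>pts X. cnorm (Fm_obj Y) (hat X f x) \<le> M"
    using hat_pts Y.pnorm_le_1_iff by (intro exI[of _ 1]) auto
  fix s x assume x: "x \<in> pts X" and "range s \<subseteq> pts X"
    and inc: "cone_incseq (Fm_obj X) s" and lub: "cone_lub (Fm_obj X) s x"
  then have s: "s n \<in> pts X" for n by auto
  have incseq: "incseq (\<lambda>n. s n a)" for a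
    using inc X.cone_incseq_Fm_obj[of s, OF X.pts_carrier[OF s]] by blast
  have lim: "(\<lambda>n. s n a) \<longlonglongrightarrow> x a" for a
    by (rule X.cone_lub_Fm_objD[OF X.pts_carrier[OF s] inc lub])
  show "cone_lub (Fm_obj Y) (\<lambda>n. hat X f (s n)) (hat X f x)"
  proof (rule Y.cone_lub_Fm_objI)
    show "incseq (\<lambda>n. hat X f (s n) b)" for b
      using incseq by (auto simp: incseq_def intro!: hat_mono s)
    show "(\<lambda>n. hat X f (s n) b) \<longlonglongrightarrow> hat X f x b" for b
      by (rule tendsto_hat[OF s x incseq lim])
  qed (intro Y.pts_carrier hat_pts s x)+
qed

lemma measurable_path_hat:
  assumes "unitary_path (Fm_obj X) n \<gamma>"
  shows "measurable_path (Fm_obj Y) n (\<lambda>r. hat X f (\<gamma> r))"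
proof -
  have \<gamma>: "\<gamma> r \<in> pts X" if "r \<in> space (RR n)" for r
    using assms that by (auto simp: unitary_path_def X.cone_ball_Fm_obj)
  have coord: "(\<lambda>r. \<gamma> r a) \<in> borel_measurable (RR n)" if "a \<in> web X" for a
    using assms that by (auto simp: unitary_path_def X.measurable_path_Fm_obj)
  have "(\<lambda>r. series X f (\<gamma> r) b) \<in> borel_measurable (RR n)" for b
    unfolding series_def
  proof (rule borel_measurable_infsum_ennreal[OF countable_mfin[OF X.countable_web]])
    fix \<mu> assume \<mu>: "\<mu> \<in> mfin (web X)"
    have "(\<lambda>r. monomial (\<gamma> r) \<mu>) \<in> borel_measurable (RR n)"
      unfolding monomial_def using \<mu>
        by (intro borel_measurable_prod borel_measurable_power coord)
          (auto simp: mfin_def)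
    then show "(\<lambda>r. ennreal (f \<mu> b * monomial (\<gamma> r) \<mu>)) \<in> borel_measurable (RR n)" by simp
  qed
  then have "(\<lambda>r. hat X f (\<gamma> r) b) \<in> borel_measurable (RR n)" for b
    unfolding hat_def by simp
  moreover have "Y.pnorm (hat X f (\<gamma> r)) \<le> 1" if "r \<in> space (RR n)" for r
    using Y.pnorm_le_1_iff hat_pts[OF \<gamma>[OF that]] by blast
  ultimately show ?thesis
    unfolding Y.measurable_path_Fm_obj using \<gamma> hat_pts Y.pts_carrier by auto
qed

lemma Fm_mor_hom: "Fm_mor X Y f \<in> cstabm_hom (Fm_obj X) (Fm_obj Y)"
  unfolding Fm_mor_def X.cone_ball_Fm_obj[symmetric]
  by (rule cstabm_hom_restrict)
     (use hat_pts in \<open>auto simp: X.cone_ball_Fm_obj Y.cone_ball_Fm_obj intro: stable_hat measurable_path_hat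
        X.measurable_cone_Fm_obj Y.measurable_cone_Fm_obj\<close>)

end

section \<open>Uniqueness of the coefficients of a power series\<close>

lemma powser_right_zero_imp_zero:
  fixes c :: "nat \<Rightarrow> real"
  assumes "0 < e" and zero: "\<And>s. 0 < s \<Longrightarrow> s < e \<Longrightarrow> (\<lambda>k. c k * s ^ k) sums 0"
  shows "c k = 0"
proof (induction k rule: less_induct)
  case (less k)
  have shifted: "(\<lambda>j. c (j + k) * s ^ j) sums 0" if s: "0 < s" "s < e" for s
  proof -
    have "(\<lambda>j. c (j + k) * s ^ (j + k)) sums 0"
      using zero[OF s] less sums_iff_shift[of "\<lambda>j. c j * s ^ j" k 0] by simp
    then have "(\<lambda>j. c (j + k) * s ^ (j + k) / s ^ k) sums (0 / s ^ k)" by (rule sums_divide)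
    then show ?thesis using s by (simp add: power_add)
  qed
  have "summable (\<lambda>j. c (j + k) * (e / 2) ^ j)" using shifted[of "e / 2"] \<open>0 < e\<close> by (auto simp: sums_iff)
  then have "(\<lambda>j. c (j + k) * x ^ j) sums (\<Sum>j. c (j + k) * x ^ j)" if "norm x < e / 2" for x
    using summable_sums[OF powser_inside[of "\<lambda>j. c (j + k)" "e / 2" x]] that \<open>0 < e\<close> by simp
  then have "((\<lambda>x. \<Sum>j. c (j + k) * x ^ j) \<longlongrightarrow> c (0 + k)) (at 0)"
    using \<open>0 < e\<close> by (intro powser_limit_0[of "e / 2"]) auto
  then have "((\<lambda>x. \<Sum>j. c (j + k) * x ^ j) \<longlongrightarrow> c k) (at_right 0)"
    by (auto intro: tendsto_within_subset)
  moreover have "\<forall>\<^sub>F x in at_right 0. (\<Sum>j. c (j + k) * x ^ j) = 0"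
    using \<open>0 < e\<close> shifted by (intro eventually_at_rightI[of 0 e]) (auto simp: sums_iff)
  ultimately have "((\<lambda>x::real. 0) \<longlongrightarrow> c k) (at_right 0)" by (rule Lim_transform_eventually)
  then show "c k = 0" by (intro tendsto_unique[OF trivial_limit_at_right_real _ tendsto_const])
qed

lemma has_sum_mfin_insert:
  fixes h :: "'a multiset \<Rightarrow> real"
  assumes "a \<notin> A" "0 < s"
    and sum: "((\<lambda>\<mu>. h \<mu> * monomial (x(a := s)) \<mu>) has_sum S) (mfin (insert a A))"
  shows "(\<lambda>\<nu>. h (\<nu> + replicate_mset k a) * monomial x \<nu>) summable_on mfin A"
    and "(\<lambda>k. (\<Sum>\<^sub>\<infinity>\<nu>\<in>mfin A. h (\<nu> + replicate_mset k a) * monomial x \<nu>) * s ^ k) sums S"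
proof -
  let ?slice = "\<lambda>k \<nu>. h (\<nu> + replicate_mset k a) * monomial x \<nu>"
  have "h (\<nu> + replicate_mset k a) * monomial (x(a := s)) (\<nu> + replicate_mset k a) = ?slice k \<nu> * s ^ k"
    if "\<nu> \<in> mfin A" for k \<nu>
  proof -
    have "monomial (x(a := s)) \<nu> = monomial x \<nu>"
      using that assms(1) by (intro monomial_cong) (auto simp: mfin_def)
    then show ?thesis by (simp add: monomial_plus monomial_replicate_mset)
  qed
  then have total: "((\<lambda>(k, \<nu>). ?slice k \<nu> * s ^ k) has_sum S) (UNIV \<times> mfin A)"
    using sum has_sum_reindex_bij_betw[OF bij_betw_mfin_insert[OF assms(1)],
      of "\<lambda>\<mu>. h \<mu> * monomial (x(a := s)) \<mu>" S]
    by (auto elim!: has_sum_cong[THEN iffD1, rotated])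
  have "(\<lambda>\<nu>. ?slice k \<nu> * s ^ k) summable_on mfin A" for k
    using summable_on_SigmaD1[OF has_sum_imp_summable[OF total], of k] by simp
  then have "(\<lambda>\<nu>. ?slice k \<nu> * s ^ k * (1 / s ^ k)) summable_on mfin A" for k
    by (rule summable_on_cmult_left)
  then show slices: "?slice k summable_on mfin A" for k using assms(2) by simp
  have "((\<lambda>k. \<Sum>\<^sub>\<infinity>\<nu>\<in>mfin A. ?slice k \<nu> * s ^ k) has_sum S) UNIV"
    using total slices
      by (intro has_sum_SigmaD[OF total])
        (auto intro!: has_sum_infsum summable_on_cmult_left)
  then show "(\<lambda>k. (\<Sum>\<^sub>\<infinity>\<nu>\<in>mfin A. ?slice k \<nu>) * s ^ k) sums S"
    using slices by (intro has_sum_imp_sums) (simp add: infsum_cmult_left)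
qed

lemma multi_powser_zero_imp_zero:
  fixes h :: "'a multiset \<Rightarrow> real"
  assumes "finite A" "0 < r"
    and "\<And>x. (\<And>a. a \<in> A \<Longrightarrow> 0 < x a \<and> x a < r) \<Longrightarrow> ((\<lambda>\<mu>. h \<mu> * monomial x \<mu>) has_sum 0) (mfin A)"
    and "\<mu> \<in> mfin A"
  shows "h \<mu> = 0"
  using assms(1,3,4)
proof (induction A arbitrary: h \<mu> rule: finite_induct)
  case empty
  have "mfin {} = {{#} :: 'a multiset}" by (auto simp: mfin_def)
  then show ?case using empty.prems(1)[of undefined] empty.prems(2) by (simp add: has_sum_finite_iff)
next
  case (insert a A)
  let ?slice = "\<lambda>k \<nu>. h (\<nu> + replicate_mset k a)"
  have "\<mu> \<in> (\<lambda>(k, \<nu>). \<nu> + replicate_mset k a) ` (UNIV \<times> mfin A)"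
    using bij_betw_imp_surj_on[OF bij_betw_mfin_insert[OF insert.hyps(2)]] insert.prems(2) by simp
  then obtain k \<nu> where \<mu>: "\<mu> = \<nu> + replicate_mset k a" and \<nu>: "\<nu> \<in> mfin A" by auto
  have "?slice k \<nu> = 0"
  proof (rule insert.IH[OF _ \<nu>, of "?slice k"])
    fix x assume x: "\<And>b. b \<in> A \<Longrightarrow> 0 < x b \<and> x b < r"
    have zero: "((\<lambda>\<mu>. h \<mu> * monomial (x(a := s)) \<mu>) has_sum 0) (mfin (insert a A))" if "0 < s" "s < r" for s
      by (rule insert.prems(1)) (use x that in auto)
    have "(\<lambda>k. (\<Sum>\<^sub>\<infinity>\<nu>\<in>mfin A. ?slice k \<nu> * monomial x \<nu>) * s ^ k) sums 0" if "0 < s" "s < r" for s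
      by (rule has_sum_mfin_insert(2)[OF insert.hyps(2) that(1) zero[OF that]])
    then have sum: "(\<Sum>\<^sub>\<infinity>\<nu>\<in>mfin A. ?slice k \<nu> * monomial x \<nu>) = 0"
      by (rule powser_right_zero_imp_zero[OF \<open>0 < r\<close>])
    have "(\<lambda>\<nu>. ?slice k \<nu> * monomial x \<nu>) summable_on mfin A"
      using \<open>0 < r\<close> by (intro has_sum_mfin_insert(1)[OF insert.hyps(2) _ zero[of "r / 2"]]) auto
    from has_sum_infsum[OF this] show "((\<lambda>\<nu>. ?slice k \<nu> * monomial x \<nu>) has_sum 0) (mfin A)"
      unfolding sum .
  qed
  then show ?case by (simp add: \<mu>)
qed

lemma (in pcspace) pts_box:
  assumes "finite A" "A \<subseteq> web X"
  obtains r where "0 < r" "(\<lambda>a. if a \<in> A then r else 0) \<in> pts X"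
proof -
  have "(\<lambda>a. if a \<in> A then 1 else 0) \<in> Fm_carrier X"
    by (rule finite_support_carrier[OF assms]) auto
  then obtain r where "0 < r" "(\<lambda>a. r * (if a \<in> A then 1 else 0)) \<in> pts X"
    unfolding carrier_iff by (elim exE conjE)
  moreover have "(\<lambda>a. r * (if a \<in> A then 1 else 0)) = (\<lambda>a. if a \<in> A then r else 0)" by auto
  ultimately show ?thesis by (simp add: that)
qed

lemma (in pcs_hom) hat_has_sum:
  assumes A: "A \<subseteq> web X" and x: "(\<lambda>a. if a \<in> A then x a else 0) \<in> pts X"
  shows "((\<lambda>\<mu>. f \<mu> b * monomial x \<mu>) has_sum hat X f (\<lambda>a. if a \<in> A then x a else 0) b) (mfin A)"
proof -
  let ?x = "\<lambda>a. if a \<in> A then x a else 0"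
  have "((\<lambda>\<mu>. f \<mu> b * monomial ?x \<mu>) has_sum hat X f ?x b) (mfin A)"
    using ennreal_hat[OF x] Y.pts_nonneg[OF hat_pts[OF x]] X.pts_nonneg[OF x]
    by (intro has_sum_of_infsum_ennreal mult_nonneg_nonneg coeff_nonneg monomial_nonneg)
       (simp_all add: X.series_finite_support[OF A])
  also have "?this \<longleftrightarrow> ?thesis"
  proof (rule has_sum_cong)
    fix \<mu> assume "\<mu> \<in> mfin A"
    then have "monomial ?x \<mu> = monomial x \<mu>" by (intro monomial_cong) (auto simp: mfin_def)
    then show "f \<mu> b * monomial ?x \<mu> = f \<mu> b * monomial x \<mu>" by simp
  qed
  finally show ?thesis .
qed

lemma hat_inject:
  assumes f: "pcs_hom X Y f" and g: "pcs_hom X Y g" and eq: "\<And>x. x \<in> pts X \<Longrightarrow> hat X f x = hat X g x"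
  shows "f = g"
proof (intro ext)
  interpret f: pcs_hom X Y f by fact
  interpret g: pcs_hom X Y g by fact
  fix \<mu> b
  show "f \<mu> b = g \<mu> b"
  proof (cases "\<mu> \<in> mfin (web X)")
    case False
    then show ?thesis using f.hom g.hom by (simp add: pcoh_hom_def)
  next
    case True
    define A where "A = set_mset \<mu>"
    have A: "finite A" "A \<subseteq> web X" using True by (auto simp: A_def mfin_def)
    then obtain r where r: "0 < r" "(\<lambda>a. if a \<in> A then r else 0) \<in> pts X" using f.X.pts_box by blast
    have "f \<mu> b - g \<mu> b = 0"
    proof (rule multi_powser_zero_imp_zero[OF A(1) r(1), of "\<lambda>\<mu>. f \<mu> b - g \<mu> b"])
      show "\<mu> \<in> mfin A" by (simp add: A_def mfin_def)
      fix x assume "\<And>a. a \<in> A \<Longrightarrow> 0 < x a \<and> x a < r"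
      then have x: "(\<lambda>a. if a \<in> A then x a else 0) \<in> pts X"
        by (intro f.X.pts_downward_closed[OF r(2)]) (auto intro: less_imp_le)
      have "((\<lambda>\<mu>. f \<mu> b * monomial x \<mu> - g \<mu> b * monomial x \<mu>) has_sum 0) (mfin A)"
        using has_sum_add[OF f.hat_has_sum[OF A(2) x, of b]
          has_sum_uminusI[OF g.hat_has_sum[OF A(2) x, of b]]]
        by (simp add: eq[OF x])
      then show "((\<lambda>\<mu>. (f \<mu> b - g \<mu> b) * monomial x \<mu>) has_sum 0) (mfin A)"
        by (simp add: left_diff_distrib)
    qed
    then show ?thesis by simp
  qed
qed

section \<open>Newton expansion on multisets\<close>

definition mbinom :: "'a multiset \<Rightarrow> 'a multiset \<Rightarrow> real" where
  "mbinom \<mu> \<nu> = (\<Prod>a\<in>set_mset \<nu>. real (count \<mu> a choose count \<nu> a))"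

lemma mbinom_nonneg: "0 \<le> mbinom \<mu> \<nu>"
  by (auto simp: mbinom_def intro: prod_nonneg)

lemma mbinom_self: "mbinom \<mu> \<mu> = 1"
  by (simp add: mbinom_def)

lemma mbinom_eq_0: "\<not> \<nu> \<subseteq># \<mu> \<Longrightarrow> mbinom \<mu> \<nu> = 0"
proof -
  assume "\<not> \<nu> \<subseteq># \<mu>"
  then obtain a where a: "count \<mu> a < count \<nu> a" by (auto simp: subseteq_mset_def not_le)
  then have "a \<in># \<nu>" by (metis count_eq_zero_iff not_less_zero)
  then show ?thesis unfolding mbinom_def using a
    by (intro prod_zero) (auto intro!: bexI[of _ a] binomial_eq_0)
qed

lemma mbinom_remove:
  "mbinom \<mu> \<nu> = real (count \<mu> a choose count \<nu> a) * (\<Prod>b\<in>set_mset \<nu> - {a}. real (count \<mu> b choose count \<nu> b))"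
  by (cases "a \<in># \<nu>") (simp_all add: mbinom_def prod.remove not_in_iff)

lemma mbinom_add_mset:
  "mbinom (add_mset a \<mu>) (add_mset a \<nu>) = mbinom \<mu> \<nu> + mbinom \<mu> (add_mset a \<nu>)"
proof -
  define others where "others = (\<Prod>b\<in>set_mset \<nu> - {a}. real (count \<mu> b choose count \<nu> b))"
  have "set_mset (add_mset a \<nu>) - {a} = set_mset \<nu> - {a}" by auto
  moreover have "(\<Prod>b\<in>set_mset \<nu> - {a}. real (count (add_mset a \<mu>) b choose count (add_mset a \<nu>) b)) = others"
    "(\<Prod>b\<in>set_mset \<nu> - {a}. real (count \<mu> b choose count (add_mset a \<nu>) b)) = others"
    unfolding others_def by (auto intro!: prod.cong split: if_splits)
  ultimately have "mbinom (add_mset a \<mu>) (add_mset a \<nu>) =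
      real (Suc (count \<mu> a) choose Suc (count \<nu> a)) * others"
    "mbinom \<mu> (add_mset a \<nu>) = real (count \<mu> a choose Suc (count \<nu> a)) * others"
    using mbinom_remove[of "add_mset a \<mu>" "add_mset a \<nu>" a] mbinom_remove[of \<mu> "add_mset a \<nu>" a]
    by (simp_all del: binomial_Suc_Suc)
  moreover have "mbinom \<mu> \<nu> = real (count \<mu> a choose count \<nu> a) * others"
    unfolding others_def by (rule mbinom_remove)
  ultimately show ?thesis by (simp add: distrib_right)
qed

lemma mbinom_add_mset_notin: "a \<notin># \<nu> \<Longrightarrow> mbinom (add_mset a \<mu>) \<nu> = mbinom \<mu> \<nu>"
  by (auto simp: mbinom_def intro!: prod.cong)

lemma finite_submsets: "finite {\<nu>. \<nu> \<subseteq># \<mu>}"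
proof (rule finite_subset)
  show "{\<nu>. \<nu> \<subseteq># \<mu>} \<subseteq> mset ` {xs. set xs \<subseteq> set_mset \<mu> \<and> length xs \<le> size \<mu>}"
  proof
    fix \<nu> assume "\<nu> \<in> {\<nu>. \<nu> \<subseteq># \<mu>}"
    moreover obtain xs where "mset xs = \<nu>" using ex_mset by blast
    ultimately show "\<nu> \<in> mset ` {xs. set xs \<subseteq> set_mset \<mu> \<and> length xs \<le> size \<mu>}"
      using set_mset_mono[of \<nu> \<mu>] size_mset_mono[of \<nu> \<mu>] by (intro image_eqI[of _ _ xs]) auto
  qed
qed (simp add: finite_lists_length_le)

text \<open>The forward differences of \<open>\<Phi>\<close> at the origin, defined by inverting Newton's formula.\<close>

function newton :: "('a multiset \<Rightarrow> real) \<Rightarrow> 'a multiset \<Rightarrow> real" where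
  "newton \<Phi> \<mu> = \<Phi> \<mu> - (\<Sum>\<nu> | \<nu> \<subset># \<mu>. mbinom \<mu> \<nu> * newton \<Phi> \<nu>)"
  by auto
termination
  by (relation "Wellfounded.measure (\<lambda>(\<Phi>, \<mu>). size \<mu>)") (auto simp: mset_subset_size)

declare newton.simps [simp del]

lemma newton_expansion: "\<Phi> \<mu> = (\<Sum>\<nu> | \<nu> \<subseteq># \<mu>. mbinom \<mu> \<nu> * newton \<Phi> \<nu>)"
proof -
  have "{\<nu>. \<nu> \<subseteq># \<mu>} = insert \<mu> {\<nu>. \<nu> \<subset># \<mu>}" by (auto simp: subset_mset.le_less)
  moreover have "finite {\<nu>. \<nu> \<subset># \<mu>}" by (rule finite_subset[OF _ finite_submsets[of \<mu>]]) auto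
  ultimately show ?thesis by (simp add: mbinom_self newton.simps[of \<Phi> \<mu>])
qed

definition tally :: "('i \<Rightarrow> 'a) \<Rightarrow> 'i set \<Rightarrow> 'a multiset" where
  "tally c I = image_mset c (mset_set I)"

lemma count_tally: "finite I \<Longrightarrow> count (tally c I) a = card {i \<in> I. c i = a}"
  unfolding tally_def by (rule count_image_mset_eq_card_vimage)

lemma tally_mono: "finite J \<Longrightarrow> I \<subseteq> J \<Longrightarrow> tally c I \<subseteq># tally c J"
  unfolding tally_def by (intro image_mset_subseteq_mono subset_imp_msubset_mset_set)

lemma ex_tally:
  obtains N :: "nat set" and c where "finite N" "card N = size \<nu>" "tally c N = \<nu>"
proof -
  obtain xs where xs: "mset xs = \<nu>" using ex_mset by blast
  have "tally ((!) xs) {0..<length xs} = mset (map ((!) xs) [0..<length xs])"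
    by (simp add: tally_def)
  then have "tally ((!) xs) {0..<length xs} = \<nu>" unfolding map_nth xs .
  moreover have "card {0..<length xs} = size \<nu>" by (simp flip: xs)
  ultimately show ?thesis using that by blast
qed

lemma tally_insert: "finite I \<Longrightarrow> i \<notin> I \<Longrightarrow> tally c (insert i I) = add_mset (c i) (tally c I)"
  by (simp add: tally_def)

lemma tally_halves:
  assumes "finite I"
  shows "tally (c \<circ> fst) (I \<times> (UNIV :: bool set)) = repeat_mset 2 (tally c I)"
proof (rule multiset_eqI)
  fix a
  have "{p \<in> I \<times> (UNIV :: bool set). (c \<circ> fst) p = a} = {i \<in> I. c i = a} \<times> UNIV" by auto
  then show "count (tally (c \<circ> fst) (I \<times> (UNIV :: bool set))) a = count (repeat_mset 2 (tally c I)) a"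
    using assms by (simp add: count_tally card_cartesian_product)
qed

lemma tally_section: "tally (c \<circ> fst) ((\<lambda>i. (i, p i)) ` I) = tally c I"
proof -
  have "tally (c \<circ> fst) ((\<lambda>i. (i, p i)) ` I) = image_mset (c \<circ> fst) (image_mset (\<lambda>i. (i, p i)) (mset_set I))"
    unfolding tally_def by (subst image_mset_mset_set) (auto simp: inj_on_def)
  then show ?thesis by (simp add: tally_def multiset.map_comp comp_def)
qed

lemma card_tally_insert:
  assumes "finite J" "j \<notin> J"
  shows "card {I \<in> Pow (insert j J). tally c I = \<nu>} =
    card {I \<in> Pow J. tally c I = \<nu>} + card {I \<in> Pow J. add_mset (c j) (tally c I) = \<nu>}"
proof -
  let ?old = "{I \<in> Pow J. tally c I = \<nu>}" and ?new = "{I \<in> Pow J. add_mset (c j) (tally c I) = \<nu>}"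
  have "tally c (insert j I) = add_mset (c j) (tally c I)" if "I \<in> Pow J" for I
    using that assms finite_subset by (intro tally_insert) auto
  then have "{I \<in> Pow (insert j J). tally c I = \<nu>} = ?old \<union> insert j ` ?new"
    unfolding Pow_insert by auto
  moreover have "card (?old \<union> insert j ` ?new) = card ?old + card (insert j ` ?new)"
    by (rule card_Un_disjoint) (use assms in auto)
  moreover have "card (insert j ` ?new) = card ?new"
    by (rule card_image) (use assms in \<open>auto simp: inj_on_def\<close>)
  ultimately show ?thesis by simp
qed

lemma card_tally_eq:
  assumes "finite J"
  shows "real (card {I \<in> Pow J. tally c I = \<nu>}) = mbinom (tally c J) \<nu>"
  using assms
proof (induction J arbitrary: \<nu> rule: finite_induct)
  case empty
  have "{I \<in> Pow {}. tally c I = \<nu>} = (if \<nu> = {#} then {{}} else {})" by (auto simp: tally_def)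
  then show ?case by (cases "\<nu> = {#}") (simp_all add: tally_def mbinom_self mbinom_eq_0)
next
  case (insert j J)
  show ?case
  proof (cases "c j \<in># \<nu>")
    case True
    then obtain \<nu>' where \<nu>: "\<nu> = add_mset (c j) \<nu>'" by (blast dest: multi_member_split)
    then have "{I \<in> Pow J. add_mset (c j) (tally c I) = \<nu>} = {I \<in> Pow J. tally c I = \<nu>'}" by auto
    then show ?thesis
      unfolding card_tally_insert[OF insert.hyps] tally_insert[OF insert.hyps] of_nat_add
      using insert.IH[of \<nu>] insert.IH[of \<nu>'] by (simp add: \<nu> mbinom_add_mset)
  next
    case False
    then have "{I \<in> Pow J. add_mset (c j) (tally c I) = \<nu>} = {}" by auto
    then show ?thesis
      unfolding card_tally_insert[OF insert.hyps] tally_insert[OF insert.hyps]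
        mbinom_add_mset_notin[OF False] insert.IH[of \<nu>, symmetric]
      by (simp only: card.empty add_0_right)
  qed
qed

lemma sum_Pow_tally:
  assumes "finite J"
  shows "(\<Sum>I\<in>Pow J. g (tally c I)) = (\<Sum>\<nu> | \<nu> \<subseteq># tally c J. mbinom (tally c J) \<nu> * g \<nu>)"
proof -
  have "(\<Sum>I\<in>Pow J. g (tally c I)) = (\<Sum>\<nu> | \<nu> \<subseteq># tally c J. \<Sum>I\<in>{I \<in> Pow J. tally c I = \<nu>}. g (tally c I))"
    by (rule sum.group[symmetric]) (use assms finite_submsets tally_mono in auto)
  also have "\<dots> = (\<Sum>\<nu> | \<nu> \<subseteq># tally c J. mbinom (tally c J) \<nu> * g \<nu>)"
    by (intro sum.cong refl) (simp flip: card_tally_eq[OF assms])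
  finally show ?thesis .
qed

lemma sum_Pow_inject:
  fixes d e :: "'i set \<Rightarrow> 'c::cancel_comm_monoid_add"
  assumes "finite N" and eq: "\<And>I. I \<subseteq> N \<Longrightarrow> (\<Sum>J\<in>Pow I. d J) = (\<Sum>J\<in>Pow I. e J)"
  shows "d N = e N"
  using assms
proof (induction "card N" arbitrary: N rule: less_induct)
  case less
  have "d J = e J" if "J \<in> Pow N - {N}" for J
    using that less.prems psubset_card_mono[of N J] by (intro less.hyps) (auto intro: finite_subset)
  then have "(\<Sum>J\<in>Pow N - {N}. d J) = (\<Sum>J\<in>Pow N - {N}. e J)" by (rule sum.cong[OF refl])
  moreover have "(\<Sum>J\<in>Pow N. g J) = g N + (\<Sum>J\<in>Pow N - {N}. g J)" for g :: "'i set \<Rightarrow> 'c"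
    using less.prems(1) by (intro sum.remove) auto
  ultimately show ?case using less.prems(2)[of N] by simp
qed

lemma differences_eq_newton:
  assumes "finite N" and d: "\<And>I. I \<subseteq> N \<Longrightarrow> \<Phi> (tally c I) = (\<Sum>J\<in>Pow I. d J)" and "J \<subseteq> N"
  shows "d J = newton \<Phi> (tally c J)"
proof (rule sum_Pow_inject[of J d "\<lambda>I. newton \<Phi> (tally c I)"])
  show "finite J" using assms finite_subset by auto
  fix I assume "I \<subseteq> J"
  then have I: "finite I" "I \<subseteq> N" using \<open>J \<subseteq> N\<close> finite_subset[OF _ \<open>finite N\<close>] by auto
  have "(\<Sum>J\<in>Pow I. newton \<Phi> (tally c J)) = \<Phi> (tally c I)"
    unfolding sum_Pow_tally[OF I(1)] by (rule newton_expansion[symmetric])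
  then show "(\<Sum>J\<in>Pow I. d J) = (\<Sum>J\<in>Pow I. newton \<Phi> (tally c J))" using d[OF I(2)] by simp
qed

definition mfact :: "'a multiset \<Rightarrow> real" where
  "mfact \<nu> = (\<Prod>a\<in>set_mset \<nu>. fact (count \<nu> a))"

lemma mfact_pos: "0 < mfact \<nu>"
  by (auto simp: mfact_def intro: prod_pos)

lemma power_size_mset: "c ^ size \<nu> = (\<Prod>a\<in>set_mset \<nu>. c ^ count \<nu> a)"
  by (simp add: size_multiset_overloaded_eq power_sum)

definition dyadic :: "nat \<Rightarrow> 'a multiset \<Rightarrow> 'a \<Rightarrow> real" where
  "dyadic n \<kappa> = (\<lambda>a. real (count \<kappa> a) / 2 ^ n)"

lemma dyadic_nonneg: "0 \<le> dyadic n \<kappa> a"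
  by (simp add: dyadic_def)

lemma dyadic_mono: "\<nu> \<subseteq># \<kappa> \<Longrightarrow> dyadic n \<nu> a \<le> dyadic n \<kappa> a"
  by (simp add: dyadic_def divide_right_mono mset_subset_eq_count)

lemma dyadic_repeat_mset: "dyadic (n + k) (repeat_mset (2 ^ k) \<kappa>) = dyadic n \<kappa>"
  by (simp add: dyadic_def fun_eq_iff power_add)

definition newton_basis :: "nat \<Rightarrow> ('a \<Rightarrow> real) \<Rightarrow> 'a multiset \<Rightarrow> real" where
  "newton_basis n x \<nu> = (\<Prod>a\<in>set_mset \<nu>. \<Prod>i<count \<nu> a. x a - real i / 2 ^ n)"

lemma newton_basis_dyadic: "newton_basis n (dyadic n \<kappa>) \<nu> = mbinom \<kappa> \<nu> * mfact \<nu> / (2 ^ n) ^ size \<nu>"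
proof -
  have "(\<Prod>i<j. real k / 2 ^ n - real i / 2 ^ n) = real (k choose j) * fact j / (2 ^ n) ^ j" for j k
  proof -
    have "(\<Prod>i<j. real k / 2 ^ n - real i / 2 ^ n) = (\<Prod>i = 0..<j. (real k - real i) / 2 ^ n)"
      by (simp add: diff_divide_distrib atLeast0LessThan)
    also have "\<dots> = (\<Prod>i = 0..<j. real k - real i) / (2 ^ n) ^ j" by (simp add: prod_dividef)
    also have "(\<Prod>i = 0..<j. real k - real i) = real (k choose j) * fact j"
      by (simp add: binomial_gbinomial gbinomial_mult_fact')
    finally show ?thesis .
  qed
  then show ?thesis
    by (simp add: newton_basis_def dyadic_def mbinom_def mfact_def power_size_mset prod.distrib prod_dividef)
qed

lemma newton_basis_dyadic_nonneg: "0 \<le> newton_basis n (dyadic n \<kappa>) \<nu>"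
  using mbinom_nonneg[of \<kappa> \<nu>] mfact_pos[of \<nu>] by (simp add: newton_basis_dyadic)

lemma newton_basis_dyadic_eq_0: "\<not> \<nu> \<subseteq># \<kappa> \<Longrightarrow> newton_basis n (dyadic n \<kappa>) \<nu> = 0"
  by (simp add: newton_basis_dyadic mbinom_eq_0)

lemma tendsto_newton_basis: "(\<lambda>n. newton_basis n x \<nu>) \<longlonglongrightarrow> monomial x \<nu>"
proof -
  have "(\<lambda>n. real i * (1/2) ^ n) \<longlonglongrightarrow> real i * 0" for i
    by (intro tendsto_intros LIMSEQ_realpow_zero) auto
  then have "(\<lambda>n. real i / 2 ^ n) \<longlonglongrightarrow> 0" for i by (simp add: power_one_over)
  then have "(\<lambda>n. newton_basis n x \<nu>) \<longlonglongrightarrow> (\<Prod>a\<in>set_mset \<nu>. \<Prod>i<count \<nu> a. x a - 0)"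
    unfolding newton_basis_def by (intro tendsto_intros)
  then show ?thesis by (simp add: monomial_def)
qed

lemma newton_basis_scale_le:
  assumes r: "0 \<le> r" "r \<le> 1" and scale: "\<And>a. dyadic n \<kappa>' a = r * dyadic n \<kappa> a"
  shows "newton_basis n (dyadic n \<kappa>') \<nu> \<le> r ^ size \<nu> * newton_basis n (dyadic n \<kappa>) \<nu>"
proof (cases "\<nu> \<subseteq># \<kappa>'")
  case True
  have nonneg: "0 \<le> dyadic n \<kappa>' a - real i / 2 ^ n" if "i < count \<nu> a" for a i
    using that mset_subset_eq_count[OF True, of a] by (simp add: dyadic_def divide_right_mono)
  have "r * (real i / 2 ^ n) \<le> 1 * (real i / 2 ^ n)" for i using r by (intro mult_right_mono) auto
  then have "dyadic n \<kappa>' a - real i / 2 ^ n \<le> r * (dyadic n \<kappa> a - real i / 2 ^ n)" for a i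
    by (simp add: scale right_diff_distrib)
  then have "newton_basis n (dyadic n \<kappa>') \<nu> \<le>
      (\<Prod>a\<in>set_mset \<nu>. \<Prod>i<count \<nu> a. r * (dyadic n \<kappa> a - real i / 2 ^ n))"
    unfolding newton_basis_def using nonneg by (intro prod_mono conjI prod_nonneg) auto
  also have "\<dots> = r ^ size \<nu> * newton_basis n (dyadic n \<kappa>) \<nu>"
    by (simp add: newton_basis_def prod.distrib power_size_mset)
  finally show ?thesis .
next
  case False
  then show ?thesis using r newton_basis_dyadic_nonneg[of n \<kappa> \<nu>] by (simp add: newton_basis_dyadic_eq_0)
qed

lemma summable_on_mfin_geometric:
  assumes "finite A" "0 \<le> r" "r < (1::real)"
  shows "(\<lambda>\<nu>. r ^ size \<nu>) summable_on mfin A"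
  using assms(1)
proof (induction A rule: finite_induct)
  case empty
  have "mfin {} = {{#} :: 'a multiset}" by (auto simp: mfin_def)
  then show ?case by simp
next
  case (insert a A)
  have "(\<lambda>(k, \<nu>). r ^ k * r ^ size \<nu>) summable_on (UNIV :: nat set) \<times> mfin A"
  proof (rule summable_on_SigmaI)
    show "((\<lambda>\<nu>. case (k, \<nu>) of (k, \<nu>) \<Rightarrow> r ^ k * r ^ size \<nu>)
        has_sum r ^ k * (\<Sum>\<^sub>\<infinity>\<nu>\<in>mfin A. r ^ size \<nu>)) (mfin A)" for k
      using has_sum_cmult_right[OF has_sum_infsum[OF insert.IH]] by simp
    show "(\<lambda>k. r ^ k * (\<Sum>\<^sub>\<infinity>\<nu>\<in>mfin A. r ^ size \<nu>)) summable_on UNIV"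
      using assms(2,3) by (intro summable_on_cmult_left norm_summable_imp_summable_on) (simp add: norm_power)
  qed (use assms(2) in simp)
  then have "(\<lambda>p. r ^ size ((\<lambda>(k, \<nu>). \<nu> + replicate_mset k a) p)) summable_on UNIV \<times> mfin A"
    by (rule summable_on_cong[THEN iffD1, rotated]) (auto simp: power_add mult.commute)
  then show ?case
    using summable_on_reindex_bij_betw[OF bij_betw_mfin_insert[OF insert.hyps(2)],
      of "\<lambda>\<nu>. r ^ size \<nu>"] by simp
qed

section \<open>Absolutely monotone functions are power series\<close>

lemma incseq_dyadic_floor: "incseq (\<lambda>n. real_of_int \<lfloor>2 ^ n * t\<rfloor> / 2 ^ n)"
proof (rule incseq_SucI)
  fix n
  have "2 * \<lfloor>2 ^ n * t\<rfloor> \<le> \<lfloor>2 ^ Suc n * t\<rfloor>"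
    unfolding le_floor_iff using of_int_floor_le[of "2 ^ n * t"] by simp
  then have "2 * real_of_int \<lfloor>2 ^ n * t\<rfloor> \<le> real_of_int \<lfloor>2 ^ Suc n * t\<rfloor>" by linarith
  then show "real_of_int \<lfloor>2 ^ n * t\<rfloor> / 2 ^ n \<le> real_of_int \<lfloor>2 ^ Suc n * t\<rfloor> / 2 ^ Suc n"
    by (simp add: field_simps)
qed

lemma tendsto_dyadic_floor: "(\<lambda>n. real_of_int \<lfloor>2 ^ n * t\<rfloor> / 2 ^ n) \<longlonglongrightarrow> t"
proof (rule tendsto_sandwich[OF always_eventually always_eventually _ tendsto_const])
  show "\<forall>n. t - (1/2) ^ n \<le> real_of_int \<lfloor>2 ^ n * t\<rfloor> / 2 ^ n"
  proof
    fix n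
    have "(2 ^ n * t - 1) / 2 ^ n \<le> real_of_int \<lfloor>2 ^ n * t\<rfloor> / 2 ^ n"
      by (intro divide_right_mono) (linarith, simp)
    then show "t - (1/2) ^ n \<le> real_of_int \<lfloor>2 ^ n * t\<rfloor> / 2 ^ n"
      by (simp add: diff_divide_distrib power_one_over)
  qed
  show "\<forall>n. real_of_int \<lfloor>2 ^ n * t\<rfloor> / 2 ^ n \<le> t"
    using of_int_floor_le[of "2 ^ _ * t"] by (simp add: field_simps)
  have "(\<lambda>n. t - (1/2) ^ n) \<longlonglongrightarrow> t - 0" by (intro tendsto_intros LIMSEQ_realpow_zero) auto
  then show "(\<lambda>n. t - (1/2) ^ n) \<longlonglongrightarrow> t" by simp
qed

lemma dyadic_sum_replicate_mset:
  assumes "finite A" "0 \<le> x a"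
  shows "dyadic n (\<Sum>b\<in>A. replicate_mset (nat \<lfloor>2 ^ n * x b\<rfloor>) b) a =
    (if a \<in> A then real_of_int \<lfloor>2 ^ n * x a\<rfloor> / 2 ^ n else 0)"
proof -
  have "count (\<Sum>b\<in>A. replicate_mset (nat \<lfloor>2 ^ n * x b\<rfloor>) b) a =
      (\<Sum>b\<in>A. if a = b then nat \<lfloor>2 ^ n * x b\<rfloor> else 0)"
    unfolding count_sum by (intro sum.cong) auto
  then show ?thesis using assms by (simp add: dyadic_def)
qed

context pcspace
begin

lemma dyadic_approximation:
  assumes x: "x \<in> pts X"
  obtains \<kappa> where "\<And>a. incseq (\<lambda>n. dyadic n (\<kappa> n) a)" "\<And>a. (\<lambda>n. dyadic n (\<kappa> n) a) \<longlonglongrightarrow> x a"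
proof -
  obtain A :: "nat \<Rightarrow> 'a set" where A: "incseq A" "\<And>n. finite (A n)" "(\<Union>n. A n) = web X"
    using countable_finite_exhaustion[OF countable_web] by metis
  define \<kappa> where "\<kappa> n = (\<Sum>a\<in>A n. replicate_mset (nat \<lfloor>2 ^ n * x a\<rfloor>) a)" for n
  have dyadic: "dyadic n (\<kappa> n) a = (if a \<in> A n then real_of_int \<lfloor>2 ^ n * x a\<rfloor> / 2 ^ n else 0)" for n a
    using A(2) pts_nonneg[OF x] unfolding \<kappa>_def by (rule dyadic_sum_replicate_mset)
  show ?thesis
  proof (rule that[of \<kappa>])
    fix a
    have "dyadic n (\<kappa> n) a \<le> dyadic (Suc n) (\<kappa> (Suc n)) a" for n
    proof (cases "a \<in> A n")
      case True
      then have "a \<in> A (Suc n)" using incseq_SucD[OF A(1)] by auto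
      then show ?thesis using True incseq_SucD[OF incseq_dyadic_floor[of "x a"]] by (simp add: dyadic)
    next
      case False
      then have "dyadic n (\<kappa> n) a = 0" by (simp add: dyadic)
      then show ?thesis using dyadic_nonneg by simp
    qed
    then show "incseq (\<lambda>n. dyadic n (\<kappa> n) a)" by (rule incseq_SucI)
    show "(\<lambda>n. dyadic n (\<kappa> n) a) \<longlonglongrightarrow> x a"
    proof (cases "a \<in> web X")
      case True
      then obtain m where "a \<in> A m" using A(3) by auto
      then have "\<forall>\<^sub>F n in sequentially. real_of_int \<lfloor>2 ^ n * x a\<rfloor> / 2 ^ n = dyadic n (\<kappa> n) a"
        using incseqD[OF A(1)] by (intro eventually_mono[OF eventually_ge_at_top[of m]]) (auto simp: dyadic)
      then show ?thesis by (rule Lim_transform_eventually[OF tendsto_dyadic_floor])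
    next
      case False
      then have "a \<notin> A n" for n using A(3) by auto
      then show ?thesis using pts_outside[OF x False] by (simp add: dyadic)
    qed
  qed
qed

lemma dyadic_submset_pts: "dyadic n \<kappa> \<in> pts X \<Longrightarrow> \<nu> \<subseteq># \<kappa> \<Longrightarrow> dyadic n \<nu> \<in> pts X"
  by (rule pts_downward_closed) (auto simp: dyadic_nonneg dyadic_mono)

lemma eventually_dyadic_pts:
  assumes "\<nu> \<in> mfin (web X)"
  shows "\<forall>\<^sub>F n in sequentially. dyadic n \<nu> \<in> pts X"
proof -
  have "(\<lambda>a. real (count \<nu> a)) \<in> Fm_carrier X"
    by (rule finite_support_carrier[of "set_mset \<nu>"]) (use assms in \<open>auto simp: mfin_def not_in_iff\<close>)
  then obtain r where r: "r > 0" "(\<lambda>a. r * real (count \<nu> a)) \<in> pts X"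
    unfolding carrier_iff by (elim exE conjE)
  have "(\<lambda>n. (1/2) ^ n) \<longlonglongrightarrow> (0::real)" by (rule LIMSEQ_realpow_zero) auto
  then have "\<forall>\<^sub>F n in sequentially. (1/2) ^ n < r" using r(1) by (rule order_tendstoD(2))
  then show ?thesis
  proof eventually_elim
    case (elim n)
    show "dyadic n \<nu> \<in> pts X"
    proof (rule pts_downward_closed[OF r(2)])
      fix a
      have "(1/2) ^ n * real (count \<nu> a) \<le> r * real (count \<nu> a)" using elim by (intro mult_right_mono) auto
      then show "dyadic n \<nu> a \<le> r * real (count \<nu> a)" by (simp add: dyadic_def power_one_over)
    qed (rule dyadic_nonneg)
  qed
qed

end

locale absolutely_monotone = pcspace X for X :: "'a pcs" +
  fixes \<phi> :: "('a \<Rightarrow> real) \<Rightarrow> real"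
  assumes nat_cube: "\<And>(N :: nat set) u. finite N \<Longrightarrow> (\<And>i a. i \<in> N \<Longrightarrow> 0 \<le> u i a) \<Longrightarrow>
      (\<lambda>a. \<Sum>i\<in>N. u i a) \<in> pts X \<Longrightarrow> monotone_cube nonneg_semiring N (\<lambda>I. \<phi> (\<lambda>a. \<Sum>i\<in>I. u i a))"
    and continuous: "\<And>s x. (\<And>n. s n \<in> pts X) \<Longrightarrow> x \<in> pts X \<Longrightarrow> (\<And>a. incseq (\<lambda>n. s n a)) \<Longrightarrow>
      (\<And>a. (\<lambda>n. s n a) \<longlonglongrightarrow> x a) \<Longrightarrow> (\<lambda>n. \<phi> (s n)) \<longlonglongrightarrow> \<phi> x"
begin

lemma cube:
  assumes "finite N" and u: "\<And>i a. i \<in> N \<Longrightarrow> 0 \<le> u i a" and "(\<lambda>a. \<Sum>i\<in>N. u i a) \<in> pts X"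
  shows "monotone_cube nonneg_semiring N (\<lambda>I. \<phi> (\<lambda>a. \<Sum>i\<in>I. u i a))"
proof -
  obtain h where "bij_betw h {0..<card N} N" using ex_bij_betw_nat_finite[OF assms(1)] by blast
  then have h: "inj_on h {0..<card N}" "h ` {0..<card N} = N" by (auto simp: bij_betw_def)
  have reindex: "(\<Sum>i\<in>I. u (h i) a) = (\<Sum>i\<in>h ` I. u i a)" if "I \<subseteq> {0..<card N}" for I a
    using inj_on_subset[OF h(1) that] by (simp add: sum.reindex)
  have "monotone_cube nonneg_semiring {0..<card N} (\<lambda>I. \<phi> (\<lambda>a. \<Sum>i\<in>I. u (h i) a))"
  proof (rule nat_cube)
    show "0 \<le> u (h i) a" if "i \<in> {0..<card N}" for i a using that h(2) by (intro u) blast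
    show "(\<lambda>a. \<Sum>i\<in>{0..<card N}. u (h i) a) \<in> pts X" using assms(3) by (simp add: reindex h(2))
  qed simp
  then have "monotone_cube nonneg_semiring {0..<card N} (\<lambda>I. \<phi> (\<lambda>a. \<Sum>i\<in>h ` I. u i a))"
    by (rule monotone_cube_cong[THEN iffD1, rotated]) (simp add: reindex)
  from nonneg.monotone_cube_image[OF _ h(1) this] show ?thesis by (simp add: h(2))
qed

lemma nonneg_on_pts: "x \<in> pts X \<Longrightarrow> 0 \<le> \<phi> x"
proof -
  assume x: "x \<in> pts X"
  then obtain d where "cube_differences nonneg_semiring {0 :: nat} (\<lambda>I. \<phi> (\<lambda>a. \<Sum>i\<in>I. x a)) d"
    using nat_cube[of "{0}" "\<lambda>_. x"] pts_nonneg[OF x] by (auto simp: monotone_cube_def)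
  from nonneg.cube_closed[OF this subset_refl] show ?thesis by (simp add: nonneg_semiring_simps)
qed

definition difference :: "nat \<Rightarrow> 'a multiset \<Rightarrow> real" where
  "difference n = newton (\<lambda>\<kappa>. \<phi> (dyadic n \<kappa>))"

lemma cube_differences_dyadic:
  assumes "finite N" "dyadic n (tally c N) \<in> pts X"
  shows "cube_differences nonneg_semiring N (\<lambda>I. \<phi> (dyadic n (tally c I))) (\<lambda>J. difference n (tally c J))"
proof -
  define u where "u i a = (if c i = a then 1 / 2 ^ n else 0 :: real)" for i a
  have sum: "(\<lambda>a. \<Sum>i\<in>I. u i a) = dyadic n (tally c I)" if "I \<subseteq> N" for I
  proof -
    have I: "finite I" using that assms(1) finite_subset by auto
    have "(\<Sum>i\<in>I. u i a) = (\<Sum>i\<in>{i \<in> I. c i = a}. 1 / 2 ^ n)" for a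
      unfolding u_def by (rule sum.mono_neutral_cong_right) (use I in auto)
    then show ?thesis by (simp add: fun_eq_iff dyadic_def count_tally[OF I])
  qed
  have "monotone_cube nonneg_semiring N (\<lambda>I. \<phi> (\<lambda>a. \<Sum>i\<in>I. u i a))"
    by (rule cube[OF assms(1)]) (simp_all add: u_def[abs_def] sum[unfolded u_def] assms(2))
  then obtain d where d: "\<And>J. J \<subseteq> N \<Longrightarrow> 0 \<le> d J" "\<And>I. I \<subseteq> N \<Longrightarrow> \<phi> (dyadic n (tally c I)) = (\<Sum>J\<in>Pow I. d J)"
    by (auto simp: monotone_cube_def cube_differences_nonneg_semiring sum)
  have "d J = difference n (tally c J)" if "J \<subseteq> N" for J
    unfolding difference_def by (rule differences_eq_newton[OF assms(1) d(2) that])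
  then have "0 \<le> difference n (tally c J)" "d J = difference n (tally c J)" if "J \<subseteq> N" for J
    using d(1)[OF that] that by simp_all
  moreover have "(\<Sum>J\<in>Pow I. d J) = (\<Sum>J\<in>Pow I. difference n (tally c J))" if "I \<subseteq> N" for I
    using calculation(2) that by (intro sum.cong) auto
  ultimately show ?thesis
    using d(2) by (simp add: cube_differences_nonneg_semiring)
qed

lemma difference_nonneg:
  assumes "dyadic n \<nu> \<in> pts X"
  shows "0 \<le> difference n \<nu>"
proof -
  obtain N :: "nat set" and c where "finite N" and \<nu>: "tally c N = \<nu>" by (rule ex_tally)
  then show ?thesis
    using cube_differences_dyadic[of N n c] assms by (auto simp: cube_differences_nonneg_semiring)
qed

text \<open>Splitting each increment into two halves, the difference along the given increments
  collects the differences along all sets of halves meeting each pair, among them the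
  \<open>2 ^ size \<nu>\<close> choices of one half from each pair.\<close>

lemma difference_Suc_le:
  assumes \<nu>: "dyadic n \<nu> \<in> pts X"
  shows "2 ^ size \<nu> * difference (Suc n) \<nu> \<le> difference n \<nu>"
proof -
  obtain N :: "nat set" and c where N: "finite N" "card N = size \<nu>" "tally c N = \<nu>" by (rule ex_tally)
  define halves where "halves I = I \<times> (UNIV :: bool set)" for I :: "nat set"
  let ?d = "\<lambda>T. difference (Suc n) (tally (c \<circ> fst) T)"
  let ?covers = "\<lambda>J. {T. T \<subseteq> halves N \<and> fst ` T = J}"
  have tally: "dyadic (Suc n) (tally (c \<circ> fst) (halves I)) = dyadic n (tally c I)" if "I \<subseteq> N" for I
    using dyadic_repeat_mset[of n 1] finite_subset[OF that N(1)] by (simp add: halves_def tally_halves)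
  have fine: "cube_differences nonneg_semiring (halves N) (\<lambda>I. \<phi> (dyadic (Suc n) (tally (c \<circ> fst) I))) ?d"
    using N \<nu> tally[OF subset_refl] by (intro cube_differences_dyadic) (auto simp: halves_def)
  then have closed: "0 \<le> ?d T" if "T \<subseteq> halves N" for T
    using that by (simp add: cube_differences_nonneg_semiring)
  have "cube_differences nonneg_semiring N (\<lambda>I. \<phi> (dyadic (Suc n) (tally (c \<circ> fst) (halves I))))
      (\<lambda>J. \<Oplus>\<^bsub>nonneg_semiring\<^esub>T\<in>?covers J. ?d T)"
    by (rule nonneg.cube_differences_galois[OF N(1) _ fine]) (use N(1) in \<open>auto simp: halves_def\<close>)
  moreover have "(\<Oplus>\<^bsub>nonneg_semiring\<^esub>T\<in>?covers J. ?d T) = (\<Sum>T\<in>?covers J. ?d T)" for J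
    by (rule finsum_nonneg_semiring) (use closed in auto)
  ultimately have "\<phi> (dyadic n (tally c I)) = (\<Sum>J\<in>Pow I. \<Sum>T\<in>?covers J. ?d T)" if "I \<subseteq> N" for I
    using that tally by (simp add: cube_differences_nonneg_semiring)
  then have "(\<Sum>T\<in>?covers N. ?d T) = difference n \<nu>"
    using differences_eq_newton[OF N(1), of "\<lambda>\<kappa>. \<phi> (dyadic n \<kappa>)" c _ N] by (simp add: difference_def N(3))
  moreover have "(\<Sum>T\<in>(\<lambda>B. (\<lambda>i. (i, i \<in> B)) ` N) ` Pow N. ?d T) \<le> (\<Sum>T\<in>?covers N. ?d T)"
    by (rule sum_mono2) (use N(1) closed in \<open>auto simp: halves_def image_image\<close>)
  moreover have "inj_on (\<lambda>B. (\<lambda>i. (i, i \<in> B)) ` N) (Pow N)" by (rule inj_onI) blast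
  then have "(\<Sum>T\<in>(\<lambda>B. (\<lambda>i. (i, i \<in> B)) ` N) ` Pow N. ?d T) = 2 ^ size \<nu> * difference (Suc n) \<nu>"
    by (simp add: sum.reindex tally_section N card_Pow)
  ultimately show ?thesis by simp
qed

definition divided_difference :: "nat \<Rightarrow> 'a multiset \<Rightarrow> real" where
  "divided_difference n \<nu> = difference n \<nu> * (2 ^ n) ^ size \<nu> / mfact \<nu>"

lemma divided_difference_nonneg: "dyadic n \<nu> \<in> pts X \<Longrightarrow> 0 \<le> divided_difference n \<nu>"
  using difference_nonneg mfact_pos[of \<nu>] by (simp add: divided_difference_def)

lemma divided_difference_Suc_le:
  assumes "dyadic n \<nu> \<in> pts X"
  shows "divided_difference (Suc n) \<nu> \<le> divided_difference n \<nu>"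
proof -
  have "divided_difference (Suc n) \<nu> = 2 ^ size \<nu> * difference (Suc n) \<nu> * ((2 ^ n) ^ size \<nu> / mfact \<nu>)"
    by (simp add: divided_difference_def power_mult_distrib)
  also have "\<dots> \<le> difference n \<nu> * ((2 ^ n) ^ size \<nu> / mfact \<nu>)"
    using difference_Suc_le[OF assms] mfact_pos[of \<nu>] by (intro mult_right_mono) auto
  finally show ?thesis by (simp add: divided_difference_def)
qed

definition taylor :: "'a multiset \<Rightarrow> real" where
  "taylor \<nu> = (if \<nu> \<in> mfin (web X) then lim (\<lambda>n. divided_difference n \<nu>) else 0)"

lemma divided_difference_limit:
  assumes "\<nu> \<in> mfin (web X)"
  shows "0 \<le> taylor \<nu>" "(\<lambda>n. divided_difference n \<nu>) \<longlonglongrightarrow> taylor \<nu>"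
proof -
  obtain m where m: "\<And>n. n \<ge> m \<Longrightarrow> dyadic n \<nu> \<in> pts X"
    using eventually_dyadic_pts[OF assms] by (auto simp: eventually_sequentially)
  have "decseq (\<lambda>n. divided_difference (n + m) \<nu>)"
    using m by (intro decseq_SucI) (simp add: divided_difference_Suc_le)
  moreover have "\<forall>n. 0 \<le> divided_difference (n + m) \<nu>" using m by (simp add: divided_difference_nonneg)
  ultimately obtain l where shifted: "(\<lambda>n. divided_difference (n + m) \<nu>) \<longlonglongrightarrow> l"
    by (rule decseq_convergent)
  then have "(\<lambda>n. divided_difference n \<nu>) \<longlonglongrightarrow> l" by (rule LIMSEQ_offset)
  moreover from this have "taylor \<nu> = l" using assms by (simp add: taylor_def limI)
  moreover have "0 \<le> l" using shifted m
    by (intro LIMSEQ_le_const[OF shifted])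
      (auto simp: divided_difference_nonneg)
  ultimately show "0 \<le> taylor \<nu>" "(\<lambda>n. divided_difference n \<nu>) \<longlonglongrightarrow> taylor \<nu>" by simp_all
qed

lemma taylor_nonneg: "0 \<le> taylor \<nu>"
  using divided_difference_limit(1) by (cases "\<nu> \<in> mfin (web X)") (simp_all add: taylor_def)

lemma newton_formula:
  "\<phi> (dyadic n \<kappa>) = (\<Sum>\<nu> | \<nu> \<subseteq># \<kappa>. divided_difference n \<nu> * newton_basis n (dyadic n \<kappa>) \<nu>)"
proof -
  have "divided_difference n \<nu> * newton_basis n (dyadic n \<kappa>) \<nu> = mbinom \<kappa> \<nu> * difference n \<nu>" for \<nu>
    using mfact_pos[of \<nu>] by (simp add: divided_difference_def newton_basis_dyadic)
  moreover have "\<phi> (dyadic n \<kappa>) = (\<Sum>\<nu> | \<nu> \<subseteq># \<kappa>. mbinom \<kappa> \<nu> * difference n \<nu>)"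
    unfolding difference_def by (rule newton_expansion[of "\<lambda>\<kappa>. \<phi> (dyadic n \<kappa>)" \<kappa>])
  ultimately show ?thesis by simp
qed

lemma newton_term_nonneg:
  assumes "dyadic n \<kappa> \<in> pts X"
  shows "0 \<le> divided_difference n \<nu> * newton_basis n (dyadic n \<kappa>) \<nu>"
proof (cases "\<nu> \<subseteq># \<kappa>")
  case True
  then show ?thesis
    by (intro mult_nonneg_nonneg divided_difference_nonneg dyadic_submset_pts[OF assms]
      newton_basis_dyadic_nonneg)
qed (simp add: newton_basis_dyadic_eq_0)

lemma infsum_newton_formula:
  assumes \<kappa>: "dyadic n \<kappa> \<in> pts X" and "set_mset \<kappa> \<subseteq> A"
  shows "(\<Sum>\<^sub>\<infinity>\<nu>\<in>mfin A. ennreal (divided_difference n \<nu> * newton_basis n (dyadic n \<kappa>) \<nu>)) =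
      ennreal (\<phi> (dyadic n \<kappa>))"
proof -
  have "(\<Sum>\<^sub>\<infinity>\<nu>\<in>mfin A. ennreal (divided_difference n \<nu> * newton_basis n (dyadic n \<kappa>) \<nu>)) =
      (\<Sum>\<^sub>\<infinity>\<nu>\<in>{\<nu>. \<nu> \<subseteq># \<kappa>}. ennreal (divided_difference n \<nu> * newton_basis n (dyadic n \<kappa>) \<nu>))"
    using assms(2)
      by (intro infsum_cong_neutral)
        (auto simp: mfin_def newton_basis_dyadic_eq_0 dest: set_mset_mono)
  also have "\<dots> = ennreal (\<phi> (dyadic n \<kappa>))"
    using newton_term_nonneg[OF \<kappa>] by (simp add: finite_submsets sum_ennreal newton_formula)
  finally show ?thesis .
qed

lemma newton_term_scale_le:
  assumes \<kappa>: "dyadic n \<kappa> \<in> pts X" and r: "0 \<le> r" "r \<le> 1"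
    and scale: "\<And>a. dyadic n \<kappa>' a = r * dyadic n \<kappa> a"
  shows "divided_difference n \<nu> * newton_basis n (dyadic n \<kappa>') \<nu> \<le> r ^ size \<nu> * \<phi> (dyadic n \<kappa>)"
proof (cases "\<nu> \<subseteq># \<kappa>")
  case True
  have "divided_difference n \<nu> * newton_basis n (dyadic n \<kappa>') \<nu> \<le>
      divided_difference n \<nu> * (r ^ size \<nu> * newton_basis n (dyadic n \<kappa>) \<nu>)"
    by (intro mult_left_mono newton_basis_scale_le r scale divided_difference_nonneg
      dyadic_submset_pts[OF \<kappa> True])
  also have "\<dots> = r ^ size \<nu> * (divided_difference n \<nu> * newton_basis n (dyadic n \<kappa>) \<nu>)" by simp
  also have "\<dots> \<le> r ^ size \<nu> * \<phi> (dyadic n \<kappa>)"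
    unfolding newton_formula[of n \<kappa>] using r True
    by (intro mult_left_mono member_le_sum newton_term_nonneg[OF \<kappa>] finite_submsets) auto
  finally show ?thesis .
next
  case False
  then have "newton_basis n (dyadic n \<kappa>') \<nu> = 0"
    using newton_basis_scale_le[OF r scale, of \<nu>] newton_basis_dyadic_nonneg[of n \<kappa>' \<nu>]
    by (simp add: newton_basis_dyadic_eq_0)
  then show ?thesis using r nonneg_on_pts[OF \<kappa>] by simp
qed

lemma tendsto_infsum_newton_terms:
  assumes "finite A" "A \<subseteq> web X" and r: "0 \<le> r" "r < 1" and "0 \<le> M"
    and bound: "\<And>k \<nu>. divided_difference (n + k) \<nu> * newton_basis (n + k) y \<nu> \<le> r ^ size \<nu> * M"
  shows "(\<lambda>k. \<Sum>\<^sub>\<infinity>\<nu>\<in>mfin A. ennreal (divided_difference (n + k) \<nu> * newton_basis (n + k) y \<nu>)) \<longlonglongrightarrow>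
    (\<Sum>\<^sub>\<infinity>\<nu>\<in>mfin A. ennreal (taylor \<nu> * monomial y \<nu>))"
proof (rule infsum_ennreal_dominated_convergence)
  show "countable (mfin A)" by (simp add: countable_mfin assms(1) countable_finite)
  show "ennreal (divided_difference (n + k) \<nu> * newton_basis (n + k) y \<nu>) \<le> ennreal (r ^ size \<nu> * M)" for k \<nu>
    by (rule ennreal_leI[OF bound])
  show "(\<Sum>\<^sub>\<infinity>\<nu>\<in>mfin A. ennreal (r ^ size \<nu> * M)) < \<infinity>"
    using summable_on_mfin_geometric[OF assms(1) r] r(1) \<open>0 \<le> M\<close>
    by (subst infsum_ennreal) (auto intro!: summable_on_cmult_left)
  fix \<nu> assume "\<nu> \<in> mfin A"
  then have "\<nu> \<in> mfin (web X)" using assms(2) by (auto simp: mfin_def)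
  then have "(\<lambda>n. divided_difference n \<nu> * newton_basis n y \<nu>) \<longlonglongrightarrow> taylor \<nu> * monomial y \<nu>"
    by (intro tendsto_mult divided_difference_limit(2) tendsto_newton_basis)
  from LIMSEQ_ignore_initial_segment[OF this, of n]
  show "(\<lambda>k. ennreal (divided_difference (n + k) \<nu> * newton_basis (n + k) y \<nu>)) \<longlonglongrightarrow>
      ennreal (taylor \<nu> * monomial y \<nu>)"
    by (intro tendsto_ennrealI) (simp add: add.commute)
qed

lemma infsum_taylor_shrunk:
  assumes x: "x \<in> pts X" "\<And>k. x \<in> range (dyadic (n + k))" and y: "\<And>k. y \<in> range (dyadic (n + k))"
    and r: "0 \<le> r" "r < 1" and scale: "\<And>a. y a = r * x a"
    and A: "finite A" "A \<subseteq> web X" "\<And>a. a \<notin> A \<Longrightarrow> x a = 0"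
  shows "(\<Sum>\<^sub>\<infinity>\<nu>\<in>mfin A. ennreal (taylor \<nu> * monomial y \<nu>)) = ennreal (\<phi> y)"
proof -
  have "\<exists>\<kappa>. x = dyadic (n + k) \<kappa>" "\<exists>\<kappa>. y = dyadic (n + k) \<kappa>" for k
    using x(2)[of k] y[of k] by auto
  then obtain \<kappa> \<kappa>' where \<kappa>: "\<And>k. x = dyadic (n + k) (\<kappa> k)" and \<kappa>': "\<And>k. y = dyadic (n + k) (\<kappa>' k)"
    by metis
  have y_pts: "y \<in> pts X"
    by (rule pts_downward_closed[OF x(1)])
       (use r pts_nonneg[OF x(1)] in \<open>auto simp: scale intro: mult_left_le_one_le\<close>)
  have "divided_difference (n + k) \<nu> * newton_basis (n + k) y \<nu> \<le> r ^ size \<nu> * \<phi> x" for k \<nu>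
    using newton_term_scale_le[of "n + k" "\<kappa> k" r "\<kappa>' k" \<nu>] x(1) r scale by (simp flip: \<kappa> \<kappa>')
  then have "(\<lambda>k. \<Sum>\<^sub>\<infinity>\<nu>\<in>mfin A. ennreal (divided_difference (n + k) \<nu> * newton_basis (n + k) y \<nu>)) \<longlonglongrightarrow>
      (\<Sum>\<^sub>\<infinity>\<nu>\<in>mfin A. ennreal (taylor \<nu> * monomial y \<nu>))"
    by (rule tendsto_infsum_newton_terms[OF A(1,2) r nonneg_on_pts[OF x(1)]])
  moreover have "(\<Sum>\<^sub>\<infinity>\<nu>\<in>mfin A. ennreal (divided_difference (n + k) \<nu> * newton_basis (n + k) y \<nu>)) =
      ennreal (\<phi> y)" for k
  proof -
    have "set_mset (\<kappa>' k) \<subseteq> A"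
    proof
      fix a assume "a \<in># \<kappa>' k"
      then have "y a \<noteq> 0" by (simp add: \<kappa>'[of k] dyadic_def)
      then show "a \<in> A" using A(3)[of a] scale by auto
    qed
    then show ?thesis using infsum_newton_formula[of "n + k" "\<kappa>' k" A] y_pts by (simp flip: \<kappa>')
  qed
  ultimately show ?thesis by (simp add: LIMSEQ_const_iff)
qed

lemma series_taylor_shrunk:
  fixes q :: nat
  assumes \<kappa>: "dyadic m \<kappa> \<in> pts X"
  defines "y \<equiv> \<lambda>a. (1 - (1/2) ^ q) * dyadic m \<kappa> a"
  shows "series X (\<lambda>\<nu> _. taylor \<nu>) y b = ennreal (\<phi> y)"
proof -
  have outside: "a \<notin># \<kappa> \<Longrightarrow> dyadic m \<kappa> a = 0" for a by (simp add: dyadic_def not_in_iff)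
  have web: "set_mset \<kappa> \<subseteq> web X"
  proof
    fix a assume "a \<in># \<kappa>"
    then have "dyadic m \<kappa> a \<noteq> 0" by (simp add: dyadic_def)
    then show "a \<in> web X" using pts_outside[OF \<kappa>] by blast
  qed
  have "series X (\<lambda>\<nu> _. taylor \<nu>) y b = (\<Sum>\<^sub>\<infinity>\<nu>\<in>mfin (set_mset \<kappa>). ennreal (taylor \<nu> * monomial y \<nu>))"
    by (rule series_finite_support[OF web]) (simp add: y_def outside)
  also have "\<dots> = ennreal (\<phi> y)"
  proof (rule infsum_taylor_shrunk[where n = "m + q" and r = "1 - (1/2) ^ q", OF \<kappa> _ _ _ _ _ _ web outside])
    fix k
    have "dyadic m \<kappa> = dyadic (m + q + k) (repeat_mset (2 ^ (q + k)) \<kappa>)"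
      by (simp add: dyadic_repeat_mset add.assoc)
    then show "dyadic m \<kappa> \<in> range (dyadic (m + q + k))" by simp
    have "y = dyadic (m + q + k) (repeat_mset (2 ^ k * (2 ^ q - 1)) \<kappa>)"
      by (simp add: y_def dyadic_def fun_eq_iff power_add of_nat_diff power_one_over field_simps)
    then show "y \<in> range (dyadic (m + q + k))" by simp
  qed (simp_all add: y_def power_le_one)
  finally show ?thesis .
qed

lemma series_taylor_limit:
  assumes x: "x \<in> pts X" and s: "\<And>n a. 0 \<le> s n a"
    and inc: "\<And>a. incseq (\<lambda>n. s n a)" and lim: "\<And>a. (\<lambda>n. s n a) \<longlonglongrightarrow> x a"
    and eq: "\<And>n. s n \<in> pts X \<Longrightarrow> series X (\<lambda>\<nu> _. taylor \<nu>) (s n) b = ennreal (\<phi> (s n))"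
  shows "series X (\<lambda>\<nu> _. taylor \<nu>) x b = ennreal (\<phi> x)"
proof (rule LIMSEQ_unique)
  have pts: "s n \<in> pts X" for n
    by (rule pts_downward_closed[OF x s]) (rule incseq_le[OF inc lim])
  show "(\<lambda>n. series X (\<lambda>\<nu> _. taylor \<nu>) (s n) b) \<longlonglongrightarrow> series X (\<lambda>\<nu> _. taylor \<nu>) x b"
    by (rule tendsto_series) (rule taylor_nonneg s inc lim)+
  have "(\<lambda>n. \<phi> (s n)) \<longlonglongrightarrow> \<phi> x" by (rule continuous[OF pts x inc lim])
  then show "(\<lambda>n. series X (\<lambda>\<nu> _. taylor \<nu>) (s n) b) \<longlonglongrightarrow> ennreal (\<phi> x)"
    unfolding eq[OF pts] by (rule tendsto_ennrealI)
qed

lemma series_taylor_dyadic: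
  assumes "dyadic m \<kappa> \<in> pts X"
  shows "series X (\<lambda>\<nu> _. taylor \<nu>) (dyadic m \<kappa>) b = ennreal (\<phi> (dyadic m \<kappa>))"
proof (rule series_taylor_limit[OF assms])
  let ?s = "\<lambda>q a. (1 - (1/2) ^ q) * dyadic m \<kappa> a"
  have half: "(1/2) ^ q \<le> (1::real)" for q by (rule power_le_one) auto
  show "0 \<le> ?s q a" for q a using half by (simp add: dyadic_nonneg)
  have "decseq (\<lambda>q. (1/2 :: real) ^ q)" by (auto simp: decseq_def intro: power_decreasing)
  then show "incseq (\<lambda>q. ?s q a)" for a
    by (auto simp: decseq_def incseq_def dyadic_nonneg intro!: mult_right_mono)
  have "(\<lambda>q. ?s q a) \<longlonglongrightarrow> (1 - 0) * dyadic m \<kappa> a" for a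
    by (intro tendsto_intros LIMSEQ_realpow_zero) auto
  then show "(\<lambda>q. ?s q a) \<longlonglongrightarrow> dyadic m \<kappa> a" for a by simp
  show "series X (\<lambda>\<nu> _. taylor \<nu>) (?s q) b = ennreal (\<phi> (?s q))" for q
    by (rule series_taylor_shrunk[OF assms])
qed

theorem series_taylor:
  assumes x: "x \<in> pts X"
  shows "series X (\<lambda>\<nu> _. taylor \<nu>) x b = ennreal (\<phi> x)"
proof -
  obtain \<kappa> where inc: "\<And>a. incseq (\<lambda>n. dyadic n (\<kappa> n) a)" and lim: "\<And>a. (\<lambda>n. dyadic n (\<kappa> n) a) \<longlonglongrightarrow> x a"
    using dyadic_approximation[OF x] by metis
  show ?thesis by (rule series_taylor_limit[OF x dyadic_nonneg inc lim series_taylor_dyadic])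
qed

end

section \<open>The functor\<close>

locale stable_pcs_map = X: pcspace X + Y: pcspace Y
  for X :: "'a pcs" and Y :: "'b pcs" and g :: "('a \<Rightarrow> real) \<Rightarrow> ('b \<Rightarrow> real)" +
  assumes stable: "stable (Fm_obj X) (Fm_obj Y) g"

sublocale stable_pcs_map \<subseteq> cone_map "Fm_obj X" "Fm_obj Y" g
  using X.normed_cone_Fm_obj Y.normed_cone_Fm_obj stable by (rule stable_cone_map)

context stable_pcs_map
begin

lemma prestable: "prestable (Fm_obj X) (Fm_obj Y) g"
  using stable by (simp add: stable_def)

lemma monotone_cube_map_coordinate:
  assumes N: "finite N" and u: "\<And>i a. i \<in> N \<Longrightarrow> 0 \<le> u i a" and total: "(\<lambda>a. \<Sum>i\<in>N. u i a) \<in> pts X"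
  shows "monotone_cube nonneg_semiring N (\<lambda>I. g (\<lambda>a. \<Sum>i\<in>I. u i a) b)"
proof -
  have closed: "u \<in> N \<rightarrow> Fm_carrier X"
    using N u
      by (intro Pi_I X.carrier_downward_closed[OF X.pts_carrier[OF total]])
        (auto intro: member_le_sum)
  have vertex: "vertex (Fm_obj X) (\<lambda>_. 0) u I = (\<lambda>a. \<Sum>i\<in>I. u i a)" if "I \<subseteq> N" for I
    using X.vertex_Fm_obj[OF N closed that] by simp
  have "ball_cube (Fm_obj X) N (\<lambda>_. 0) u"
    using N closed total X.pts_carrier[OF X.zero_pts]
    by (simp add: ball_cube_def vertex[OF subset_refl] X.cone_ball_Fm_obj X.Fm_obj_simps(1))
  from Y.monotone_cube_coordinate[OF N prestable_monotone_cube[OF prestable this]]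
  show ?thesis by (rule monotone_cube_cong[THEN iffD1, rotated]) (simp only: vertex)
qed

lemma tendsto_map_coordinate:
  assumes s: "\<And>n. s n \<in> pts X" and x: "x \<in> pts X" and inc: "\<And>a. incseq (\<lambda>n. s n a)"
    and lim: "\<And>a. (\<lambda>n. s n a) \<longlonglongrightarrow> x a"
  shows "(\<lambda>n. g (s n) b) \<longlonglongrightarrow> g x b"
proof (rule Y.cone_lub_Fm_objD)
  show "g (s n) \<in> Fm_carrier Y" for n
    using range s by (auto simp: X.cone_ball_Fm_obj Y.Fm_obj_simps)
  have lub: "cone_lub (Fm_obj X) s x"
    by (rule X.cone_lub_Fm_objI[OF X.pts_carrier[OF s] X.pts_carrier[OF x] inc lim])
  have s_inc: "cone_incseq (Fm_obj X) s"
    using X.cone_incseq_Fm_obj[of s, OF X.pts_carrier[OF s]] inc by blast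
  then show "cone_incseq (Fm_obj Y) (\<lambda>n. g (s n))"
    using prestable_mono(2)[OF prestable] s X.pts_carrier
    by (simp add: cone_incseq_def X.cone_ball_Fm_obj X.Fm_obj_simps)
  show "cone_lub (Fm_obj Y) (\<lambda>n. g (s n)) (g x)"
    using stable s x s_inc lub by (simp add: stable_def X.cone_ball_Fm_obj image_subset_iff)
qed

lemma absolutely_monotone_coordinate: "absolutely_monotone X (\<lambda>x. g x b)"
  by unfold_locales (fact monotone_cube_map_coordinate, fact tendsto_map_coordinate)

end

lemma Fm_mor_full:
  assumes X: "pcspace X" and Y: "pcspace Y" and g: "g \<in> cstabm_hom (Fm_obj X) (Fm_obj Y)"
  shows "\<exists>f\<in>pcoh_hom X Y. Fm_mor X Y f = g"
proof -
  interpret stable_pcs_map X Y g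
    using X Y g by (simp add: stable_pcs_map_def stable_pcs_map_axioms_def cstabm_hom_def)
  interpret coord: absolutely_monotone X "\<lambda>x. g x b" for b
    by (rule absolutely_monotone_coordinate)
  have g_pts: "g \<in> pts X \<rightarrow>\<^sub>E pts Y"
    using g by (simp add: cstabm_hom_def X.cone_ball_Fm_obj Y.cone_ball_Fm_obj)
  define f where "f \<mu> b = (if \<mu> \<in> mfin (web X) \<and> b \<in> web Y then coord.taylor b \<mu> else 0)" for \<mu> b
  have series: "series X f x b = ennreal (g x b)" if x: "x \<in> pts X" for x b
  proof (cases "b \<in> web Y")
    case True
    then have "series X f x b = series X (\<lambda>\<mu> _. coord.taylor b \<mu>) x b"
      unfolding series_def f_def by (intro infsum_cong) auto
    then show ?thesis using coord.series_taylor[OF x] by simp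
  next
    case False
    have "g x \<in> pts Y" using g_pts x by auto
    then show ?thesis using False by (simp add: series_def f_def Y.pts_outside)
  qed
  have hat: "hat X f x = g x" if x: "x \<in> pts X" for x
    using PiE_mem[OF g_pts x] by (simp add: fun_eq_iff hat_def series[OF x] Y.pts_nonneg)
  show ?thesis
  proof
    show "Fm_mor X Y f = g"
      using hat g_pts by (auto simp: Fm_mor_def fun_eq_iff PiE_iff extensional_def)
    show "f \<in> pcoh_hom X Y"
      using hat g_pts series coord.taylor_nonneg by (auto simp: pcoh_hom_def f_def PiE_iff)
  qed
qed

lemma pcs_homI: "is_pcs X \<Longrightarrow> is_pcs Y \<Longrightarrow> f \<in> pcoh_hom X Y \<Longrightarrow> pcs_hom X Y f"
  by (simp add: pcs_hom_def pcspace_def pcs_hom_axioms_def)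

lemma Fm_mor_inject:
  assumes "pcs_hom X Y f" "pcs_hom X Y g" and eq: "Fm_mor X Y f = Fm_mor X Y g"
  shows "f = g"
proof (rule hat_inject[OF assms(1,2)])
  show "hat X f x = hat X g x" if "x \<in> pts X" for x
    using fun_cong[OF eq, of x] that by (simp add: Fm_mor_def)
qed

lemma pcs_hom_id:
  assumes "is_pcs X"
  shows "pcs_hom X X (pcoh_id X)" and hat_pcoh_id: "\<And>x. x \<in> pts X \<Longrightarrow> hat X (pcoh_id X) x = x"
proof -
  interpret X: pcspace X by (rule pcspace.intro[OF assms])
  have series: "series X (pcoh_id X) x b = ennreal (x b)" if x: "x \<in> pts X" for x b
  proof -
    have "series X (pcoh_id X) x b = (\<Sum>\<^sub>\<infinity>\<mu>\<in>(if b \<in> web X then {{#b#}} else {}). ennreal (x b))"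
      unfolding series_def
      by (rule infsum_cong_neutral) (auto simp: pcoh_id_def mfin_def split: if_splits)
    then show ?thesis using X.pts_outside[OF x, of b] by simp
  qed
  show hat: "\<And>x. x \<in> pts X \<Longrightarrow> hat X (pcoh_id X) x = x"
    using X.pts_nonneg by (auto simp: hat_def series fun_eq_iff)
  show "pcs_hom X X (pcoh_id X)"
    using hat series by (intro pcs_homI assms) (auto simp: pcoh_hom_def pcoh_id_def mfin_def)
qed

lemma pcs_hom_comp:
  fixes X Y Z :: "'a pcs"
  assumes f: "pcs_hom X Y f" and g: "pcs_hom Y Z g"
  shows "pcs_hom X Z (pcoh_comp X Y Z g f)"
    and hat_pcoh_comp: "\<And>x. x \<in> pts X \<Longrightarrow> hat X (pcoh_comp X Y Z g f) x = hat Y g (hat X f x)"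
proof -
  interpret f: pcs_hom X Y f by fact
  interpret g: pcs_hom Y Z g by fact
  let ?gf = "compose (cone_ball (Fm_obj X)) (Fm_mor Y Z g) (Fm_mor X Y f)"
  have "?gf \<in> cstabm_hom (Fm_obj X) (Fm_obj Z)"
    by (rule cstabm_hom_compose[OF f.X.measurable_cone_Fm_obj f.Y.measurable_cone_Fm_obj
          g.Y.measurable_cone_Fm_obj f.Fm_mor_hom g.Fm_mor_hom])
  then obtain h where h: "h \<in> pcoh_hom X Z" and h_eq: "Fm_mor X Z h = ?gf"
    using Fm_mor_full[OF f.X.pcspace_axioms g.Y.pcspace_axioms] by blast
  have hat: "hat X h x = hat Y g (hat X f x)" if "x \<in> pts X" for x
    using fun_cong[OF h_eq, of x] that f.hat_pts[OF that]
    by (simp add: Fm_mor_def compose_def f.X.cone_ball_Fm_obj)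
  have homI: "pcs_hom X Z h'" if "h' \<in> pcoh_hom X Z" for h'
    using f.X.is_pcs g.Y.is_pcs that by (rule pcs_homI)
  have "pcoh_comp X Y Z g f = h"
    unfolding pcoh_comp_def
  proof (rule the_equality)
    show "h \<in> pcoh_hom X Z \<and> (\<forall>x\<in>pts X. hat X h x = hat Y g (hat X f x))" using h hat by blast
    fix h' assume "h' \<in> pcoh_hom X Z \<and> (\<forall>x\<in>pts X. hat X h' x = hat Y g (hat X f x))"
    then show "h' = h" using hat by (intro hat_inject[OF homI homI[OF h]]) auto
  qed
  then show "pcs_hom X Z (pcoh_comp X Y Z g f)"
    "\<And>x. x \<in> pts X \<Longrightarrow> hat X (pcoh_comp X Y Z g f) x = hat Y g (hat X f x)"
    using homI[OF h] hat by auto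
qed

lemma is_category_Pcoh: "is_category (Pcoh :: ('a pcs, 'a multiset \<Rightarrow> 'a \<Rightarrow> real) category)"
proof -
  have unit: "pcoh_comp A A B f (pcoh_id A) = f" "pcoh_comp A B B (pcoh_id B) f = f"
    if f: "pcs_hom A B f" for A B :: "'a pcs" and f
  proof -
    interpret f: pcs_hom A B f by fact
    note A = pcs_hom_id[OF f.X.is_pcs] and B = pcs_hom_id[OF f.Y.is_pcs]
    show "pcoh_comp A A B f (pcoh_id A) = f"
      by (rule hat_inject[OF pcs_hom_comp(1)[OF A(1) f] f]) (simp add: hat_pcoh_comp[OF A(1) f] A(2))
    show "pcoh_comp A B B (pcoh_id B) f = f"
      by (rule hat_inject[OF pcs_hom_comp(1)[OF f B(1)] f])
        (simp add: hat_pcoh_comp[OF f B(1)] B(2) f.hat_pts)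
  qed
  have assoc: "pcoh_comp A C D h (pcoh_comp A B C g f) = pcoh_comp A B D (pcoh_comp B C D h g) f"
    if f: "pcs_hom A B f" and g: "pcs_hom B C g" and h: "pcs_hom C D h" for A B C D :: "'a pcs" and f g h
  proof (rule hat_inject)
    show "pcs_hom A D (pcoh_comp A C D h (pcoh_comp A B C g f))"
      "pcs_hom A D (pcoh_comp A B D (pcoh_comp B C D h g) f)"
      by (intro pcs_hom_comp f g h)+
    fix x assume "x \<in> pts A"
    then show "hat A (pcoh_comp A C D h (pcoh_comp A B C g f)) x =
        hat A (pcoh_comp A B D (pcoh_comp B C D h g) f) x"
      using f g h by (simp add: hat_pcoh_comp pcs_hom_comp pcs_hom.hat_pts[OF f])
  qed
  show ?thesis
    unfolding is_category_def Pcoh_def category.simps mem_Collect_eq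
    by (simp add: pcs_hom.hom[OF pcs_hom_id(1)] pcs_hom.hom[OF pcs_hom_comp(1)[OF pcs_homI pcs_homI]]
        unit[OF pcs_homI] assoc[OF pcs_homI pcs_homI pcs_homI])
qed

lemma is_functor_Fm: "is_functor (Pcoh :: ('a pcs, 'a multiset \<Rightarrow> 'a \<Rightarrow> real) category)
      (Cstabm :: (('a \<Rightarrow> real) mcone, ('a \<Rightarrow> real) \<Rightarrow> ('a \<Rightarrow> real)) category) Fm_obj Fm_mor"
proof -
  have ball: "cone_ball (Fm_obj X) = pts X" if "is_pcs X" for X :: "'a pcs"
    by (rule pcspace.cone_ball_Fm_obj[OF pcspace.intro[OF that]])
  have obj: "measurable_cone (Fm_obj X)" if "is_pcs X" for X :: "'a pcs"
    by (rule pcspace.measurable_cone_Fm_obj[OF pcspace.intro[OF that]])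
  have mor: "Fm_mor X Y f \<in> cstabm_hom (Fm_obj X) (Fm_obj Y)"
    if "is_pcs X" "is_pcs Y" "f \<in> pcoh_hom X Y" for X Y :: "'a pcs" and f
    by (rule pcs_hom.Fm_mor_hom[OF pcs_homI[OF that]])
  have id: "Fm_mor X X (pcoh_id X) = (\<lambda>x\<in>cone_ball (Fm_obj X). x)" if "is_pcs X" for X :: "'a pcs"
    by (simp add: Fm_mor_def ball[OF that] hat_pcoh_id[OF that] cong: restrict_cong)
  have comp: "Fm_mor X Z (pcoh_comp X Y Z g f) = compose (cone_ball (Fm_obj X)) (Fm_mor Y Z g) (Fm_mor X Y f)"
    if "is_pcs X" and f: "pcs_hom X Y f" and g: "pcs_hom Y Z g" for X Y Z :: "'a pcs" and f g
    using pcs_hom.hat_pts[OF f]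
    by (auto simp: Fm_mor_def compose_def ball[OF that(1)] hat_pcoh_comp[OF f g] fun_eq_iff)
  show ?thesis
    unfolding is_functor_def
    using is_category_Pcoh is_category_Cstabm obj mor id comp[OF _ pcs_homI pcs_homI]
    by (simp add: Pcoh_def Cstabm_def)
qed

theorem theorem5p8:
  "is_functor (Pcoh :: ('a pcs, 'a multiset \<Rightarrow> 'a \<Rightarrow> real) category)
      (Cstabm :: (('a \<Rightarrow> real) mcone, ('a \<Rightarrow> real) \<Rightarrow> ('a \<Rightarrow> real)) category) Fm_obj Fm_mor \<and>
   is_full (Pcoh :: ('a pcs, 'a multiset \<Rightarrow> 'a \<Rightarrow> real) category)
      (Cstabm :: (('a \<Rightarrow> real) mcone, ('a \<Rightarrow> real) \<Rightarrow> ('a \<Rightarrow> real)) category) Fm_obj Fm_mor \<and>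
   is_faithful (Pcoh :: ('a pcs, 'a multiset \<Rightarrow> 'a \<Rightarrow> real) category)
      (Fm_mor :: 'a pcs \<Rightarrow> 'a pcs \<Rightarrow> ('a multiset \<Rightarrow> 'a \<Rightarrow> real) \<Rightarrow> ('a \<Rightarrow> real) \<Rightarrow> ('a \<Rightarrow> real))"
proof (intro conjI is_functor_Fm)
  show "is_full (Pcoh :: ('a pcs, 'a multiset \<Rightarrow> 'a \<Rightarrow> real) category)
      (Cstabm :: (('a \<Rightarrow> real) mcone, ('a \<Rightarrow> real) \<Rightarrow> ('a \<Rightarrow> real)) category) Fm_obj Fm_mor"
    unfolding is_full_def Pcoh_def Cstabm_def category.simps
    using Fm_mor_full[OF pcspace.intro pcspace.intro] by blast
  show "is_faithful (Pcoh :: ('a pcs, 'a multiset \<Rightarrow> 'a \<Rightarrow> real) category)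
      (Fm_mor :: 'a pcs \<Rightarrow> 'a pcs \<Rightarrow> ('a multiset \<Rightarrow> 'a \<Rightarrow> real) \<Rightarrow> ('a \<Rightarrow> real) \<Rightarrow> ('a \<Rightarrow> real))"
    unfolding is_faithful_def Pcoh_def category.simps
    by (intro ballI inj_onI) (rule Fm_mor_inject[OF pcs_homI pcs_homI], simp_all)
qed

end
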